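(* Let $q>1$, let $\mathfrak{G}_\Gamma$ be a connected, finite $(q+1)$-regular graph and let $f\in C^{\mathrm{lc}}(\mathfrak{P}_\Gamma)$. Then: (i) The series defining the weighted dynamical Ihara zeta function $$\mathbf{Z}_f(s)=\sum_{[\mathbf{p}_0]\in\mathscr{P}_0}\frac{q^{(\frac12+is)\ell_0}}{1-q^{(\frac12+is)\ell_0}}\sum_{k=0}^{\ell_0-1}f(\sigma^k(\widehat{\mathbf{p}}_0))$$ converges absolutely for $\mathrm{Im}(s)>\frac32$. (ii) For every fixed $\vartheta\in(0,1)$, the function $\mathbf{Z}_f(s)$ continues meromorphically to the half-plane $$\mathscr{H}_{\vartheta,1}=\Big\{s\in\mathbb{C}\;\Big|\;\mathrm{Im}(s)>\frac32+\frac{\log\vartheta}{\log q}\Big\}.$$ Its poles in this half-plane are contained in the set of resonances of the transfer operator $\mathcal{L}_{\Gamma,\pm}$ acting on the Banach space $\mathcal{F}_\vartheta(\mathfrak{P}_\Gamma^\pm)$, i.e. every pole $s_0$ is such that $\lambda(s_0)=q^{-(\frac12+is_0)}$ belongs to the spectrum of $\mathcal{L}_{\Gamma,\pm}$ on $\mathcal{F}_\vartheta(\mathfrak{P}_\Gamma^\pm)$. (iii) If the meromorphically continued resolvent $\mathbf{R}(s)=(\mathrm{Id}-q^{\frac12+is}\mathcal{L}_{\Gamma,\pm})^{-1}$ on $\mathcal{F}_\vartheta(\mathfrak{P}_\Gamma^\pm)$ has a pole of order $J(s_0)$ at $s_0\in\mathscr{H}_{\vartheta,1}$, then for every $0\le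 k\le J(s_0)$ $$\mathrm{Res}_{s=s_0}\big[\mathbf{Z}_f(s)(\lambda(s)-\lambda(s_0))^k\big]=\frac{i}{\log q}\,\mathrm{Tr}\big[(\mathcal{L}_{\Gamma,\pm}-\lambda(s_0))^k\,\Pi_{s_0}f\big],$$ where $\lambda(s)=q^{-(\frac12+is)}$ and $\Pi_{s_0}$ is the Riesz spectral projector of $\mathcal{L}_{\Gamma,\pm}$ at the eigenvalue $\lambda(s_0)$.
   Context: Graph: $\mathfrak{G}_\Gamma=(\mathfrak{X}_\Gamma,\mathfrak{E}_\Gamma)$ is a finite connected simple $(q+1)$-regular graph: finite vertex set $\mathfrak{X}_\Gamma$, directed edges $\mathfrak{E}_\Gamma\subset\mathfrak{X}_\Gamma^2$, no loops, no multiple edges, $(x,y)\in\mathfrak{E}_\Gamma\Rightarrow(y,x)\in\mathfrak{E}_\Gamma$, every vertex has $q+1$ neighbours. For $\vec e=(a,b)$ put $\iota(\vec e)=a$, $\tau(\vec e)=b$, $\vec e^{\,\mathrm{op}}=(b,a)$. (It is the quotient of the $(q+1)$-regular tree by a discrete cocompact group $\Gamma$ acting freely; the path spaces below are the $\Gamma$-quotients of those of the tree.) Path spaces: a sequence of edges is admissible if consecutive edges $\vec a,\vec b$ satisfy $\tau(\vec a)=\iota(\vec b)$ and $\vec b\neq\vec a^{\,\mathrm{op}}$. $\mathfrak{P}_\Gamma^+$ is the set of admissible right-infinite sequences $(\vec e_1,\vec e_2,\ldots)$, with shift $\sigma_+$ dropping $\vec e_1$; $\mathfrak{P}_\Gamma^-$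 is the set of admissible left-infinite sequences $(\ldots,\vec e_2,\vec e_1)$, with shift $\sigma_-$ dropping $\vec e_1$. $\mathfrak{P}_\Gamma$ is the set of pairs $(\mathbf{p}_+,\mathbf{p}_-)$, $\mathbf{p}_+=(\vec e_1,\ldots)\in\mathfrak{P}_\Gamma^+$, $\mathbf{p}_-=(\ldots,\vec b_1)\in\mathfrak{P}_\Gamma^-$, with $\iota(\vec e_1)=\tau(\vec b_1)$ and $\vec e_1\ne\vec b_1^{\,\mathrm{op}}$ (i.e. admissible bi-infinite chains), with bijective shift $\sigma(\mathbf{p}_+,\mathbf{p}_-)=((\vec e_2,\vec e_3,\ldots),(\ldots,\vec b_2,\vec b_1,\vec e_1))$. $\pi_\pm:\mathfrak{P}_\Gamma\to\mathfrak{P}_\Gamma^\pm$ are the projections. $C^{\mathrm{lc}}(\cdot)$ denotes locally constant complex functions (depending on finitely many edges near the basepoint). Cycles: a closed path of length $n\ge3$ is an admissible sequence $(\vec e_1,\ldots,\vec e_n)$ with $\tau(\vec e_n)=\iota(\vec e_1)$ and $\vec e_1\ne\vec e_n^{\,\mathrm{op}}$; it is primitive if it is not a repetition of a shorter closed path. $\mathscr{P}_0$ is the set of primitive closed paths modulo cyclic rotation; $\ell_0$ is the length of $[\mathbf{p}_0]$, and $\widehat{\mathbf{p}}_0\in\mathfrak{P}_\Gamma$ is the bi-infinite periodic chain obtained by repeating a representative (so $\sigma^{\ell_0}(\widehat{\mathbf{p}}_0)=\widehat{\mathbf{p}}_0$). Transfer operator: $(\mathcal{L}_{\Gamma,\pm}\varphi)(\mathbf{p}_\pm)=\sum_{\sigma_\pm(\mathbf{p}'_\pm)=\mathbf{p}_\pm}\varphi(\mathbf{p}'_\pm)$.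 For $\vartheta\in(0,1)$, $d_\vartheta(\mathbf{p},\mathbf{p}')=\vartheta^{\kappa}$ with $\kappa$ the smallest $i\ge1$ such that the $i$-th edges (counted from $\vec e_1$) differ, and $d_\vartheta(\mathbf p,\mathbf p)=0$; $\mathcal{F}_\vartheta(\mathfrak{P}_\Gamma^\pm)$ is the Banach space of $d_\vartheta$-Lipschitz complex functions with norm (Lipschitz constant) $+\ \|\cdot\|_\infty$. The resolvent $\mathbf{R}(s)$ is defined for $\mathrm{Im}(s)$ large and extends meromorphically, with finite-rank principal parts, to $\mathscr{H}_{\vartheta,1}$. Meaning of $f$ in the trace in (iii): for the sign $+$, choose $m\ge1$ and $f_+\in C^{\mathrm{lc}}(\mathfrak{P}_\Gamma^+)$ with $f\circ\sigma^m=f_+\circ\pi_+$ (such a pair exists); then $\mathrm{Tr}[A f]:=\mathrm{Tr}[A M_{f_+}]$, the ordinary trace of a finite-rank operator, where $M_{f_+}$ is multiplication by $f_+$ on $\mathcal{F}_\vartheta(\mathfrak{P}^+_\Gamma)$. For the sign $-$ one uses the mirror-image reduction $f\circ\sigma^{-m}=f_-\circ\pi_-$ and $M_{f_-}$ on $\mathcal{F}_\vartheta(\mathfrak{P}_\Gamma^-)$. *)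

theory Defs
  imports
    "HOL-Complex_Analysis.Complex_Analysis"
    "HOL-Library.Stream"
    "Graph_Theory.Pair_Digraph"
    "Graph_Theory.Digraph_Component"
begin

type_synonym 'v edge = "'v \<times> 'v"

definition follows :: "'v edge \<Rightarrow> 'v edge \<Rightarrow> bool" where
  "follows a b \<longleftrightarrow> snd a = fst b \<and> b \<noteq> prod.swap a"

datatype side = Plus | Minus

text \<open>
  Both kinds of half-infinite paths are streams read off from the base point: a left-infinite
  path \<open>(\<dots>, e\<^sub>2, e\<^sub>1)\<close> is the stream \<open>e\<^sub>1, e\<^sub>2, \<dots>\<close>. With this encoding both one-sided shifts
  are \<^const>\<open>stl\<close>.
\<close>

fun half_paths :: "'v pair_pre_digraph \<Rightarrow> side \<Rightarrow> 'v edge stream set" where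
  "half_paths G Plus  = {p. sset p \<subseteq> parcs G \<and> (\<forall>i. follows (p !! i) (p !! Suc i))}"
| "half_paths G Minus = {p. sset p \<subseteq> parcs G \<and> (\<forall>i. follows (p !! Suc i) (p !! i))}"

definition paths :: "'v pair_pre_digraph \<Rightarrow> ('v edge stream \<times> 'v edge stream) set" where
  "paths G = {(p, b). p \<in> half_paths G Plus \<and> b \<in> half_paths G Minus \<and> follows (shd b) (shd p)}"

fun half :: "side \<Rightarrow> 'v edge stream \<times> 'v edge stream \<Rightarrow> 'v edge stream" where
  "half Plus p = fst p"
| "half Minus p = snd p"

text \<open>\<open>shift Plus\<close> is the two-sided shift and \<open>shift Minus\<close> is its inverse.\<close>

fun shift :: "side \<Rightarrow> 'v edge stream \<times> 'v edge stream \<Rightarrow> 'v edge stream \<times> 'v edge stream" where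
  "shift Plus (p, b) = (stl p, shd p ## b)"
| "shift Minus (p, b) = (shd b ## p, stl b)"

definition loc_const :: "'v pair_pre_digraph \<Rightarrow> ('v edge stream \<times> 'v edge stream \<Rightarrow> complex) set" where
  "loc_const G = {f. \<exists>N. \<forall>p\<in>paths G. \<forall>p'\<in>paths G.
     stake N (fst p) = stake N (fst p') \<and> stake N (snd p) = stake N (snd p') \<longrightarrow> f p = f p'}"

definition loc_const_half :: "'v pair_pre_digraph \<Rightarrow> side \<Rightarrow> ('v edge stream \<Rightarrow> complex) set" where
  "loc_const_half G \<epsilon> = {g. \<exists>N. \<forall>p\<in>half_paths G \<epsilon>. \<forall>p'\<in>half_paths G \<epsilon>.
     stake N p = stake N p' \<longrightarrow> g p = g p'}"

definition is_reduction ::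
  "'v pair_pre_digraph \<Rightarrow> side \<Rightarrow> ('v edge stream \<times> 'v edge stream \<Rightarrow> complex) \<Rightarrow>
   nat \<Rightarrow> ('v edge stream \<Rightarrow> complex) \<Rightarrow> bool" where
  "is_reduction G \<epsilon> f m g \<longleftrightarrow>
     m \<ge> 1 \<and> g \<in> loc_const_half G \<epsilon> \<and> (\<forall>p\<in>paths G. f ((shift \<epsilon> ^^ m) p) = g (half \<epsilon> p))"

definition closed_path :: "'v pair_pre_digraph \<Rightarrow> 'v edge list \<Rightarrow> bool" where
  "closed_path G c \<longleftrightarrow>
     length c \<ge> 3 \<and> set c \<subseteq> parcs G \<and> successively follows c \<and> follows (last c) (hd c)"

definition primitive_path :: "'v pair_pre_digraph \<Rightarrow> 'v edge list \<Rightarrow> bool" where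
  "primitive_path G c \<longleftrightarrow> closed_path G c \<and>
     \<not> (\<exists>c' m. closed_path G c' \<and> length c' < length c \<and> c = concat (replicate m c'))"

definition primitive_cycles :: "'v pair_pre_digraph \<Rightarrow> 'v edge list set set" where
  "primitive_cycles G =
     {c. primitive_path G c} // {(c, rotate k c) | c k. primitive_path G c}"

definition periodic_path :: "'v edge list \<Rightarrow> 'v edge stream \<times> 'v edge stream" where
  "periodic_path c = (cycle c, cycle (rev c))"

definition zeta_term ::
  "nat \<Rightarrow> ('v edge stream \<times> 'v edge stream \<Rightarrow> complex) \<Rightarrow> complex \<Rightarrow> 'v edge list set \<Rightarrow> complex" where
  "zeta_term q f s C =
     (let c = (SOME c. c \<in> C);
          l = length c;
          w = of_nat q powr ((1/2 + \<i> * s) * of_nat l)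
      in w / (1 - w) * (\<Sum>k<l. f ((shift Plus ^^ k) (periodic_path c))))"

definition weighted_zeta ::
  "'v pair_pre_digraph \<Rightarrow> nat \<Rightarrow> ('v edge stream \<times> 'v edge stream \<Rightarrow> complex) \<Rightarrow> complex \<Rightarrow> complex" where
  "weighted_zeta G q f s = (\<Sum>\<^sub>\<infinity>C\<in>primitive_cycles G. zeta_term q f s C)"

definition half_plane :: "nat \<Rightarrow> real \<Rightarrow> complex set" where
  "half_plane q \<theta> = {s. Im s > 3/2 + ln \<theta> / ln (real q)}"

definition is_zeta_continuation ::
  "'v pair_pre_digraph \<Rightarrow> nat \<Rightarrow> ('v edge stream \<times> 'v edge stream \<Rightarrow> complex) \<Rightarrow>
   real \<Rightarrow> (complex \<Rightarrow> complex) \<Rightarrow> bool" where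
  "is_zeta_continuation G q f \<theta> Z \<longleftrightarrow>
     Z meromorphic_on half_plane q \<theta> \<and> (\<forall>s. Im s > 3/2 \<longrightarrow> Z s = weighted_zeta G q f s)"

text \<open>
  The Banach spaces needed below depend on the graph, so they are carrier sets \<open>V\<close> of functions
  with a norm \<open>N\<close> on \<open>V\<close>, and operators matter only through their values on \<open>V\<close>.
\<close>

definition bounded_operator ::
  "('x \<Rightarrow> complex) set \<Rightarrow> (('x \<Rightarrow> complex) \<Rightarrow> real) \<Rightarrow> (('x \<Rightarrow> complex) \<Rightarrow> ('x \<Rightarrow> complex)) \<Rightarrow> bool" where
  "bounded_operator V N A \<longleftrightarrow>
     A ` V \<subseteq> V \<and>
     (\<forall>\<phi>\<in>V. \<forall>\<psi>\<in>V. \<forall>a b. A (\<lambda>p. a * \<phi> p + b * \<psi> p) = (\<lambda>p. a * A \<phi> p + b * A \<psi> p)) \<and>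
     (\<exists>C. \<forall>\<phi>\<in>V. N (A \<phi>) \<le> C * N \<phi>)"

definition operator_norm ::
  "('x \<Rightarrow> complex) set \<Rightarrow> (('x \<Rightarrow> complex) \<Rightarrow> real) \<Rightarrow> (('x \<Rightarrow> complex) \<Rightarrow> ('x \<Rightarrow> complex)) \<Rightarrow> real" where
  "operator_norm V N A = Inf {C. C \<ge> 0 \<and> (\<forall>\<phi>\<in>V. N (A \<phi>) \<le> C * N \<phi>)}"

definition is_inverse_operator ::
  "('x \<Rightarrow> complex) set \<Rightarrow> (('x \<Rightarrow> complex) \<Rightarrow> real) \<Rightarrow>
   (('x \<Rightarrow> complex) \<Rightarrow> ('x \<Rightarrow> complex)) \<Rightarrow> (('x \<Rightarrow> complex) \<Rightarrow> ('x \<Rightarrow> complex)) \<Rightarrow> bool" where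
  "is_inverse_operator V N A B \<longleftrightarrow>
     bounded_operator V N B \<and> (\<forall>\<phi>\<in>V. B (A \<phi>) = \<phi> \<and> A (B \<phi>) = \<phi>)"

definition spectrum ::
  "('x \<Rightarrow> complex) set \<Rightarrow> (('x \<Rightarrow> complex) \<Rightarrow> real) \<Rightarrow> (('x \<Rightarrow> complex) \<Rightarrow> ('x \<Rightarrow> complex)) \<Rightarrow> complex set" where
  "spectrum V N T = {\<zeta>. \<not> (\<exists>B. is_inverse_operator V N (\<lambda>\<phi> p. \<zeta> * \<phi> p - T \<phi> p) B)}"

definition resolvent ::
  "('x \<Rightarrow> complex) set \<Rightarrow> (('x \<Rightarrow> complex) \<Rightarrow> real) \<Rightarrow> (('x \<Rightarrow> complex) \<Rightarrow> ('x \<Rightarrow> complex)) \<Rightarrow>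
   complex \<Rightarrow> (('x \<Rightarrow> complex) \<Rightarrow> ('x \<Rightarrow> complex))" where
  "resolvent V N T \<zeta> = (SOME B. is_inverse_operator V N (\<lambda>\<phi> p. \<zeta> * \<phi> p - T \<phi> p) B)"

text \<open>
  The Riesz projector \<open>1 / (2\<pi>\<i>) \<ointegral> (\<zeta> - T)\<^sup>-\<^sup>1 d\<zeta>\<close> over small circles around \<open>\<mu>\<close>. Point evaluations are
  bounded functionals on the spaces used below, so the operator-valued integral can be computed
  pointwise; the integral over all sufficiently small circles is the library's \<^const>\<open>residue\<close>.
\<close>

definition riesz_projector ::
  "('x \<Rightarrow> complex) set \<Rightarrow> (('x \<Rightarrow> complex) \<Rightarrow> real) \<Rightarrow> (('x \<Rightarrow> complex) \<Rightarrow> ('x \<Rightarrow> complex)) \<Rightarrow>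
   complex \<Rightarrow> (('x \<Rightarrow> complex) \<Rightarrow> ('x \<Rightarrow> complex))" where
  "riesz_projector V N T \<mu> = (\<lambda>\<phi> p. residue (\<lambda>\<zeta>. resolvent V N T \<zeta> \<phi> p) \<mu>)"

text \<open>\<open>A = (\<Sum>i<n. l i \<otimes> u i)\<close> on \<open>V\<close>, with linear functionals \<open>l i\<close> and vectors \<open>u i\<close>.\<close>

definition rank_decomposition ::
  "('x \<Rightarrow> complex) set \<Rightarrow> (('x \<Rightarrow> complex) \<Rightarrow> ('x \<Rightarrow> complex)) \<Rightarrow>
   nat \<Rightarrow> (nat \<Rightarrow> ('x \<Rightarrow> complex) \<Rightarrow> complex) \<Rightarrow> (nat \<Rightarrow> 'x \<Rightarrow> complex) \<Rightarrow> bool" where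
  "rank_decomposition V A n l u \<longleftrightarrow>
     (\<forall>i<n. u i \<in> V \<and>
        (\<forall>\<phi>\<in>V. \<forall>\<psi>\<in>V. \<forall>a b. l i (\<lambda>p. a * \<phi> p + b * \<psi> p) = a * l i \<phi> + b * l i \<psi>)) \<and>
     (\<forall>\<phi>\<in>V. A \<phi> = (\<lambda>p. \<Sum>i<n. l i \<phi> * u i p))"

definition finite_rank ::
  "('x \<Rightarrow> complex) set \<Rightarrow> (('x \<Rightarrow> complex) \<Rightarrow> ('x \<Rightarrow> complex)) \<Rightarrow> bool" where
  "finite_rank V A \<longleftrightarrow> (\<exists>n l u. rank_decomposition V A n l u)"

text \<open>The number \<open>\<Sum>i<n. l i (u i)\<close> does not depend on the decomposition.\<close>

definition finite_rank_trace ::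
  "('x \<Rightarrow> complex) set \<Rightarrow> (('x \<Rightarrow> complex) \<Rightarrow> ('x \<Rightarrow> complex)) \<Rightarrow> complex" where
  "finite_rank_trace V A = (THE t. \<exists>n l u. rank_decomposition V A n l u \<and> t = (\<Sum>i<n. l i (u i)))"

definition operator_holomorphic_on ::
  "('x \<Rightarrow> complex) set \<Rightarrow> (('x \<Rightarrow> complex) \<Rightarrow> real) \<Rightarrow>
   (complex \<Rightarrow> ('x \<Rightarrow> complex) \<Rightarrow> ('x \<Rightarrow> complex)) \<Rightarrow> complex set \<Rightarrow> bool" where
  "operator_holomorphic_on V N H U \<longleftrightarrow>
     (\<forall>s\<in>U. bounded_operator V N (H s) \<and>
        (\<exists>D. bounded_operator V N D \<and>
           ((\<lambda>h. operator_norm V N (\<lambda>\<phi> p. (H (s + h) \<phi> p - H s \<phi> p) / h - D \<phi> p)) \<longlongrightarrow> 0) (at 0)))"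

text \<open>
  \<open>R s = (\<Sum>j=1..n. A j / (s - s\<^sub>0) ^ j) + (holomorphic)\<close> near \<open>s\<^sub>0\<close>. As for the library's
  \<^const>\<open>meromorphic_on\<close>, the value of \<open>R\<close> at \<open>s\<^sub>0\<close> itself is irrelevant.
\<close>

definition principal_part ::
  "('x \<Rightarrow> complex) set \<Rightarrow> (('x \<Rightarrow> complex) \<Rightarrow> real) \<Rightarrow>
   (complex \<Rightarrow> ('x \<Rightarrow> complex) \<Rightarrow> ('x \<Rightarrow> complex)) \<Rightarrow> complex \<Rightarrow>
   nat \<Rightarrow> (nat \<Rightarrow> ('x \<Rightarrow> complex) \<Rightarrow> ('x \<Rightarrow> complex)) \<Rightarrow> bool" where
  "principal_part V N R s\<^sub>0 n A \<longleftrightarrow>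
     (\<forall>j\<in>{1..n}. bounded_operator V N (A j)) \<and>
     (\<exists>r>0. \<exists>H. operator_holomorphic_on V N H (ball s\<^sub>0 r) \<and>
        (\<forall>s\<in>ball s\<^sub>0 r - {s\<^sub>0}. \<forall>\<phi>\<in>V.
           R s \<phi> = (\<lambda>p. (\<Sum>j=1..n. A j \<phi> p / (s - s\<^sub>0) ^ j) + H s \<phi> p)))"

definition operator_meromorphic_on ::
  "('x \<Rightarrow> complex) set \<Rightarrow> (('x \<Rightarrow> complex) \<Rightarrow> real) \<Rightarrow>
   (complex \<Rightarrow> ('x \<Rightarrow> complex) \<Rightarrow> ('x \<Rightarrow> complex)) \<Rightarrow> complex set \<Rightarrow> bool" where
  "operator_meromorphic_on V N R U \<longleftrightarrow>
     (\<forall>s\<^sub>0\<in>U. \<exists>n A. principal_part V N R s\<^sub>0 n A \<and> (\<forall>j\<in>{1..n}. finite_rank V (A j)))"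

definition has_pole_of_order ::
  "('x \<Rightarrow> complex) set \<Rightarrow> (('x \<Rightarrow> complex) \<Rightarrow> real) \<Rightarrow>
   (complex \<Rightarrow> ('x \<Rightarrow> complex) \<Rightarrow> ('x \<Rightarrow> complex)) \<Rightarrow> complex \<Rightarrow> nat \<Rightarrow> bool" where
  "has_pole_of_order V N R s\<^sub>0 J \<longleftrightarrow>
     J \<ge> 1 \<and> (\<exists>A. principal_part V N R s\<^sub>0 J A \<and> (\<exists>\<phi>\<in>V. A J \<phi> \<noteq> (\<lambda>_. 0)))"

definition path_dist :: "real \<Rightarrow> 'v edge stream \<Rightarrow> 'v edge stream \<Rightarrow> real" where
  "path_dist \<theta> p p' =
     (if p = p' then 0 else \<theta> ^ (LEAST i. i \<ge> 1 \<and> p !! (i - 1) \<noteq> p' !! (i - 1)))"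

definition lipschitz_bounds ::
  "real \<Rightarrow> 'v edge stream set \<Rightarrow> ('v edge stream \<Rightarrow> complex) \<Rightarrow> real set" where
  "lipschitz_bounds \<theta> P \<phi> =
     {C. C \<ge> 0 \<and> (\<forall>p\<in>P. \<forall>p'\<in>P. norm (\<phi> p - \<phi> p') \<le> C * path_dist \<theta> p p')}"

text \<open>Functions on \<open>P\<close> are represented by their extension by zero.\<close>

definition lip_space :: "real \<Rightarrow> 'v edge stream set \<Rightarrow> ('v edge stream \<Rightarrow> complex) set" where
  "lip_space \<theta> P = {\<phi>. (\<forall>p. p \<notin> P \<longrightarrow> \<phi> p = 0) \<and> lipschitz_bounds \<theta> P \<phi> \<noteq> {}}"

definition lip_norm ::
  "real \<Rightarrow> 'v edge stream set \<Rightarrow> ('v edge stream \<Rightarrow> complex) \<Rightarrow> real" where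
  "lip_norm \<theta> P \<phi> = Inf (lipschitz_bounds \<theta> P \<phi>) + (SUP p\<in>P. norm (\<phi> p))"

definition transfer ::
  "'v edge stream set \<Rightarrow> ('v edge stream \<Rightarrow> complex) \<Rightarrow> ('v edge stream \<Rightarrow> complex)" where
  "transfer P \<phi> = (\<lambda>p. \<Sum>p'\<in>{p'\<in>P. stl p' = p}. \<phi> p')"

definition eigval :: "nat \<Rightarrow> complex \<Rightarrow> complex" where
  "eigval q s = of_nat q powr (- (1/2 + \<i> * s))"

definition is_resolvent_continuation ::
  "'v edge stream set \<Rightarrow> nat \<Rightarrow> real \<Rightarrow>
   (complex \<Rightarrow> ('v edge stream \<Rightarrow> complex) \<Rightarrow> ('v edge stream \<Rightarrow> complex)) \<Rightarrow> bool" where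
  "is_resolvent_continuation P q \<theta> R \<longleftrightarrow>
     operator_meromorphic_on (lip_space \<theta> P) (lip_norm \<theta> P) R (half_plane q \<theta>) \<and>
     (\<exists>c. \<forall>s. Im s > c \<longrightarrow>
        is_inverse_operator (lip_space \<theta> P) (lip_norm \<theta> P)
          (\<lambda>\<phi> p. \<phi> p - of_nat q powr (1/2 + \<i> * s) * transfer P \<phi> p) (R s))"

end

theory Submission
  imports Defs "Jordan_Normal_Form.Char_Poly"
begin

text \<open>
  Let \<open>L\<close> be the transfer operator and \<open>l\<close> the spectral parameter. Fix \<open>n\<close> and split the Lipschitz functions
  into functions of the first \<open>n\<close> letters and functions vanishing at one chosen base point of every
  cylinder of length \<open>n\<close>. The first summand is \<open>L\<close>-invariant and finite-dimensional; on the quotient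
  \<open>L\<close> has norm at most \<open>q\<theta>\<close>. So for \<open>norm l > q\<theta>\<close> the resolvent is a Neumann series together with the
  inverse of a matrix \<open>l - T\<close>, which gives its meromorphic continuation with finite-rank principal parts.
  If the reduction \<open>g\<close> of \<open>f\<close> depends on \<open>n\<close> letters, then the trace of \<open>\<phi> \<mapsto> L\<^sup>m (g \<phi>)\<close> on the first
  summand is the sum of \<open>g\<close> over the points of period \<open>m\<close>. Regrouping the zeta function by closed paths
  instead of primitive ones therefore yields \<open>l F(l) - F\<^sub>0\<close> with \<open>F(l)\<close> the trace of \<open>\<phi> \<mapsto> (l - T)\<^sup>-\<^sup>1 (g \<phi>)\<close>
  (a rational function) and \<open>F\<^sub>0\<close> that of multiplication by \<open>g\<close>, and its residues follow from the
  change of variables from \<open>s\<close> to \<open>l\<close>.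
\<close>

subsection \<open>Traces of finite-rank operators\<close>

text \<open>The factor \<open>q\<theta>\<close> has two sources: a path has at most \<open>q\<close>
  preimages, and prepending a letter shrinks distances by \<open>\<theta>\<close>. The second gain
  is available only between paths of one cylinder, because these have the same preimage letters;
  this dictates the splitting along cylinders, with evaluation at base points as the projection. The
  Neumann part of the resolvent is holomorphic for \<open>norm l > q\<theta>\<close>, so all
  singularities there come from the matrix block. Spectral projectors and principal parts therefore
  take values in cylinder functions, and their traces are diagonal sums over words. As
  \<open>V\<close> is only a carrier set, operator-valued holomorphy is derived from pointwise
  holomorphy with uniform Lipschitz bounds, by divided differences and the maximum modulus
  principle. The two signs differ only in the direction of the adjacency relation, so one abstract
  subshift serves both. The shift hidden in a reduction drops out of the zeta function because
  rotation permutes the closed paths of each length.\<close>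

definition lin_closed :: "('x \<Rightarrow> complex) set \<Rightarrow> bool" where
  "lin_closed V \<longleftrightarrow> (\<forall>\<phi>\<in>V. \<forall>\<psi>\<in>V. \<forall>a b. (\<lambda>p. a * \<phi> p + b * \<psi> p) \<in> V)"

definition lin_functional :: "('x \<Rightarrow> complex) set \<Rightarrow> (('x \<Rightarrow> complex) \<Rightarrow> complex) \<Rightarrow> bool" where
  "lin_functional V l \<longleftrightarrow>
     (\<forall>\<phi>\<in>V. \<forall>\<psi>\<in>V. \<forall>a b. l (\<lambda>p. a * \<phi> p + b * \<psi> p) = a * l \<phi> + b * l \<psi>)"

lemma lin_closedD: "lin_closed V \<Longrightarrow> \<phi> \<in> V \<Longrightarrow> \<psi> \<in> V \<Longrightarrow> (\<lambda>p. a * \<phi> p + b * \<psi> p) \<in> V"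
  by (simp add: lin_closed_def)

lemma lin_functionalD:
  "lin_functional V l \<Longrightarrow> \<phi> \<in> V \<Longrightarrow> \<psi> \<in> V \<Longrightarrow> l (\<lambda>p. a * \<phi> p + b * \<psi> p) = a * l \<phi> + b * l \<psi>"
  by (simp add: lin_functional_def)

lemma lin_functional_sum:
  assumes V: "lin_closed V" and l: "lin_functional V l" and w: "\<And>i. i < n \<Longrightarrow> w i \<in> V"
    and ne: "V \<noteq> {}"
  shows "(\<lambda>p. \<Sum>i<n. a i * w i p) \<in> V \<and> l (\<lambda>p. \<Sum>i<(n::nat). a i * w i p) = (\<Sum>i<n. a i * l (w i))"
  using w
proof (induction n)
  case 0
  obtain \<phi> where \<phi>: "\<phi> \<in> V" using ne by auto
  have "(\<lambda>p. 0 * \<phi> p + 0 * \<phi> p) \<in> V" by (rule lin_closedD[OF V \<phi> \<phi>])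
  moreover have "l (\<lambda>p. 0 * \<phi> p + 0 * \<phi> p) = 0 * l \<phi> + 0 * l \<phi>"
    by (rule lin_functionalD[OF l \<phi> \<phi>])
  ultimately show ?case by simp
next
  case (Suc n)
  have IH: "(\<lambda>p. \<Sum>i<n. a i * w i p) \<in> V" "l (\<lambda>p. \<Sum>i<n. a i * w i p) = (\<Sum>i<n. a i * l (w i))"
    using Suc by auto
  have wn: "w n \<in> V" using Suc by simp
  have "(\<lambda>p. 1 * (\<Sum>i<n. a i * w i p) + a n * w n p) \<in> V"
    by (rule lin_closedD[OF V IH(1) wn])
  moreover have "l (\<lambda>p. 1 * (\<Sum>i<n. a i * w i p) + a n * w n p)
     = 1 * l (\<lambda>p. \<Sum>i<n. a i * w i p) + a n * l (w n)"
    by (rule lin_functionalD[OF l IH(1) wn])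
  ultimately show ?case using IH(2) by simp
qed

text \<open>Behind the uniqueness of the trace. If \<open>l n\<close> is nonzero at some
  \<open>\<phi>\<close>, the relation at \<open>\<phi>\<close> expresses \<open>w n\<close> through
  the other vectors; substituting this moves \<open>l n\<close> into the remaining functionals
  without changing the sum \<open>\<Sum>i. l i (w i)\<close>, and one summand fewer is left.\<close>

lemma trace_of_zero_decomposition:
  fixes l :: "nat \<Rightarrow> ('x \<Rightarrow> complex) \<Rightarrow> complex"
  assumes V: "lin_closed V"
    and "\<And>i. i < n \<Longrightarrow> lin_functional V (l i)" and "\<And>i. i < n \<Longrightarrow> w i \<in> V"
    and "\<And>\<phi> p. \<phi> \<in> V \<Longrightarrow> (\<Sum>i<n. l i \<phi> * w i p) = 0"
  shows "(\<Sum>i<n. l i (w i)) = 0"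
  using assms(2-)
proof (induction n arbitrary: l)
  case (Suc n)
  have ln: "lin_functional V (l n)" and wn: "w n \<in> V" using Suc.prems by auto
  show ?case
  proof (cases "\<forall>\<phi>\<in>V. l n \<phi> = 0")
    case True
    have "(\<Sum>i<n. l i (w i)) = 0"
    proof (rule Suc.IH)
      fix \<phi> p assume "\<phi> \<in> V"
      then show "(\<Sum>i<n. l i \<phi> * w i p) = 0" using Suc.prems(3)[of \<phi> p] True by simp
    qed (use Suc.prems in auto)
    then show ?thesis using True wn by simp
  next
    case False
    then obtain \<phi> where \<phi>: "\<phi> \<in> V" "l n \<phi> \<noteq> 0" by blast
    define a where "a i = - l i \<phi> / l n \<phi>" for i
    have wn_eq: "w n = (\<lambda>p. \<Sum>i<n. a i * w i p)"
    proof
      fix p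
      have "(\<Sum>i<n. l i \<phi> * w i p) + l n \<phi> * w n p = 0"
        using Suc.prems(3)[OF \<phi>(1), of p] by simp
      then have "w n p = - (\<Sum>i<n. l i \<phi> * w i p) / l n \<phi>"
        using \<phi>(2) by (simp add: field_simps add_eq_0_iff)
      then show "w n p = (\<Sum>i<n. a i * w i p)"
        by (simp add: a_def sum_negf[symmetric] sum_divide_distrib)
    qed
    define l' where "l' i \<psi> = l i \<psi> + a i * l n \<psi>" for i \<psi>
    have "(\<Sum>i<n. l' i (w i)) = 0"
    proof (rule Suc.IH)
      fix i assume i: "i < n"
      have "lin_functional V (l i)" using Suc.prems i by simp
      with ln show "lin_functional V (l' i)" unfolding lin_functional_def l'_def
        by (auto simp: algebra_simps)
      show "w i \<in> V" using Suc.prems i by simp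
    next
      fix \<psi> p assume \<psi>: "\<psi> \<in> V"
      have "(\<Sum>i<n. l' i \<psi> * w i p) = (\<Sum>i<n. l i \<psi> * w i p) + l n \<psi> * (\<Sum>i<n. a i * w i p)"
        by (simp add: l'_def algebra_simps sum.distrib sum_distrib_left)
      also have "\<dots> = (\<Sum>i<Suc n. l i \<psi> * w i p)" by (simp add: wn_eq)
      also have "\<dots> = 0" using Suc.prems(3) \<psi> by blast
      finally show "(\<Sum>i<n. l' i \<psi> * w i p) = 0" .
    qed
    moreover have "l n (w n) = (\<Sum>i<n. a i * l n (w i))"
      unfolding wn_eq using lin_functional_sum[OF V ln, of n w a] Suc.prems(2) \<phi> by auto
    ultimately show ?thesis by (simp add: l'_def sum.distrib)
  qed
qed simp

text \<open>Two decompositions of \<open>A\<close>, the second with negated functionals, concatenate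
  to a decomposition of zero. The \<open>THE\<close> in the definition is thereby resolved.\<close>

lemma finite_rank_trace_eq:
  assumes V: "lin_closed V" and D: "rank_decomposition V A n l u"
  shows "finite_rank_trace V A = (\<Sum>i<n. l i (u i))"
  unfolding finite_rank_trace_def
proof (rule the_equality)
  show "\<exists>n' l' u'. rank_decomposition V A n' l' u' \<and> (\<Sum>i<n. l i (u i)) = (\<Sum>i<n'. l' i (u' i))"
    using D by blast
next
  fix t assume "\<exists>n l u. rank_decomposition V A n l u \<and> t = (\<Sum>i<n. l i (u i))"
  then obtain n' l' u' where D': "rank_decomposition V A n' l' u'" and t: "t = (\<Sum>i<n'. l' i (u' i))"
    by blast
  define L where "L i = (if i < n then l i else (\<lambda>\<phi>. - l' (i - n) \<phi>))" for i
  define U where "U i = (if i < n then u i else u' (i - n))" for i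
  have split: "(\<Sum>i<n+m. h i) = (\<Sum>i<n. h i) + (\<Sum>i<m. h (n + i))" for m and h :: "nat \<Rightarrow> complex"
    by (induction m) (auto simp: add.assoc)
  have "(\<Sum>i<n+n'. L i (U i)) = 0"
  proof (rule trace_of_zero_decomposition[OF V, where l = L and w = U])
    fix i assume i: "i < n + n'"
    show "lin_functional V (L i)"
    proof (cases "i < n")
      case True
      then show ?thesis using D unfolding rank_decomposition_def lin_functional_def L_def by simp
    next
      case False
      then have "i - n < n'" using i by simp
      then have "lin_functional V (l' (i - n))"
        using D' unfolding rank_decomposition_def lin_functional_def by blast
      then show ?thesis using False unfolding L_def lin_functional_def by (auto simp: algebra_simps)
    qed
    show "U i \<in> V" using i D D' unfolding U_def rank_decomposition_def by auto
  next
    fix \<phi> p assume \<phi>: "\<phi> \<in> V"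
    have "A \<phi> p = (\<Sum>i<n. l i \<phi> * u i p)" "A \<phi> p = (\<Sum>i<n'. l' i \<phi> * u' i p)"
      using D D' \<phi> unfolding rank_decomposition_def by (metis)+
    then show "(\<Sum>i<n+n'. L i \<phi> * U i p) = 0"
      unfolding split by (simp add: L_def U_def sum_negf)
  qed
  then show "t = (\<Sum>i<n. l i (u i))" unfolding split t by (simp add: L_def U_def sum_negf)
qed

subsection \<open>Resolvents of finite matrices\<close>

text \<open>\<open>d\<close> is the characteristic polynomial of \<open>T\<close> and
  \<open>adj\<close> the adjugate of \<open>x - T\<close>, so the two identities are those of the
  adjugate from either side. The rows are renumbered by an enumeration \<open>h\<close> of
  \<open>I\<close>.\<close>

lemma matrix_resolvent_polynomials:
  fixes T :: "'i \<Rightarrow> 'i \<Rightarrow> complex"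
  assumes fin: "finite I"
  obtains adj :: "'i \<Rightarrow> 'i \<Rightarrow> complex poly" and d :: "complex poly" where
    "d \<noteq> 0"
    "\<And>x i j. i \<in> I \<Longrightarrow> j \<in> I \<Longrightarrow>
       x * poly (adj i j) x - (\<Sum>k\<in>I. T i k * poly (adj k j) x) = (if i = j then poly d x else 0)"
    "\<And>x i j. i \<in> I \<Longrightarrow> j \<in> I \<Longrightarrow>
       x * poly (adj i j) x - (\<Sum>k\<in>I. poly (adj i k) x * T k j) = (if i = j then poly d x else 0)"
    "\<And>x. poly d x = 0 \<Longrightarrow> \<exists>v. (\<exists>i\<in>I. v i \<noteq> 0) \<and> (\<forall>i\<in>I. (\<Sum>k\<in>I. T i k * v k) = x * v i)"
proof -
  define n where "n = card I"
  obtain h where h: "bij_betw h {0..<n} I" using ex_bij_betw_nat_finite[OF fin] n_def by blast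
  define g where "g = inv_into {0..<n} h"
  have gh: "g (h k) = k" if "k < n" for k
    using h that unfolding g_def by (simp add: bij_betw_inv_into_left)
  have hg: "h (g i) = i" and gn: "g i < n" if "i \<in> I" for i
    using h that unfolding g_def
    by (simp_all add: bij_betw_inv_into_right)
       (metis atLeastLessThan_iff bij_betwE bij_betw_inv_into)
  have gij: "g i = g j \<longleftrightarrow> i = j" if "i \<in> I" "j \<in> I" for i j
    using hg(1)[OF that(1)] hg(1)[OF that(2)] by metis
  have hI: "h k \<in> I" if "k < n" for k using h that by (auto simp: bij_betw_def)
  define A where "A = Matrix.mat n n (\<lambda>(i,j). T (h i) (h j))"
  have A: "A \<in> carrier_mat n n" unfolding A_def by simp
  define B where "B = char_poly_matrix A"
  have B: "B \<in> carrier_mat n n" unfolding B_def using A by simp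
  have Bij: "B $$ (i,j) = (if i = j then [:0,1:] else 0) + [:- T (h i) (h j):]" if "i < n" "j < n" for i j
    using that unfolding B_def char_poly_matrix_def A_def by simp
  define d where "d = char_poly A"
  define C where "C = adj_mat B"
  have C: "C \<in> carrier_mat n n" and BC: "B * C = d \<cdot>\<^sub>m 1\<^sub>m n" and CB: "C * B = d \<cdot>\<^sub>m 1\<^sub>m n"
    using adj_mat[OF B] unfolding C_def d_def char_poly_def B_def by auto
  define adj where "adj i j = C $$ (g i, g j)" for i j
  have reindex: "(\<Sum>k\<in>I. f k) = (\<Sum>k<n. f (h k))" for f :: "'i \<Rightarrow> complex"
    using sum.reindex_bij_betw[OF h, of f] by (simp add: atLeast0LessThan)
  show thesis
  proof
    show "d \<noteq> 0" using degree_monic_char_poly[OF A] d_def by auto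
  next
    fix x i j assume i: "i \<in> I" and j: "j \<in> I"
    have "(B * C) $$ (g i, g j) = (\<Sum>k<n. B $$ (g i, k) * C $$ (k, g j))"
      using B C gn[OF i] gn[OF j] by (simp add: scalar_prod_def atLeast0LessThan)
    also have "poly \<dots> x = (\<Sum>k<n. (if g i = k then x else 0) * poly (C $$ (k, g j)) x - T i (h k) * poly (C $$ (k, g j)) x)"
      unfolding poly_sum using gn[OF i] hg[OF i]
      by (intro sum.cong refl) (auto simp: Bij algebra_simps)
    also have "\<dots> = (\<Sum>k<n. if g i = k then x * poly (C $$ (k, g j)) x else 0) - (\<Sum>k<n. T i (h k) * poly (C $$ (k, g j)) x)"
      unfolding sum_subtractf by (intro arg_cong2[where f = "(-)"] sum.cong refl) auto
    also have "\<dots> = x * poly (adj i j) x - (\<Sum>k\<in>I. T i k * poly (adj k j) x)"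
      unfolding reindex adj_def using gn[OF i] by (simp add: gh)
    finally show "x * poly (adj i j) x - (\<Sum>k\<in>I. T i k * poly (adj k j) x) = (if i = j then poly d x else 0)"
      unfolding BC using gn[OF i] gn[OF j] hg[OF i] hg[OF j] gij[OF i j] by auto
  next
    fix x i j assume i: "i \<in> I" and j: "j \<in> I"
    have "(C * B) $$ (g i, g j) = (\<Sum>k<n. C $$ (g i, k) * B $$ (k, g j))"
      using B C gn[OF i] gn[OF j] by (simp add: scalar_prod_def atLeast0LessThan)
    also have "poly \<dots> x = (\<Sum>k<n. (if k = g j then x else 0) * poly (C $$ (g i, k)) x - poly (C $$ (g i, k)) x * T (h k) j)"
      unfolding poly_sum using gn[OF j] hg[OF j]
      by (intro sum.cong refl) (auto simp: Bij algebra_simps)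
    also have "\<dots> = (\<Sum>k<n. if k = g j then x * poly (C $$ (g i, k)) x else 0) - (\<Sum>k<n. poly (C $$ (g i, k)) x * T (h k) j)"
      unfolding sum_subtractf by (intro arg_cong2[where f = "(-)"] sum.cong refl) auto
    also have "\<dots> = x * poly (adj i j) x - (\<Sum>k\<in>I. poly (adj i k) x * T k j)"
      unfolding reindex adj_def using gn[OF j] by (simp add: gh)
    finally show "x * poly (adj i j) x - (\<Sum>k\<in>I. poly (adj i k) x * T k j) = (if i = j then poly d x else 0)"
      unfolding CB using gn[OF i] gn[OF j] hg[OF i] hg[OF j] gij[OF i j] by auto
  next
    fix x assume "poly d x = 0"
    then have "eigenvalue A x" using eigenvalue_root_char_poly[OF A] d_def by simp
    then obtain w where w: "w \<in> carrier_vec n" "w \<noteq> 0\<^sub>v n" "A *\<^sub>v w = x \<cdot>\<^sub>v w"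
      using A unfolding eigenvalue_def eigenvector_def by auto
    define v where "v i = vec_index w (g i)" for i
    obtain k where k: "k < n" "vec_index w k \<noteq> 0" using w(1,2) by (metis carrier_vecD dim_vec eq_vecI index_zero_vec(1) index_zero_vec(2))
    have "\<exists>i\<in>I. v i \<noteq> 0" using k hI[OF k(1)] gh[OF k(1)] unfolding v_def by metis
    moreover have "(\<Sum>k\<in>I. T i k * v k) = x * v i" if i: "i \<in> I" for i
    proof -
      have "vec_index (A *\<^sub>v w) (g i) = x * vec_index w (g i)" using w gn[OF i] by simp
      moreover have "vec_index (A *\<^sub>v w) (g i) = (\<Sum>k<n. T i (h k) * vec_index w k)"
        using w(1) gn[OF i] hg[OF i] A by (simp add: scalar_prod_def A_def atLeast0LessThan)
      ultimately show ?thesis unfolding reindex v_def by (simp add: gh)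
    qed
    ultimately show "\<exists>v. (\<exists>i\<in>I. v i \<noteq> 0) \<and> (\<forall>i\<in>I. (\<Sum>k\<in>I. T i k * v k) = x * v i)" by blast
  qed
qed

subsection \<open>Residues\<close>

lemma residue_meromorphic:
  assumes "f meromorphic_on {z}"
  shows "residue f z = fls_residue (laurent_expansion f z)"
  by (rule has_laurent_expansion_residue)
     (rule meromorphic_on_imp_has_laurent_expansion[OF assms], simp)

lemma residue_add_meromorphic:
  assumes "f meromorphic_on {z}" "g meromorphic_on {z}"
  shows "residue (\<lambda>w. f w + g w) z = residue f z + residue g z"
proof -
  have "residue (\<lambda>w. f w + g w) z = fls_residue (laurent_expansion f z + laurent_expansion g z)"
    by (intro has_laurent_expansion_residue has_laurent_expansion_add meromorphic_on_imp_has_laurent_expansion[OF assms(1)]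
        meromorphic_on_imp_has_laurent_expansion[OF assms(2)]) auto
  then show ?thesis by (simp add: residue_meromorphic assms)
qed

lemma residue_cmult_meromorphic:
  assumes "f meromorphic_on {z}"
  shows "residue (\<lambda>w. c * f w) z = c * residue f z"
proof -
  have "residue (\<lambda>w. c * f w) z = fls_residue (fls_const c * laurent_expansion f z)"
    by (intro has_laurent_expansion_residue has_laurent_expansion_cmult_left
        meromorphic_on_imp_has_laurent_expansion[OF assms]) auto
  then show ?thesis by (simp add: residue_meromorphic assms)
qed

lemma residue_sum_meromorphic:
  assumes "\<And>i. i \<in> I \<Longrightarrow> f i meromorphic_on {z}"
  shows "residue (\<lambda>w. \<Sum>i\<in>I. f i w) z = (\<Sum>i\<in>I. residue (f i) z)"
  using assms
proof (induction I rule: infinite_finite_induct)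
  case (insert i I)
  then show ?case
    by (simp add: residue_add_meromorphic meromorphic_on_sum)
qed (auto simp: residue_const)

lemma residue_analytic: "f analytic_on {z} \<Longrightarrow> residue f z = 0"
  by (metis analytic_at insertI1 residue_holo)

text \<open>Multiplying by a power of \<open>fls_X\<close> clears the pole of \<open>F\<close> and
  reduces the claim to the chain rule for power series; the product rule on both sides then lets the
  extra power cancel.\<close>

lemma fls_deriv_compose_fps:
  fixes F :: "complex fls"
  assumes G: "fps_nth G 0 = 0" "G \<noteq> 0"
  shows "fls_deriv (fls_compose_fps F G) = fls_compose_fps (fls_deriv F) G * fps_to_fls (fps_deriv G)"
proof -
  define n where "n = nat (- fls_subdegree F)"
  define l where "l = fps_to_fls G"
  define H where "H = fls_regpart (F * fls_X ^ n)"
  have l0: "l ^ n \<noteq> 0" using G by (simp add: l_def)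
  have "fls_subdegree (F * fls_X ^ n) \<ge> 0"
    by (cases "F = 0") (auto simp: n_def)
  then have F: "F * fls_X ^ n = fps_to_fls H" unfolding H_def by simp
  have comp_pow: "fls_compose_fps (fls_X ^ k) G = l ^ k" for k
    using G by (simp add: fls_compose_fps_power l_def)
  have 1: "fls_compose_fps F G * l ^ n = fps_to_fls (H oo G)"
    using arg_cong[OF F, of "\<lambda>F. fls_compose_fps F G"] G by (simp add: fls_compose_fps_mult comp_pow)
  have "fls_deriv (fls_compose_fps F G * l ^ n) = fps_to_fls (fps_deriv H oo G) * fps_to_fls (fps_deriv G)"
    unfolding 1 fls_deriv_fps_to_fls fps_compose_deriv[OF G(1)] fls_times_fps_to_fls ..
  also have "fps_to_fls (fps_deriv H oo G) = fls_compose_fps (fls_deriv (F * fls_X ^ n)) G"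
    unfolding F fls_deriv_fps_to_fls using G by simp
  also have "\<dots> = fls_compose_fps F G * (of_nat n * l ^ (n - 1)) + fls_compose_fps (fls_deriv F) G * l ^ n"
    using G by (simp add: fls_deriv_power fls_compose_fps_add fls_compose_fps_mult comp_pow)
  finally have "fls_deriv (fls_compose_fps F G) * l ^ n =
     fls_compose_fps (fls_deriv F) G * fls_deriv l * l ^ n"
    by (simp add: fls_deriv_power algebra_simps l_def fls_deriv_fps_to_fls)
  then have "fls_deriv (fls_compose_fps F G) = fls_compose_fps (fls_deriv F) G * fls_deriv l"
    using l0 mult_right_cancel by blast
  then show ?thesis by (simp add: l_def fls_deriv_fps_to_fls)
qed

text \<open>Up to the term \<open>a / X\<close> with the residue \<open>a\<close>, a Laurent series
  is a derivative and stays one after substitution, so it contributes nothing. The remaining term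
  becomes \<open>a\<close> times the logarithmic derivative of \<open>G\<close>, whose residue is
  the order of the zero of \<open>G\<close>, namely 1 as \<open>deriv u z\<close> does not
  vanish.\<close>

lemma residue_change_of_variables:
  assumes F: "F meromorphic_on {u z}" and u: "u analytic_on {z}" and nz: "deriv u z \<noteq> 0"
  shows "residue (\<lambda>s. deriv u s * F (u s)) z = residue F (u z)"
proof -
  define \<Phi> where "\<Phi> = laurent_expansion F (u z)"
  have \<Phi>: "(\<lambda>w. F (u z + w)) has_laurent_expansion \<Phi>"
    unfolding \<Phi>_def using meromorphic_on_imp_has_laurent_expansion[OF F] by simp
  have "(\<lambda>w. u w - u z) analytic_on {z}" using u by (intro analytic_intros)
  then obtain G where G: "(\<lambda>w. u (z + w) - u z) has_fps_expansion G"
    using analytic_at_imp_has_fps_expansion by blast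
  have G0: "fps_nth G 0 = 0" using has_fps_expansion_imp_0_eq_fps_nth_0[OF G] by simp
  have der: "deriv (\<lambda>w. u (z + w) - u z) has_fps_expansion fps_deriv G"
    by (rule has_fps_expansion_deriv[OF G])
  \<comment> \<open>Translating the derivative needs differentiability at \<open>z + w\<close>,
    which analyticity at \<open>z\<close> provides only for small \<open>w\<close>.\<close>
  have ev: "\<forall>\<^sub>F w in nhds 0. deriv (\<lambda>w. u (z + w) - u z) w = deriv u (z + w)"
  proof -
    obtain S where "open S" "z \<in> S" "u holomorphic_on S" using u analytic_at by blast
    then have "\<forall>\<^sub>F x in nhds z. u analytic_on {x}"
      unfolding eventually_nhds by (metis analytic_at)
    then have "\<forall>\<^sub>F w in nhds 0. u analytic_on {z + w}"
      by (simp add: nhds_to_0[of z] eventually_filtermap)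
    then show ?thesis
    proof eventually_elim
      case (elim w)
      then have "(u has_field_derivative deriv u (z + w)) (at (z + w))"
        using analytic_on_imp_differentiable_at DERIV_deriv_iff_field_differentiable by blast
      then have "((\<lambda>w. u (z + w) - u z) has_field_derivative deriv u (z + w)) (at w)"
        by (auto intro!: derivative_eq_intros simp: DERIV_shift add.commute
            elim: DERIV_chain2[where g = "\<lambda>w. z + w", THEN DERIV_cong])
      then show ?case by (rule DERIV_imp_deriv)
    qed
  qed
  have der': "(\<lambda>w. deriv u (z + w)) has_fps_expansion fps_deriv G"
    using der has_fps_expansion_cong[OF ev refl, of "fps_deriv G"] by simp
  have "fps_nth (fps_deriv G) 0 = deriv u z"
    using has_fps_expansion_imp_0_eq_fps_nth_0[OF der'] by simp
  then have G1: "fps_nth G 1 \<noteq> 0" using nz by simp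
  then have Gn0: "G \<noteq> 0" by auto
  have sub: "fls_subdegree (fps_to_fls G) = 1"
    using G0 G1 by (simp add: fls_subdegree_fls_to_fps) (metis One_nat_def less_one subdegreeI)
  have "((\<lambda>w. F (u z + w)) \<circ> (\<lambda>w. u (z + w) - u z)) has_laurent_expansion fls_compose_fps \<Phi> G"
    by (rule has_laurent_expansion_compose[OF \<Phi> has_laurent_expansion_fps[OF G] G0 Gn0])
  then have "(\<lambda>w. deriv u (z + w) * F (u (z + w))) has_laurent_expansion
     fps_to_fls (fps_deriv G) * fls_compose_fps \<Phi> G"
    by (intro has_laurent_expansion_mult has_laurent_expansion_fps[OF der']) (simp add: o_def)
  then have res: "residue (\<lambda>s. deriv u s * F (u s)) z = fls_residue (fps_to_fls (fps_deriv G) * fls_compose_fps \<Phi> G)"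
    by (rule has_laurent_expansion_residue)
  define a where "a = fls_residue \<Phi>"
  have "fls_residue (\<Phi> - fls_const a * inverse fls_X) = 0"
    by (simp add: a_def fls_inverse_X)
  then obtain H where H: "fls_deriv H = \<Phi> - fls_const a * inverse fls_X"
    using fls_residue_nonzero_ex_antiderivative by blast
  then have "\<Phi> = fls_const a * inverse fls_X + fls_deriv H" by simp
  then have "fls_compose_fps \<Phi> G = fls_const a * inverse (fps_to_fls G) + fls_compose_fps (fls_deriv H) G"
    using G0 Gn0 by (simp add: fls_compose_fps_add fls_compose_fps_mult fls_compose_fps_inverse)
  then have "fps_to_fls (fps_deriv G) * fls_compose_fps \<Phi> G =
     fls_const a * (fls_deriv (fps_to_fls G) * inverse (fps_to_fls G)) + fls_deriv (fls_compose_fps H G)"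
    unfolding fls_deriv_compose_fps[OF G0 Gn0] by (simp add: algebra_simps fls_deriv_fps_to_fls)
  then have "fls_residue (fps_to_fls (fps_deriv G) * fls_compose_fps \<Phi> G) = a"
    by (simp only: fls_residue_add fls_residue_deriv fls_residue_fls_const_times
        fls_residue_deriv_times_inverse_eq_subdegree sub) simp
  with res show ?thesis unfolding a_def \<Phi>_def by (simp add: residue_meromorphic F)
qed

subsection \<open>Divided differences of holomorphic functions\<close>

text \<open>The value at \<open>a\<close> removes the singularity of the divided difference. For
  holomorphic \<open>g\<close> the numbers \<open>(dquot a ^^ i) g a\<close> are the Taylor
  coefficients at \<open>a\<close>.\<close>

definition dquot :: "complex \<Rightarrow> (complex \<Rightarrow> complex) \<Rightarrow> complex \<Rightarrow> complex" where
  "dquot a g = (\<lambda>z. if z = a then deriv g a else (g z - g a) / (z - a))"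

lemma dquot_expand: "g z = g a + (z - a) * dquot a g z"
  by (simp add: dquot_def)

lemma dquot_holomorphic:
  assumes "g holomorphic_on ball a r"
  shows "dquot a g holomorphic_on ball a r"
  unfolding dquot_def by (rule pole_lemma_open[OF assms]) simp

lemma dquot_cong:
  assumes "\<And>w. w \<in> ball a r \<Longrightarrow> f w = g w" and z: "z \<in> ball a r"
  shows "dquot a f z = dquot a g z"
proof -
  have r: "a \<in> ball a r" using z zero_le_dist[of a z] unfolding mem_ball dist_self by linarith
  have "\<forall>\<^sub>F w in nhds a. f w = g w"
    unfolding eventually_nhds using r assms(1) by (intro exI[of _ "ball a r"]) simp
  then have "deriv f a = deriv g a" by (rule deriv_cong_ev) simp
  then show ?thesis using assms r by (simp add: dquot_def)
qed

lemma dquot_linear: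
  assumes f: "f holomorphic_on ball a r" and g: "g holomorphic_on ball a r" and z: "z \<in> ball a r"
  shows "dquot a (\<lambda>w. x * f w + y * g w) z = x * dquot a f z + y * dquot a g z"
proof -
  have r: "a \<in> ball a r" using z zero_le_dist[of a z] unfolding mem_ball dist_self by linarith
  have "f field_differentiable at a" "g field_differentiable at a"
    using f g r by (auto intro: holomorphic_on_imp_differentiable_at)
  then have "deriv (\<lambda>w. x * f w + y * g w) a = x * deriv f a + y * deriv g a"
    by (auto intro!: DERIV_imp_deriv derivative_eq_intros simp: DERIV_deriv_iff_field_differentiable mult.commute)
  then show ?thesis by (auto simp: dquot_def diff_divide_distrib add_divide_distrib algebra_simps)
qed

text \<open>On a circle of radius at least \<open>r / 2\<close> the denominator is controlled; the
  maximum modulus principle carries the bound inside, where the quotient by \<open>z - a\<close>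
  could not be estimated directly.\<close>

lemma dquot_bound:
  assumes g: "g holomorphic_on ball a r" and K: "\<And>w. w \<in> ball a r \<Longrightarrow> norm (g w) \<le> K"
    and z: "z \<in> ball a r"
  shows "norm (dquot a g z) \<le> 4 * K / r"
proof -
  have r: "r > 0" using z zero_le_dist[of a z] unfolding mem_ball by linarith
  have K0: "K \<ge> 0" using K[OF z] norm_ge_zero order_trans by blast
  \<comment> \<open>Large enough for the denominator estimate and for the closed disc to contain
    \<open>z\<close>, but still below \<open>r\<close>.\<close>
  define t where "t = max (dist a z) (r / 2)"
  have t: "t > 0" "t < r" "t \<ge> r / 2" "dist a z \<le> t" using r z by (auto simp: t_def)
  have hol: "dquot a g holomorphic_on ball a r" by (rule dquot_holomorphic[OF g])
  have sub: "cball a t \<subseteq> ball a r" using t by auto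
  show ?thesis
  proof (rule maximum_modulus_frontier[of "dquot a g" "cball a t"])
    show "dquot a g holomorphic_on interior (cball a t)"
      using holomorphic_on_subset[OF hol] sub interior_subset by blast
    show "continuous_on (closure (cball a t)) (dquot a g)"
      using holomorphic_on_imp_continuous_on[OF holomorphic_on_subset[OF hol sub]] by simp
    show "bounded (cball a t)" by simp
    show "z \<in> cball a t" using t by simp
  next
    fix w assume "w \<in> frontier (cball a t)"
    then have w: "dist a w = t" using t by simp
    then have wr: "w \<in> ball a r" and ar: "a \<in> ball a r" and "w \<noteq> a" using t r by auto
    then have "norm (dquot a g w) = norm (g w - g a) / t"
      using w by (simp add: dquot_def norm_divide dist_norm norm_minus_commute)
    also have "\<dots> \<le> (2 * K) / t"
      using norm_triangle_ineq4[of "g w" "g a"] K[OF wr] K[OF ar] t(1) by (intro divide_right_mono) auto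
    also have "\<dots> \<le> (2 * K) / (r / 2)"
      using t r K0 by (intro divide_left_mono) auto
    finally show "norm (dquot a g w) \<le> 4 * K / r" by simp
  qed
qed

lemma dquot_iterate_expand:
  "g z = (\<Sum>i<n. (dquot a ^^ i) g a * (z - a) ^ i) + (z - a) ^ n * (dquot a ^^ n) g z"
proof (induction n)
  case (Suc n)
  show ?case
    by (subst Suc, subst (2) dquot_expand[of _ z a]) (simp add: distrib_left mult.assoc mult.left_commute)
qed simp

text \<open>Each divided difference cancels one factor \<open>z - a\<close>, as the function still
  vanishes at \<open>a\<close>. For \<open>i < n\<close> the value at \<open>a\<close> is zero; this
  forces the principal parts of the resolvent to be cylinder functions.\<close>

lemma dquot_iterate_power:
  assumes u: "u holomorphic_on ball a r" and f: "\<And>z. z \<in> ball a r \<Longrightarrow> f z = (z - a) ^ n * u z"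
    and "i \<le> n" "z \<in> ball a r"
  shows "(dquot a ^^ i) f z = (z - a) ^ (n - i) * u z"
  using assms(3,4)
proof (induction i arbitrary: z)
  case (Suc i)
  define v where "v z = (z - a) ^ (n - Suc i) * u z" for z
  have a: "a \<in> ball a r" using Suc.prems(2) zero_le_dist[of a z] unfolding mem_ball dist_self by linarith
  have "v holomorphic_on ball a r" unfolding v_def by (intro holomorphic_intros u)
  then have v: "v field_differentiable at a" using a by (auto intro: holomorphic_on_imp_differentiable_at)
  have "deriv (\<lambda>z. (z - a) * v z) a = v a"
    using v[folded DERIV_deriv_iff_field_differentiable]
    by (auto intro!: DERIV_imp_deriv derivative_eq_intros)
  then have *: "dquot a (\<lambda>z. (z - a) * v z) z = v z" by (simp add: dquot_def)
  have "n - i = Suc (n - Suc i)" using Suc.prems by simp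
  then have "dquot a ((dquot a ^^ i) f) z = dquot a (\<lambda>z. (z - a) * v z) z"
    using Suc by (intro dquot_cong[of _ r]) (auto simp: v_def)
  with * show ?case by (simp add: v_def)
qed (use f in simp)

subsection \<open>Lipschitz functions\<close>

text \<open>The exponent is \<open>Suc k\<close> because \<open>!!\<close> counts from 0 while the
  distance counts edges from 1.\<close>

lemma path_dist_eq:
  assumes "p !! k \<noteq> p' !! k" "\<And>j. j < k \<Longrightarrow> p !! j = p' !! j"
  shows "path_dist \<theta> p p' = \<theta> ^ Suc k"
proof -
  have "(LEAST i. i \<ge> 1 \<and> p !! (i - 1) \<noteq> p' !! (i - 1)) = Suc k"
  proof (rule Least_equality)
    fix y assume y: "1 \<le> y \<and> p !! (y - 1) \<noteq> p' !! (y - 1)"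
    then have "\<not> y - 1 < k" using assms(2) by blast
    with y show "Suc k \<le> y" by linarith
  qed (use assms in simp)
  moreover have "p \<noteq> p'" using assms by auto
  ultimately show ?thesis by (simp add: path_dist_def)
qed

lemma stream_first_difference:
  assumes "p \<noteq> p'"
  obtains k where "p !! k \<noteq> p' !! k" "\<And>j. j < k \<Longrightarrow> p !! j = p' !! j"
proof -
  have "\<exists>k. p !! k \<noteq> p' !! k" using assms by (metis smap_alt stream.map_ident)
  then obtain k where "p !! k \<noteq> p' !! k" "\<forall>j<k. p !! j = p' !! j"
    using exists_least_iff[of "\<lambda>k. p !! k \<noteq> p' !! k"] by blast
  then show thesis using that by blast
qed

lemma stake_eq_iff: "stake n p = stake n p' \<longleftrightarrow> (\<forall>j<n. p !! j = p' !! j)"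
proof (induction n)
  case (Suc n)
  then show ?case by (auto simp: stake_Suc less_Suc_eq simp del: stake.simps)
qed simp

lemma path_dist_refl [simp]: "path_dist \<theta> p p = 0"
  by (simp add: path_dist_def)

lemma path_dist_Stream: "path_dist \<theta> (e ## p) (e ## p') = \<theta> * path_dist \<theta> p p'"
proof (cases "p = p'")
  case False
  then obtain k where k: "p !! k \<noteq> p' !! k" "\<And>j. j < k \<Longrightarrow> p !! j = p' !! j"
    using stream_first_difference by blast
  have "path_dist \<theta> (e ## p) (e ## p') = \<theta> ^ Suc (Suc k)"
  proof (rule path_dist_eq)
    show "(e ## p) !! Suc k \<noteq> (e ## p') !! Suc k" using k by simp
  next
    fix j assume "j < Suc k"
    then show "(e ## p) !! j = (e ## p') !! j" using k(2) by (cases j) auto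
  qed
  then show ?thesis using path_dist_eq[OF k, of \<theta>] by simp
qed simp

locale lipschitz =
  fixes \<theta> :: real and P :: "'v edge stream set"
  assumes \<theta>: "0 < \<theta>" "\<theta> < 1" and P_ne: "P \<noteq> {}"
begin

abbreviation "V \<equiv> lip_space \<theta> P"
abbreviation "N \<equiv> lip_norm \<theta> P"
abbreviation "dst \<equiv> path_dist \<theta>"

lemma dst_nonneg: "dst p p' \<ge> 0"
  using \<theta> by (simp add: path_dist_def)

lemma dst_le_1: "dst p p' \<le> 1"
  using \<theta> by (simp add: path_dist_def power_le_one)

lemma dst_ge:
  assumes "stake n p \<noteq> stake n p'"
  shows "dst p p' \<ge> \<theta> ^ n"
proof -
  have "p \<noteq> p'" using assms by auto
  then obtain k where k: "p !! k \<noteq> p' !! k" "\<And>j. j < k \<Longrightarrow> p !! j = p' !! j"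
    using stream_first_difference by blast
  then have "k < n" using assms unfolding stake_eq_iff by (metis linorder_neqE_nat order.strict_trans)
  then show ?thesis using path_dist_eq[OF k, of \<theta>] \<theta> by (simp add: power_decreasing Suc_leI del: power_Suc)
qed

text \<open>A single constant for the sup bound and the Lipschitz bound. It is comparable with
  \<open>N\<close> up to a factor 2 and avoids the infimum and supremum in the norm.\<close>

definition lip_le :: "real \<Rightarrow> ('v edge stream \<Rightarrow> complex) \<Rightarrow> bool" where
  "lip_le K \<phi> \<longleftrightarrow> (\<forall>p. p \<notin> P \<longrightarrow> \<phi> p = 0) \<and> (\<forall>p\<in>P. norm (\<phi> p) \<le> K) \<and>
     (\<forall>p\<in>P. \<forall>p'\<in>P. norm (\<phi> p - \<phi> p') \<le> K * dst p p')"

lemma lip_le_imp: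
  assumes "lip_le K \<phi>"
  shows "\<phi> \<in> V" "N \<phi> \<le> 2 * K"
proof -
  obtain p where "p \<in> P" using P_ne by auto
  then have "K \<ge> 0" using assms norm_ge_zero order_trans unfolding lip_le_def by blast
  then have K: "K \<in> lipschitz_bounds \<theta> P \<phi>" using assms unfolding lip_le_def lipschitz_bounds_def by simp
  then show "\<phi> \<in> V" using assms unfolding lip_le_def lip_space_def by auto
  have "Inf (lipschitz_bounds \<theta> P \<phi>) \<le> K"
    using K by (intro cInf_lower bdd_belowI[of _ 0]) (auto simp: lipschitz_bounds_def)
  moreover have "(SUP p\<in>P. norm (\<phi> p)) \<le> K"
    using assms P_ne unfolding lip_le_def by (intro cSUP_least) auto
  ultimately show "N \<phi> \<le> 2 * K" unfolding lip_norm_def by simp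
qed

text \<open>The infimum of the Lipschitz bounds is itself one, by dividing by the positive distance
  of distinct points. The supremum is finite since the space has diameter at most 1, so the value at
  one point controls all others.\<close>

lemma lip_le_norm:
  assumes \<phi>: "\<phi> \<in> V"
  shows "lip_le (N \<phi>) \<phi>"
proof -
  define B where "B = lipschitz_bounds \<theta> P \<phi>"
  have ne: "B \<noteq> {}" and supp: "\<forall>p. p \<notin> P \<longrightarrow> \<phi> p = 0" using \<phi> unfolding lip_space_def B_def by auto
  obtain C where C: "C \<in> B" using ne by auto
  obtain p0 where p0: "p0 \<in> P" using P_ne by auto
  have Cnn: "C \<ge> 0" using C unfolding B_def lipschitz_bounds_def by simp
  have bd: "norm (\<phi> p) \<le> norm (\<phi> p0) + C" if "p \<in> P" for p
  proof -
    have "norm (\<phi> p - \<phi> p0) \<le> C * dst p p0" using C that p0 unfolding B_def lipschitz_bounds_def by simp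
    also have "\<dots> \<le> C * 1" using Cnn dst_le_1 by (intro mult_left_mono) auto
    finally show ?thesis using norm_triangle_sub[of "\<phi> p" "\<phi> p0"] by simp
  qed
  have bdd: "bdd_above ((\<lambda>p. norm (\<phi> p)) ` P)" using bd by (intro bdd_aboveI2) auto
  define I where "I = Inf B"
  define U where "U = (SUP p\<in>P. norm (\<phi> p))"
  have I0: "I \<ge> 0" unfolding I_def using ne by (intro cInf_greatest) (auto simp: B_def lipschitz_bounds_def)
  have U: "norm (\<phi> p) \<le> U" if "p \<in> P" for p unfolding U_def using bdd that by (intro cSUP_upper) auto
  have U0: "U \<ge> 0" using U[OF p0] norm_ge_zero order_trans by blast
  have I: "norm (\<phi> p - \<phi> p') \<le> I * dst p p'" if p: "p \<in> P" "p' \<in> P" for p p'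
  proof (cases "p = p'")
    case False
    then have d: "dst p p' > 0" using \<theta> by (simp add: path_dist_def)
    have "norm (\<phi> p - \<phi> p') / dst p p' \<le> I" unfolding I_def
    proof (rule cInf_greatest[OF ne])
      fix x assume "x \<in> B"
      then show "norm (\<phi> p - \<phi> p') / dst p p' \<le> x"
        using p d unfolding B_def lipschitz_bounds_def by (simp add: divide_le_eq)
    qed
    then show ?thesis using d by (simp add: divide_le_eq)
  qed simp
  have N: "N \<phi> = I + U" unfolding lip_norm_def I_def U_def B_def ..
  show ?thesis unfolding lip_le_def N
  proof (intro conjI ballI)
    fix p p' assume "p \<in> P" "p' \<in> P"
    then have "norm (\<phi> p - \<phi> p') \<le> I * dst p p'" by (rule I)
    also have "\<dots> \<le> (I + U) * dst p p'" using U0 dst_nonneg by (intro mult_right_mono) auto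
    finally show "norm (\<phi> p - \<phi> p') \<le> (I + U) * dst p p'" .
  next
    fix p assume "p \<in> P"
    then show "norm (\<phi> p) \<le> I + U" using U I0 by force
  qed (use supp in auto)
qed

lemma N_nonneg: "\<phi> \<in> V \<Longrightarrow> N \<phi> \<ge> 0"
proof -
  assume "\<phi> \<in> V"
  obtain p where "p \<in> P" using P_ne by auto
  then show ?thesis using lip_le_norm[OF \<open>\<phi> \<in> V\<close>] norm_ge_zero order_trans unfolding lip_le_def by blast
qed

lemma lip_le_mono: "lip_le K \<phi> \<Longrightarrow> K \<le> K' \<Longrightarrow> lip_le K' \<phi>"
  unfolding lip_le_def using dst_nonneg by (meson mult_right_mono order_trans)

lemma lip_le_lincomb:
  assumes "lip_le K \<phi>" "lip_le K' \<psi>"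
  shows "lip_le (norm a * K + norm b * K') (\<lambda>p. a * \<phi> p + b * \<psi> p)"
  unfolding lip_le_def
proof (intro conjI ballI)
  fix p p' assume p: "p \<in> P" "p' \<in> P"
  have "norm (a * \<phi> p + b * \<psi> p - (a * \<phi> p' + b * \<psi> p')) = norm (a * (\<phi> p - \<phi> p') + b * (\<psi> p - \<psi> p'))"
    by (simp add: algebra_simps)
  also have "\<dots> \<le> norm a * norm (\<phi> p - \<phi> p') + norm b * norm (\<psi> p - \<psi> p')"
    using norm_triangle_ineq by (metis norm_mult)
  also have "\<dots> \<le> norm a * (K * dst p p') + norm b * (K' * dst p p')"
    using assms p unfolding lip_le_def by (intro add_mono mult_left_mono) auto
  finally show "norm (a * \<phi> p + b * \<psi> p - (a * \<phi> p' + b * \<psi> p')) \<le> (norm a * K + norm b * K') * dst p p'"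
    by (simp add: algebra_simps)
next
  fix p assume p: "p \<in> P"
  have "norm (a * \<phi> p + b * \<psi> p) \<le> norm a * norm (\<phi> p) + norm b * norm (\<psi> p)"
    using norm_triangle_ineq by (metis norm_mult)
  also have "\<dots> \<le> norm a * K + norm b * K'"
    using assms p unfolding lip_le_def by (intro add_mono mult_left_mono) auto
  finally show "norm (a * \<phi> p + b * \<psi> p) \<le> norm a * K + norm b * K'" .
qed (use assms in \<open>auto simp: lip_le_def\<close>)

lemma lin_closed_V: "lin_closed V"
  unfolding lin_closed_def using lip_le_lincomb lip_le_norm lip_le_imp(1) by blast

lemma bounded_operatorI:
  assumes "\<And>\<phi> \<psi> a b. \<phi> \<in> V \<Longrightarrow> \<psi> \<in> V \<Longrightarrow> A (\<lambda>p. a * \<phi> p + b * \<psi> p) = (\<lambda>p. a * A \<phi> p + b * A \<psi> p)"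
    and "\<And>\<phi>. \<phi> \<in> V \<Longrightarrow> lip_le (K * N \<phi>) (A \<phi>)"
  shows "bounded_operator V N A"
  unfolding bounded_operator_def
proof (intro conjI)
  show "A ` V \<subseteq> V" using lip_le_imp(1)[OF assms(2)] by blast
  show "\<exists>C. \<forall>\<phi>\<in>V. N (A \<phi>) \<le> C * N \<phi>"
    using lip_le_imp(2)[OF assms(2)] by (intro exI[of _ "2 * K"]) (simp add: mult.assoc)
qed (use assms(1) in blast)

text \<open>A weak form of operator holomorphy that can be checked on scalar functions. The bound
  uniform in \<open>s\<close> is what upgrades it to differentiability in operator norm.\<close>

definition hol_family ::
  "complex \<Rightarrow> real \<Rightarrow> (complex \<Rightarrow> ('v edge stream \<Rightarrow> complex) \<Rightarrow> 'v edge stream \<Rightarrow> complex) \<Rightarrow> bool" where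
  "hol_family a r G \<longleftrightarrow>
     (\<forall>s\<in>ball a r. \<forall>\<phi>\<in>V. \<forall>\<psi>\<in>V. \<forall>x y. G s (\<lambda>p. x * \<phi> p + y * \<psi> p) = (\<lambda>p. x * G s \<phi> p + y * G s \<psi> p)) \<and>
     (\<forall>\<phi>\<in>V. \<forall>p. (\<lambda>s. G s \<phi> p) holomorphic_on ball a r) \<and>
     (\<exists>K. \<forall>s\<in>ball a r. \<forall>\<phi>\<in>V. lip_le (K * N \<phi>) (G s \<phi>))"

lemma hol_family_bounded_operator:
  assumes "hol_family a r G" "s \<in> ball a r"
  shows "bounded_operator V N (G s)"
proof -
  obtain K where "\<And>\<phi>. \<phi> \<in> V \<Longrightarrow> lip_le (K * N \<phi>) (G s \<phi>)"
    using assms unfolding hol_family_def by blast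
  then show ?thesis using assms unfolding hol_family_def by (intro bounded_operatorI) auto
qed

lemma hol_family_subset: "hol_family a r G \<Longrightarrow> ball b t \<subseteq> ball a r \<Longrightarrow> hol_family b t G"
  unfolding hol_family_def by (meson holomorphic_on_subset subsetD)

text \<open>The scalar estimate \<open>dquot_bound\<close> applies to the values
  \<open>G s \<phi> p\<close> and equally to the differences
  \<open>G s \<phi> p - G s \<phi> p'\<close>; by linearity of \<open>dquot\<close> the latter give
  the Lipschitz bound with the same factor \<open>4 / r\<close>.\<close>

lemma hol_family_dquot:
  assumes G: "hol_family a r G"
  shows "hol_family a r (\<lambda>s \<phi> p. dquot a (\<lambda>s. G s \<phi> p) s)"
proof -
  have lin: "G s (\<lambda>p. x * \<phi> p + y * \<psi> p) = (\<lambda>p. x * G s \<phi> p + y * G s \<psi> p)"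
    if "s \<in> ball a r" "\<phi> \<in> V" "\<psi> \<in> V" for s \<phi> \<psi> x y
    using G that unfolding hol_family_def by blast
  have hol: "(\<lambda>s. G s \<phi> p) holomorphic_on ball a r" if "\<phi> \<in> V" for \<phi> p
    using G that unfolding hol_family_def by blast
  obtain K where K: "\<And>s \<phi>. s \<in> ball a r \<Longrightarrow> \<phi> \<in> V \<Longrightarrow> lip_le (K * N \<phi>) (G s \<phi>)"
    using G unfolding hol_family_def by blast
  have bound: "lip_le (4 * K / r * N \<phi>) (\<lambda>p. dquot a (\<lambda>s. G s \<phi> p) s)"
    if s: "s \<in> ball a r" and \<phi>: "\<phi> \<in> V" for s \<phi>
    unfolding lip_le_def
  proof (intro conjI ballI allI impI)
    fix p assume p: "p \<in> P"
    have "norm (dquot a (\<lambda>s. G s \<phi> p) s) \<le> 4 * (K * N \<phi>) / r"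
      using K[OF _ \<phi>] p by (intro dquot_bound[OF hol[OF \<phi>] _ s]) (auto simp: lip_le_def)
    then show "norm (dquot a (\<lambda>s. G s \<phi> p) s) \<le> 4 * K / r * N \<phi>" by simp
  next
    fix p p' assume p: "p \<in> P" "p' \<in> P"
    have "norm (dquot a (\<lambda>s. 1 * G s \<phi> p + (-1) * G s \<phi> p') s) \<le> 4 * (K * N \<phi> * dst p p') / r"
      using K[OF _ \<phi>] p
      by (intro dquot_bound[OF _ _ s] holomorphic_intros hol[OF \<phi>]) (auto simp: lip_le_def)
    then show "norm (dquot a (\<lambda>s. G s \<phi> p) s - dquot a (\<lambda>s. G s \<phi> p') s) \<le> 4 * K / r * N \<phi> * dst p p'"
      by (subst (asm) dquot_linear[OF hol[OF \<phi>] hol[OF \<phi>] s]) (simp add: algebra_simps)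
  next
    fix p assume p: "p \<notin> P"
    have "dquot a (\<lambda>s. G s \<phi> p) s = dquot a (\<lambda>_. 0) s"
      using K[OF _ \<phi>] p by (intro dquot_cong[OF _ s]) (auto simp: lip_le_def)
    then show "dquot a (\<lambda>s. G s \<phi> p) s = 0" by (simp add: dquot_def)
  qed
  have "(\<lambda>p. dquot a (\<lambda>s. G s (\<lambda>p. x * \<phi> p + y * \<psi> p) p) s) =
      (\<lambda>p. x * dquot a (\<lambda>s. G s \<phi> p) s + y * dquot a (\<lambda>s. G s \<psi> p) s)"
    if s: "s \<in> ball a r" and \<phi>: "\<phi> \<in> V" "\<psi> \<in> V" for s \<phi> \<psi> x y
  proof
    fix p
    have "dquot a (\<lambda>s. G s (\<lambda>p. x * \<phi> p + y * \<psi> p) p) s = dquot a (\<lambda>s. x * G s \<phi> p + y * G s \<psi> p) s"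
      using lin[OF _ \<phi>] by (intro dquot_cong[OF _ s]) simp
    also have "\<dots> = x * dquot a (\<lambda>s. G s \<phi> p) s + y * dquot a (\<lambda>s. G s \<psi> p) s"
      by (rule dquot_linear[OF hol[OF \<phi>(1)] hol[OF \<phi>(2)] s])
    finally show "dquot a (\<lambda>s. G s (\<lambda>p. x * \<phi> p + y * \<psi> p) p) s =
      x * dquot a (\<lambda>s. G s \<phi> p) s + y * dquot a (\<lambda>s. G s \<psi> p) s" .
  qed
  moreover have "dquot a (\<lambda>s. G s \<phi> p) holomorphic_on ball a r" if "\<phi> \<in> V" for \<phi> p
    by (rule dquot_holomorphic[OF hol[OF that]])
  ultimately show ?thesis unfolding hol_family_def using bound by blast
qed

lemma hol_family_dquot_iterate:
  assumes "hol_family a r G"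
  shows "hol_family a r (\<lambda>s \<phi> p. (dquot a ^^ i) (\<lambda>s. G s \<phi> p) s)"
proof (induction i)
  case (Suc i)
  then show ?case using hol_family_dquot[OF Suc] by simp
qed (use assms in simp)

text \<open>Recentred at \<open>s\<close>, the first divided difference \<open>G1\<close> supplies
  the derivative \<open>G1 s\<close>, and the error of the difference quotient is \<open>h\<close>
  times the second divided difference \<open>G2\<close>, which is uniformly bounded.\<close>

lemma hol_family_holomorphic:
  assumes G: "hol_family a r G"
  shows "operator_holomorphic_on V N G (ball a r)"
  unfolding operator_holomorphic_on_def
proof (intro ballI conjI)
  fix s assume s: "s \<in> ball a r"
  show "bounded_operator V N (G s)" by (rule hol_family_bounded_operator[OF G s])
  define \<delta> where "\<delta> = r - dist a s"
  have \<delta>: "\<delta> > 0" using s by (simp add: \<delta>_def)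
  have "ball s \<delta> \<subseteq> ball a r"
    unfolding \<delta>_def by (auto simp: subset_iff) (smt (verit) dist_triangle)
  then have Gs: "hol_family s \<delta> G" by (rule hol_family_subset[OF G])
  define G1 where "G1 = (\<lambda>z \<phi> p. dquot s (\<lambda>s. G s \<phi> p) z)"
  define G2 where "G2 = (\<lambda>z \<phi> p. dquot s (\<lambda>s. G1 s \<phi> p) z)"
  have G1: "hol_family s \<delta> G1" unfolding G1_def by (rule hol_family_dquot[OF Gs])
  have G2: "hol_family s \<delta> G2" unfolding G2_def by (rule hol_family_dquot[OF G1])
  obtain K where K: "\<And>z \<phi>. z \<in> ball s \<delta> \<Longrightarrow> \<phi> \<in> V \<Longrightarrow> lip_le (K * N \<phi>) (G2 z \<phi>)"
    using G2 unfolding hol_family_def by blast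
  define E where "E h = (\<lambda>\<phi> p. (G (s + h) \<phi> p - G s \<phi> p) / h - G1 s \<phi> p)" for h
  have bnd: "0 \<le> operator_norm V N (E h) \<and> operator_norm V N (E h) \<le> 2 * norm h * \<bar>K\<bar>"
    if h: "h \<noteq> 0" "norm h < \<delta>" for h
  proof -
    have sh: "s + h \<in> ball s \<delta>" using h by (simp add: dist_norm)
    \<comment> \<open>The zero summand only brings the expression into the shape of
      \<open>lip_le_lincomb\<close>.\<close>
    have E: "E h \<phi> = (\<lambda>p. h * G2 (s + h) \<phi> p + 0 * G2 (s + h) \<phi> p)" for \<phi>
      using h by (auto simp: E_def G1_def G2_def dquot_def fun_eq_iff field_simps)
    have "N (E h \<phi>) \<le> 2 * norm h * \<bar>K\<bar> * N \<phi>" if \<phi>: "\<phi> \<in> V" for \<phi>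
    proof -
      have "N (E h \<phi>) \<le> 2 * (norm h * (K * N \<phi>) + norm (0::complex) * (K * N \<phi>))"
        unfolding E by (intro lip_le_imp(2) lip_le_lincomb K[OF sh \<phi>])
      also have "\<dots> = 2 * norm h * (K * N \<phi>)" by simp
      also have "\<dots> \<le> 2 * norm h * (\<bar>K\<bar> * N \<phi>)" using N_nonneg[OF \<phi>] by (intro mult_left_mono mult_right_mono) auto
      finally show ?thesis by simp
    qed
    then have "2 * norm h * \<bar>K\<bar> \<in> {C. C \<ge> 0 \<and> (\<forall>\<phi>\<in>V. N (E h \<phi>) \<le> C * N \<phi>)}" by simp
    then show ?thesis unfolding operator_norm_def
      by (intro conjI cInf_greatest cInf_lower bdd_belowI[of _ 0]) blast+
  qed
  have ev: "\<forall>\<^sub>F h in at 0. h \<noteq> 0 \<and> norm h < \<delta>"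
    unfolding eventually_at using \<delta> by (intro exI[of _ \<delta>]) (simp add: dist_norm)
  have "((\<lambda>h. operator_norm V N (E h)) \<longlongrightarrow> 0) (at 0)"
  proof (rule tendsto_sandwich)
    show "\<forall>\<^sub>F h in at 0. 0 \<le> operator_norm V N (E h)" using ev by eventually_elim (use bnd in blast)
    show "\<forall>\<^sub>F h in at 0. operator_norm V N (E h) \<le> 2 * norm h * \<bar>K\<bar>"
      using ev by eventually_elim (use bnd in blast)
    show "((\<lambda>h::complex. 2 * norm h * \<bar>K\<bar>) \<longlongrightarrow> 0) (at 0)" by (auto intro!: tendsto_eq_intros)
  qed simp
  moreover have "bounded_operator V N (G1 s)" using hol_family_bounded_operator[OF G1] \<delta> by simp
  ultimately show "\<exists>D. bounded_operator V N D \<and>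
    ((\<lambda>h. operator_norm V N (\<lambda>\<phi> p. (G (s + h) \<phi> p - G s \<phi> p) / h - D \<phi> p)) \<longlongrightarrow> 0) (at 0)"
    unfolding E_def by blast
qed

text \<open>Dividing the Taylor expansion of \<open>G\<close> of order \<open>n\<close> by
  \<open>(s - a) ^ n\<close> turns coefficient \<open>n - j\<close> into the coefficient of the
  \<open>j\<close>-th polar term and the Taylor remainder into the holomorphic part.\<close>

lemma principal_part_of_family:
  assumes G: "hol_family a r G" and r: "r > 0"
    and R: "\<And>s \<phi>. s \<in> ball a r - {a} \<Longrightarrow> \<phi> \<in> V \<Longrightarrow> R s \<phi> = (\<lambda>p. G s \<phi> p / (s - a) ^ n)"
  shows "principal_part V N R a n (\<lambda>j \<phi> p. (dquot a ^^ (n - j)) (\<lambda>s. G s \<phi> p) a)"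
  unfolding principal_part_def
proof (intro conjI ballI)
  fix j assume "j \<in> {1..n}"
  show "bounded_operator V N (\<lambda>\<phi> p. (dquot a ^^ (n - j)) (\<lambda>s. G s \<phi> p) a)"
    using hol_family_bounded_operator[OF hol_family_dquot_iterate[OF G, of "n - j"], of a] r by simp
next
  define H where "H = (\<lambda>s \<phi> p. (dquot a ^^ n) (\<lambda>s. G s \<phi> p) s)"
  have "operator_holomorphic_on V N H (ball a r)"
    unfolding H_def by (rule hol_family_holomorphic[OF hol_family_dquot_iterate[OF G]])
  moreover have "R s \<phi> = (\<lambda>p. (\<Sum>j = 1..n. (dquot a ^^ (n - j)) (\<lambda>s. G s \<phi> p) a / (s - a) ^ j) + H s \<phi> p)"
    if s: "s \<in> ball a r - {a}" and \<phi>: "\<phi> \<in> V" for s \<phi>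
  proof
    fix p
    define c where "c i = (dquot a ^^ i) (\<lambda>s. G s \<phi> p) a" for i
    define x where "x = s - a"
    have x: "x \<noteq> 0" using s by (simp add: x_def)
    have "R s \<phi> p = G s \<phi> p / x ^ n" using R[OF s \<phi>] by (simp add: x_def)
    also have "\<dots> = ((\<Sum>i<n. c i * x ^ i) + x ^ n * H s \<phi> p) / x ^ n"
      using dquot_iterate_expand[where g = "\<lambda>s. G s \<phi> p" and z = s and n = n and a = a] by (simp add: c_def H_def x_def)
    also have "\<dots> = (\<Sum>i<n. c i * x ^ i / x ^ n) + H s \<phi> p"
      using x by (simp add: add_divide_distrib sum_divide_distrib)
    also have "(\<Sum>i<n. c i * x ^ i / x ^ n) = (\<Sum>j=1..n. c (n - j) / x ^ j)"
    proof (rule sum.reindex_bij_witness[of _ "\<lambda>j. n - j" "\<lambda>i. n - i"])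
      fix i assume i: "i \<in> {..<n}"
      then have "x ^ n = x ^ i * x ^ (n - i)" by (simp add: power_add[symmetric])
      then show "c (n - (n - i)) / x ^ (n - i) = c i * x ^ i / x ^ n" using x i by simp
    qed auto
    finally show "R s \<phi> p = (\<Sum>j = 1..n. (dquot a ^^ (n - j)) (\<lambda>s. G s \<phi> p) a / (s - a) ^ j) + H s \<phi> p"
      by (simp add: c_def x_def)
  qed
  ultimately show "\<exists>r>0. \<exists>H. operator_holomorphic_on V N H (ball a r) \<and>
    (\<forall>s\<in>ball a r - {a}. \<forall>\<phi>\<in>V. R s \<phi> =
      (\<lambda>p. (\<Sum>j = 1..n. (dquot a ^^ (n - j)) (\<lambda>s. G s \<phi> p) a / (s - a) ^ j) + H s \<phi> p))"
    using r by blast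
qed

end

subsection \<open>Transfer operators of subshifts of finite type\<close>

text \<open>Common form of both half-path spaces: read off from the base point, they differ only in
  the direction of the relation \<open>r\<close>.\<close>

definition sft_paths :: "'v edge set \<Rightarrow> ('v edge \<Rightarrow> 'v edge \<Rightarrow> bool) \<Rightarrow> 'v edge stream set" where
  "sft_paths E r = {p. sset p \<subseteq> E \<and> (\<forall>i. r (p !! i) (p !! Suc i))}"

lemma sft_paths_iff: "p \<in> sft_paths E r \<longleftrightarrow> (\<forall>i. p !! i \<in> E \<and> r (p !! i) (p !! Suc i))"
  unfolding sft_paths_def by (auto simp: sset_range)

lemma all_nat_split: "(\<forall>i. Q i) \<longleftrightarrow> Q 0 \<and> (\<forall>i. Q (Suc i))"
  by (metis not0_implies_Suc)

lemma sft_paths_Stream: "e ## p \<in> sft_paths E r \<longleftrightarrow> e \<in> E \<and> r e (shd p) \<and> p \<in> sft_paths E r"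
  unfolding sft_paths_iff
  by (rule trans[OF all_nat_split]) (simp only: snth.simps stream.sel conj_assoc)

lemma sft_paths_stl: "p \<in> sft_paths E r \<Longrightarrow> stl p \<in> sft_paths E r"
  using sft_paths_Stream[of "shd p" "stl p"] by simp

lemma sft_paths_sdrop: "p \<in> sft_paths E r \<Longrightarrow> sdrop n p \<in> sft_paths E r"
  by (induction n arbitrary: p) (auto simp: sft_paths_stl)

lemma set_stake_sft_paths:
  assumes "p \<in> sft_paths E r"
  shows "set (stake m p) \<subseteq> E"
  using assms stake_sdrop[of m p] sset_shift[of "stake m p" "sdrop m p"] unfolding sft_paths_def by auto

text \<open>\<open>succ\<close> continues every letter to an infinite path, while
  \<open>pred\<close> bounds the number of preimages under \<open>stl\<close> and thereby the sup
  norm of the transfer operator.\<close>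

locale sft =
  fixes E :: "'v edge set" and r :: "'v edge \<Rightarrow> 'v edge \<Rightarrow> bool" and q :: nat
  assumes finite_E: "finite E" and E_ne: "E \<noteq> {}"
    and succ: "\<And>a. a \<in> E \<Longrightarrow> \<exists>b\<in>E. r a b"
    and pred: "\<And>b. b \<in> E \<Longrightarrow> card {a \<in> E. r a b} \<le> q"
    and q_pos: "q \<ge> 1"
begin

abbreviation "P \<equiv> sft_paths E r"
abbreviation "L \<equiv> transfer P"

lemma path_from:
  assumes "e \<in> E"
  obtains p where "p \<in> P" "shd p = e"
proof -
  define f where "f a = (SOME b. b \<in> E \<and> r a b)" for a
  have f: "f a \<in> E \<and> r a (f a)" if "a \<in> E" for a
  proof -
    have "\<exists>b. b \<in> E \<and> r a b" using succ[OF that] by blast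
    then show ?thesis unfolding f_def by (rule someI_ex)
  qed
  have fE: "(f ^^ i) e \<in> E" for i
  proof (induction i)
    case (Suc i)
    then show ?case using f[of "(f ^^ i) e"] by simp
  qed (simp add: assms)
  have "siterate f e \<in> P" unfolding sft_paths_iff
  proof
    fix i
    show "siterate f e !! i \<in> E \<and> r (siterate f e !! i) (siterate f e !! Suc i)"
      unfolding snth_siterate funpow.simps o_apply using fE[of i] f[OF fE[of i]] by blast
  qed
  then show thesis using that[of "siterate f e"] by simp
qed

lemma finite_words: "finite {xs. set xs \<subseteq> E \<and> length xs = m}"
  by (rule finite_lists_length_eq[OF finite_E])

lemma P_ne: "P \<noteq> {}"
  using E_ne path_from by blast

definition pre :: "'v edge stream \<Rightarrow> 'v edge set" where
  "pre p = {e \<in> E. r e (shd p)}"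

lemma shd_E: "p \<in> P \<Longrightarrow> shd p \<in> E"
  unfolding sft_paths_iff by (metis snth.simps(1))

lemma card_pre: "p \<in> P \<Longrightarrow> card (pre p) \<le> q"
  unfolding pre_def by (rule pred[OF shd_E])

lemma L_eq: "L \<phi> p = (if p \<in> P then \<Sum>e\<in>pre p. \<phi> (e ## p) else 0)"
proof (cases "p \<in> P")
  case True
  have "{p' \<in> P. stl p' = p} = (\<lambda>e. e ## p) ` pre p"
  proof (intro equalityI subsetI)
    fix p' assume p': "p' \<in> {p' \<in> P. stl p' = p}"
    then have "p' = shd p' ## p" by auto
    moreover have "shd p' \<in> pre p" using p' sft_paths_Stream[of "shd p'" "stl p'"] unfolding pre_def by auto
    ultimately show "p' \<in> (\<lambda>e. e ## p) ` pre p" by blast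
  qed (use True in \<open>auto simp: pre_def sft_paths_Stream\<close>)
  moreover have "inj_on (\<lambda>e. e ## p) (pre p)" by (auto intro: inj_onI)
  ultimately show ?thesis using True unfolding transfer_def by (simp add: sum.reindex)
next
  case False
  then have empty: "{p' \<in> P. stl p' = p} = {}" using sft_paths_stl by blast
  show ?thesis unfolding transfer_def empty using False by simp
qed

lemma pre_P: "p \<in> P \<Longrightarrow> e \<in> pre p \<Longrightarrow> e ## p \<in> P"
  unfolding pre_def sft_paths_Stream by simp

lemma L_linear: "L (\<lambda>p. a * \<phi> p + b * \<psi> p) = (\<lambda>p. a * L \<phi> p + b * L \<psi> p)"
  by (rule ext) (simp add: L_eq sum.distrib sum_distrib_left)

lemma L_cmult: "L (\<lambda>p. a * \<phi> p) = (\<lambda>p. a * L \<phi> p)"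
  by (rule ext) (simp add: L_eq sum_distrib_left)

lemma sum_pre_le:
  fixes A :: real
  assumes "p \<in> P" "A \<ge> 0"
  shows "(\<Sum>e\<in>pre p. A) \<le> q * A"
  unfolding sum_constant using card_pre[OF assms(1)] assms(2) by (intro mult_right_mono) auto

lemma L_sup:
  fixes A :: real
  assumes "\<And>p. p \<in> P \<Longrightarrow> norm (\<phi> p) \<le> A" and p: "p \<in> P"
  shows "norm (L \<phi> p) \<le> q * A"
proof -
  have A: "A \<ge> 0" using assms(1)[OF p] norm_ge_zero order_trans by blast
  have "norm (L \<phi> p) = norm (\<Sum>e\<in>pre p. \<phi> (e ## p))" using p by (simp only: L_eq if_True)
  also have "\<dots> \<le> (\<Sum>e\<in>pre p. A)" using assms(1) pre_P[OF p] by (intro sum_norm_le) blast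
  also have "\<dots> \<le> q * A" by (rule sum_pre_le[OF p A])
  finally show ?thesis .
qed

lemma L_sums: "(\<And>p. (\<lambda>m. a m p) sums A p) \<Longrightarrow> (\<lambda>m. L (a m) p) sums L A p"
  unfolding L_eq by (auto intro!: sums_sum)

end

text \<open>\<open>n\<close> is the number of letters on which the locally constant functions in play depend.\<close>

locale sft_cylinder = sft E r q
  for E :: "'v edge set" and r q +
  fixes n :: nat and \<theta> :: real
  assumes n_pos: "n \<ge> 1" and \<theta>_pos: "0 < \<theta>" and \<theta>_less: "\<theta> < 1"
begin

sublocale lipschitz \<theta> P
  using \<theta>_pos \<theta>_less P_ne by unfold_locales

section \<open>Cylinders of length \<open>n\<close> and oscillation within them\<close>

definition W :: "'v edge list set" where "W = stake n ` P"

definition base :: "'v edge list \<Rightarrow> 'v edge stream" where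
  "base w = (SOME p. p \<in> P \<and> stake n p = w)"

abbreviation bp :: "'v edge stream \<Rightarrow> 'v edge stream" where "bp p \<equiv> base (stake n p)"

lemma base: "w \<in> W \<Longrightarrow> base w \<in> P" "w \<in> W \<Longrightarrow> stake n (base w) = w"
proof -
  have *: "base w \<in> P \<and> stake n (base w) = w" if w: "w \<in> W"
  proof -
    obtain p where "p \<in> P" "w = stake n p" using w unfolding W_def by blast
    then have "\<exists>p. p \<in> P \<and> stake n p = w" by blast
    from someI_ex[OF this] show ?thesis unfolding base_def .
  qed
  show "w \<in> W \<Longrightarrow> base w \<in> P" "w \<in> W \<Longrightarrow> stake n (base w) = w" using * by blast+
qed

lemma W_I [simp]: "p \<in> P \<Longrightarrow> stake n p \<in> W" unfolding W_def by simp

lemma finite_W: "finite W"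
  unfolding W_def by (rule finite_subset[OF _ finite_words[of n]]) (auto dest: subsetD[OF set_stake_sft_paths])

lemma shd_cong: "stake n p = stake n p' \<Longrightarrow> shd p = shd p'"
  using n_pos unfolding stake_eq_iff by (metis Suc_le_lessD One_nat_def snth.simps(1))

text \<open>Whether a letter may be prepended is decided by the first letter alone, and
  \<open>n_pos\<close> lets a cylinder determine that letter.\<close>

lemma pre_cong: "stake n p = stake n p' \<Longrightarrow> pre p = pre p'"
  unfolding pre_def using shd_cong by metis

lemma stake_Stream_cong:
  assumes "stake n p = stake n p'"
  shows "stake n (e ## p) = stake n (e ## p')"
proof -
  obtain k where k: "n = Suc k" using n_pos by (cases n) auto
  have "stake k p = stake k p'" using assms unfolding stake_eq_iff k by simp
  then show ?thesis by (simp add: k)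
qed

text \<open>The Lipschitz condition restricted to pairs in one cylinder. Only such pairs have
  matching preimages, so this is the seminorm that \<open>L\<close> multiplies by
  \<open>\<kappa>\<close>.\<close>

definition osc :: "('v edge stream \<Rightarrow> complex) \<Rightarrow> real \<Rightarrow> bool" where
  "osc \<phi> C \<longleftrightarrow> (\<forall>p\<in>P. \<forall>p'\<in>P. stake n p = stake n p' \<longrightarrow> norm (\<phi> p - \<phi> p') \<le> C * dst p p')"

lemma oscD: "osc \<phi> C \<Longrightarrow> p \<in> P \<Longrightarrow> p' \<in> P \<Longrightarrow> stake n p = stake n p' \<Longrightarrow> norm (\<phi> p - \<phi> p') \<le> C * dst p p'"
  unfolding osc_def by blast

text \<open>Paths in different cylinders are at least \<open>\<theta> ^ n\<close> apart, so the sup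
  bound alone yields the Lipschitz constant \<open>2 * A / \<theta> ^ n\<close> across cylinders;
  \<open>C\<close> serves inside them.\<close>

lemma lip_leI:
  assumes "\<And>p. p \<notin> P \<Longrightarrow> \<phi> p = 0" "\<And>p. p \<in> P \<Longrightarrow> norm (\<phi> p) \<le> A" "osc \<phi> C" "C \<ge> 0"
  shows "lip_le (C + 2 * A / \<theta> ^ n) \<phi>"
proof -
  obtain p where "p \<in> P" using P_ne by auto
  then have A: "A \<ge> 0" using assms(2) norm_ge_zero order_trans by blast
  have tn: "0 < \<theta> ^ n" "\<theta> ^ n \<le> 1" using \<theta>_pos \<theta>_less by (auto simp: power_le_one)
  have A2: "2 * A \<le> 2 * A / \<theta> ^ n"
    using A tn by (simp add: pos_le_divide_eq mult_left_le)
  show ?thesis unfolding lip_le_def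
  proof (intro conjI ballI allI impI)
    fix p assume "p \<in> P"
    then have "norm (\<phi> p) \<le> A" by (rule assms(2))
    then show "norm (\<phi> p) \<le> C + 2 * A / \<theta> ^ n" using A A2 assms(4) by linarith
  next
    fix p p' assume p: "p \<in> P" "p' \<in> P"
    show "norm (\<phi> p - \<phi> p') \<le> (C + 2 * A / \<theta> ^ n) * dst p p'"
    proof (cases "stake n p = stake n p'")
      case True
      then have "norm (\<phi> p - \<phi> p') \<le> C * dst p p'" using assms(3) p by (intro oscD)
      also have "\<dots> \<le> (C + 2 * A / \<theta> ^ n) * dst p p'" using A tn dst_nonneg by (intro mult_right_mono) auto
      finally show ?thesis .
    next
      case False
      have "norm (\<phi> p - \<phi> p') \<le> 2 * A"
        using norm_triangle_ineq4[of "\<phi> p" "\<phi> p'"] assms(2)[OF p(1)] assms(2)[OF p(2)] by linarith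
      also have "\<dots> = 2 * A / \<theta> ^ n * \<theta> ^ n" using \<theta>_pos by simp
      also have "\<dots> \<le> 2 * A / \<theta> ^ n * dst p p'" using dst_ge[OF False] A tn by (intro mult_left_mono) auto
      also have "\<dots> \<le> (C + 2 * A / \<theta> ^ n) * dst p p'" using assms(4) dst_nonneg by (intro mult_right_mono) auto
      finally show ?thesis .
    qed
  qed (use assms in auto)
qed

abbreviation "\<kappa> \<equiv> real q * \<theta>"

lemma \<kappa>_pos: "\<kappa> > 0" using \<theta>_pos q_pos by simp

text \<open>The two points have the same at most \<open>q\<close> preimage letters, and the paired
  preimages stay in one cylinder at \<open>\<theta>\<close> times the original distance.\<close>

lemma osc_L:
  assumes "osc \<phi> C" "C \<ge> 0"
  shows "osc (L \<phi>) (\<kappa> * C)"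
  unfolding osc_def
proof (intro ballI impI)
  fix p p' assume p: "p \<in> P" "p' \<in> P" and s: "stake n p = stake n p'"
  have "L \<phi> p - L \<phi> p' = (\<Sum>e\<in>pre p. \<phi> (e ## p) - \<phi> (e ## p'))"
    using p pre_cong[OF s] by (simp add: L_eq sum_subtractf)
  also have "norm \<dots> \<le> (\<Sum>e\<in>pre p. C * (\<theta> * dst p p'))"
  proof (rule sum_norm_le)
    fix e assume e: "e \<in> pre p"
    have "e ## p \<in> P" using pre_P[OF p(1) e] .
    moreover have "e ## p' \<in> P" using pre_P[OF p(2)] e pre_cong[OF s] by simp
    ultimately have "norm (\<phi> (e ## p) - \<phi> (e ## p')) \<le> C * dst (e ## p) (e ## p')"
      by (rule oscD[OF assms(1) _ _ stake_Stream_cong[OF s]])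
    then show "norm (\<phi> (e ## p) - \<phi> (e ## p')) \<le> C * (\<theta> * dst p p')"
      unfolding path_dist_Stream .
  qed
  also have "\<dots> \<le> q * (C * (\<theta> * dst p p'))"
    using assms(2) \<theta>_pos dst_nonneg by (intro sum_pre_le[OF p(1)] mult_nonneg_nonneg) auto
  finally show "norm (L \<phi> p - L \<phi> p') \<le> \<kappa> * C * dst p p'" by (simp add: mult_ac)
qed

lemma lip_le_osc: "lip_le C \<phi> \<Longrightarrow> osc \<phi> C"
  unfolding lip_le_def osc_def by blast

text \<open>Projection onto cylinder functions along the functions that vanish at the base
  points.\<close>

definition Q :: "('v edge stream \<Rightarrow> complex) \<Rightarrow> 'v edge stream \<Rightarrow> complex" where
  "Q \<phi> p = (if p \<in> P then \<phi> (bp p) else 0)"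

text \<open>The action of \<open>L\<close> on the quotient by cylinder functions, realised on the
  representatives that vanish at the base points.\<close>

definition M :: "('v edge stream \<Rightarrow> complex) \<Rightarrow> 'v edge stream \<Rightarrow> complex" where
  "M \<phi> p = L \<phi> p - Q (L \<phi>) p"

text \<open>These functions represent the quotient. Comparing with the base point, at distance at
  most 1, shows that \<open>C\<close> bounds their sup norm too (\<open>Z_bound\<close>).\<close>

definition Z :: "('v edge stream \<Rightarrow> complex) \<Rightarrow> real \<Rightarrow> bool" where
  "Z \<phi> C \<longleftrightarrow> (\<forall>p. p \<notin> P \<longrightarrow> \<phi> p = 0) \<and> (\<forall>w\<in>W. \<phi> (base w) = 0) \<and> osc \<phi> C \<and> C \<ge> 0"

lemma ZD:
  assumes "Z \<phi> C"
  shows "p \<notin> P \<Longrightarrow> \<phi> p = 0" "w \<in> W \<Longrightarrow> \<phi> (base w) = 0" "osc \<phi> C" "C \<ge> 0"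
  using assms unfolding Z_def by blast+

lemma bp_bp: "p \<in> P \<Longrightarrow> bp (bp p) = bp p" "p \<in> P \<Longrightarrow> bp p \<in> P"
  using base by auto

lemma osc_diff_Q: "osc \<phi> C \<Longrightarrow> osc (\<lambda>p. \<phi> p - Q \<phi> p) C"
  unfolding osc_def Q_def by auto

lemma Z_diff_Q:
  assumes "\<And>p. p \<notin> P \<Longrightarrow> \<phi> p = 0" "osc \<phi> C" "C \<ge> 0"
  shows "Z (\<lambda>p. \<phi> p - Q \<phi> p) C"
  unfolding Z_def using assms osc_diff_Q base by (auto simp: Q_def)

lemma Z_bound:
  assumes "Z \<phi> C" "p \<in> P"
  shows "norm (\<phi> p) \<le> C"
proof -
  have "norm (\<phi> p - \<phi> (bp p)) \<le> C * dst p (bp p)"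
    by (rule oscD[OF ZD(3)[OF assms(1)] assms(2) bp_bp(2)[OF assms(2)] base(2)[OF W_I[OF assms(2)], symmetric]])
  also have "\<dots> \<le> C * 1" using ZD(4)[OF assms(1)] dst_le_1 by (intro mult_left_mono)
  finally show ?thesis using ZD(2)[OF assms(1) W_I[OF assms(2)]] by simp
qed

lemma Z_M: "Z \<phi> C \<Longrightarrow> Z (M \<phi>) (\<kappa> * C)"
  unfolding M_def[abs_def] using ZD(3,4)[of \<phi> C] \<kappa>_pos
  by (intro Z_diff_Q osc_L) (auto simp: L_eq)

lemma Z_M_iterate: "Z \<phi> C \<Longrightarrow> Z ((M ^^ m) \<phi>) (\<kappa> ^ m * C)"
  by (induction m) (use Z_M in \<open>auto simp: mult.assoc\<close>)

lemma Q_linear: "Q (\<lambda>p. a * \<phi> p + b * \<psi> p) = (\<lambda>p. a * Q \<phi> p + b * Q \<psi> p)"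
  by (rule ext) (simp add: Q_def)

lemma M_linear: "M (\<lambda>p. a * \<phi> p + b * \<psi> p) = (\<lambda>p. a * M \<phi> p + b * M \<psi> p)"
  by (rule ext) (simp add: M_def L_linear Q_linear algebra_simps)

lemma M_iterate_linear: "(M ^^ m) (\<lambda>p. a * \<phi> p + b * \<psi> p) = (\<lambda>p. a * (M ^^ m) \<phi> p + b * (M ^^ m) \<psi> p)"
  by (induction m) (simp_all add: M_linear)

text \<open>\<open>M\<close> involves only finitely many point evaluations at each \<open>p\<close>,
  so it may be applied termwise to series that converge merely pointwise.\<close>

lemma M_sums:
  fixes a :: "nat \<Rightarrow> 'v edge stream \<Rightarrow> complex"
  assumes "\<And>p. (\<lambda>m. a m p) sums A p"
  shows "(\<lambda>m. M (a m) p) sums M A p"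
  unfolding M_def Q_def using L_sums[where a = a and A = A and p = p, OF assms] L_sums[where a = a and A = A and p = "bp p", OF assms]
  by (cases "p \<in> P") (auto intro: sums_diff)

definition S :: "complex \<Rightarrow> ('v edge stream \<Rightarrow> complex) \<Rightarrow> 'v edge stream \<Rightarrow> complex" where
  "S l \<phi> p = (\<Sum>m. (M ^^ m) \<phi> p / l ^ Suc m)"

lemma S_summable:
  assumes "Z \<phi> C" "norm l > \<kappa>"
  shows "norm ((M ^^ m) \<phi> p / l ^ Suc m) \<le> C / norm l * (\<kappa> / norm l) ^ m"
    "summable (\<lambda>m. norm ((M ^^ m) \<phi> p / l ^ Suc m))"
proof -
  have l: "norm l > 0" using assms \<kappa>_pos by linarith
  show b: "norm ((M ^^ m) \<phi> p / l ^ Suc m) \<le> C / norm l * (\<kappa> / norm l) ^ m" for m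
  proof -
    have "norm ((M ^^ m) \<phi> p) \<le> \<kappa> ^ m * C"
    proof (cases "p \<in> P")
      case True
      then show ?thesis by (rule Z_bound[OF Z_M_iterate[OF assms(1)]])
    next
      case False
      then have "(M ^^ m) \<phi> p = 0" by (rule ZD(1)[OF Z_M_iterate[OF assms(1)]])
      then show ?thesis using ZD(4)[OF Z_M_iterate[OF assms(1)], of m] by simp
    qed
    then show ?thesis using l by (simp add: norm_divide norm_power norm_mult power_divide field_simps)
  qed
  have "summable (\<lambda>m. C / norm l * (\<kappa> / norm l) ^ m)"
    using assms l \<kappa>_pos by (intro summable_mult summable_geometric) simp
  then show "summable (\<lambda>m. norm ((M ^^ m) \<phi> p / l ^ Suc m))"
    by (rule summable_comparison_test'[where N = 0]) (use b in simp)
qed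

lemma S_sums:
  assumes "Z \<phi> C" "norm l > \<kappa>"
  shows "(\<lambda>m. (M ^^ m) \<phi> p / l ^ Suc m) sums S l \<phi> p"
  unfolding S_def using summable_norm_cancel[OF S_summable(2)[OF assms]] by (simp add: summable_sums)

text \<open>The constant is the sum of the geometric series with ratio
  \<open>\<kappa> / norm l\<close>, since each application of \<open>M\<close> costs a factor
  \<open>\<kappa>\<close>.\<close>

lemma S_Z:
  assumes \<phi>: "Z \<phi> C" and l: "norm l > \<kappa>"
  shows "Z (S l \<phi>) (C / (norm l - \<kappa>))"
proof -
  have l0: "norm l > 0" using l \<kappa>_pos by linarith
  have geo: "(\<lambda>m. C / norm l * (\<kappa> / norm l) ^ m) sums (C / (norm l - \<kappa>))"
  proof -
    have "(\<lambda>m. C / norm l * (\<kappa> / norm l) ^ m) sums (C / norm l * (1 / (1 - \<kappa> / norm l)))"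
      using l l0 \<kappa>_pos by (intro sums_mult geometric_sums) simp
    also have "C / norm l * (1 / (1 - \<kappa> / norm l)) = C / (norm l - \<kappa>)"
      using l l0 by (simp add: field_simps)
    finally show ?thesis .
  qed
  have zero: "S l \<phi> p = 0" if "\<And>m. (M ^^ m) \<phi> p = 0" for p
    unfolding S_def using that by simp
  show ?thesis unfolding Z_def
  proof (intro conjI allI impI ballI)
    fix p assume "p \<notin> P"
    then show "S l \<phi> p = 0" using ZD(1)[OF Z_M_iterate[OF \<phi>]] by (intro zero)
  next
    fix w assume "w \<in> W"
    then show "S l \<phi> (base w) = 0" using ZD(2)[OF Z_M_iterate[OF \<phi>]] by (intro zero)
  next
    show "osc (S l \<phi>) (C / (norm l - \<kappa>))" unfolding osc_def
    proof (intro ballI impI)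
      fix p p' assume p: "p \<in> P" "p' \<in> P" "stake n p = stake n p'"
      have s: "(\<lambda>m. (M ^^ m) \<phi> p / l ^ Suc m - (M ^^ m) \<phi> p' / l ^ Suc m) sums (S l \<phi> p - S l \<phi> p')"
        by (intro sums_diff S_sums[OF \<phi> l])
      have g: "(\<lambda>m. C / norm l * (\<kappa> / norm l) ^ m * dst p p') sums (C / (norm l - \<kappa>) * dst p p')"
        by (intro sums_mult2 geo)
      have b: "norm ((M ^^ m) \<phi> p / l ^ Suc m - (M ^^ m) \<phi> p' / l ^ Suc m) \<le> C / norm l * (\<kappa> / norm l) ^ m * dst p p'" for m
      proof -
        have "norm ((M ^^ m) \<phi> p - (M ^^ m) \<phi> p') \<le> \<kappa> ^ m * C * dst p p'"
          using oscD[OF ZD(3)[OF Z_M_iterate[OF \<phi>]] p] .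
        then show ?thesis using l0
          by (simp add: diff_divide_distrib[symmetric] norm_divide norm_power norm_mult power_divide field_simps)
      qed
      have "norm (\<Sum>m. (M ^^ m) \<phi> p / l ^ Suc m - (M ^^ m) \<phi> p' / l ^ Suc m) \<le> (\<Sum>m. C / norm l * (\<kappa> / norm l) ^ m * dst p p')"
        by (rule norm_suminf_le[OF b sums_summable[OF g]])
      then show "norm (S l \<phi> p - S l \<phi> p') \<le> C / (norm l - \<kappa>) * dst p p'"
        using sums_unique[OF s] sums_unique[OF g] by simp
    qed
  next
    show "C / (norm l - \<kappa>) \<ge> 0" using \<phi> l unfolding Z_def by simp
  qed
qed

text \<open>Applying \<open>M\<close> termwise shifts the Neumann series by one place; against
  \<open>l\<close> times the series only the term for \<open>m = 0\<close> is left over.\<close>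

lemma S_equation:
  assumes "Z \<phi> C" "norm l > \<kappa>"
  shows "l * S l \<phi> p - M (S l \<phi>) p = \<phi> p"
proof -
  have l: "l \<noteq> 0" using assms \<kappa>_pos by auto
  have "(\<lambda>m. M (\<lambda>p. (M ^^ m) \<phi> p / l ^ Suc m) p) sums M (S l \<phi>) p"
    by (rule M_sums[OF S_sums[OF assms]])
  moreover have "M (\<lambda>p. (M ^^ m) \<phi> p / l ^ Suc m) = (\<lambda>p. (M ^^ Suc m) \<phi> p / l ^ Suc m)" for m
    using M_linear[of "1 / l ^ Suc m" "(M ^^ m) \<phi>" 0 "(M ^^ m) \<phi>"] by simp
  ultimately have "(\<lambda>m. (M ^^ Suc m) \<phi> p / l ^ Suc m) sums M (S l \<phi>) p" by simp
  then have "(\<lambda>m. (M ^^ m) \<phi> p / l ^ m) sums (M (S l \<phi>) p + \<phi> p)"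
    using sums_Suc_iff[of "\<lambda>m. (M ^^ m) \<phi> p / l ^ m" "M (S l \<phi>) p"] by simp
  moreover have "(\<lambda>m. l * ((M ^^ m) \<phi> p / l ^ Suc m)) sums (l * S l \<phi> p)"
    by (rule sums_mult[OF S_sums[OF assms]])
  then have "(\<lambda>m. (M ^^ m) \<phi> p / l ^ m) sums (l * S l \<phi> p)" using l by simp
  ultimately show ?thesis using sums_unique2 by fastforce
qed

lemma S_linear:
  assumes "Z \<phi> C" "Z \<psi> D" "norm l > \<kappa>"
  shows "S l (\<lambda>p. a * \<phi> p + b * \<psi> p) = (\<lambda>p. a * S l \<phi> p + b * S l \<psi> p)"
proof
  fix p
  have "(\<lambda>m. a * ((M ^^ m) \<phi> p / l ^ Suc m) + b * ((M ^^ m) \<psi> p / l ^ Suc m)) sums (a * S l \<phi> p + b * S l \<psi> p)"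
    by (intro sums_add sums_mult S_sums[OF assms(1,3)] S_sums[OF assms(2,3)])
  then show "S l (\<lambda>p. a * \<phi> p + b * \<psi> p) p = a * S l \<phi> p + b * S l \<psi> p"
    unfolding S_def[of l "\<lambda>p. a * \<phi> p + b * \<psi> p"] M_iterate_linear
    by (subst sums_unique[of _ "a * S l \<phi> p + b * S l \<psi> p"]) (simp_all add: add_divide_distrib)
qed

text \<open>\<open>l * S l \<phi> p\<close> is a power series in \<open>1 / l\<close> that converges
  for \<open>norm (1 / l) < 1 / \<kappa>\<close>.\<close>

lemma S_holomorphic:
  assumes "Z \<phi> C"
  shows "(\<lambda>l. S l \<phi> p) holomorphic_on {l. norm l > \<kappa>}"
proof -
  define g where "g x = (\<Sum>m. (M ^^ m) \<phi> p * x ^ m)" for x :: complex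
  have eq: "(\<lambda>m. (M ^^ m) \<phi> p * (1 / l) ^ m) sums (l * S l \<phi> p)" if l: "norm l > \<kappa>" for l
  proof -
    have l0: "l \<noteq> 0" using l \<kappa>_pos by auto
    have "(\<lambda>m. l * ((M ^^ m) \<phi> p / l ^ Suc m)) sums (l * S l \<phi> p)"
      by (rule sums_mult[OF S_sums[OF assms l]])
    then show ?thesis using l0 by (simp add: power_divide)
  qed
  have "g holomorphic_on ball 0 (1 / \<kappa>)"
  proof (rule power_series_holomorphic)
    fix w :: complex assume w: "w \<in> ball 0 (1 / \<kappa>)"
    show "(\<lambda>m. (M ^^ m) \<phi> p * (w - 0) ^ m) sums g w"
    proof (cases "w = 0")
      case True
      then show ?thesis unfolding g_def using powser_sums_zero[of "\<lambda>m. (M ^^ m) \<phi> p"]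
        by (simp add: sums_iff)
    next
      case False
      have "norm w * \<kappa> < 1" using w \<kappa>_pos by (simp add: field_simps)
      then have "norm (1 / w) > \<kappa>" using False by (simp add: norm_divide field_simps)
      from eq[OF this] False show ?thesis unfolding g_def by (simp add: sums_iff)
    qed
  qed
  moreover have inv: "1 / l \<in> ball 0 (1 / \<kappa>)" if "norm l > \<kappa>" for l :: complex
    using that \<kappa>_pos frac_less2[of 1 1 \<kappa> "norm l"] by (simp add: norm_divide)
  ultimately have "(\<lambda>l. g (1 / l) / l) holomorphic_on {l. norm l > \<kappa>}"
    using \<kappa>_pos inv
    by (intro holomorphic_intros holomorphic_on_compose_gen[of "\<lambda>l. 1 / l" _ g "ball 0 (1 / \<kappa>)", unfolded o_def]) auto
  moreover have "g (1 / l) / l = S l \<phi> p" if "l \<in> {l. norm l > \<kappa>}" for l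
  proof -
    have l: "norm l > \<kappa>" "l \<noteq> 0" using that \<kappa>_pos by auto
    then have "g (1 / l) = l * S l \<phi> p" unfolding g_def using eq[OF l(1)] by (simp add: sums_iff)
    then show ?thesis using l by simp
  qed
  ultimately show ?thesis by (rule holomorphic_transform)
qed

end

lemma member_le_double_sum:
  fixes f :: "'a \<Rightarrow> 'b \<Rightarrow> real"
  assumes "finite A" "finite B" "a \<in> A" "b \<in> B" "\<And>a b. f a b \<ge> 0"
  shows "f a b \<le> (\<Sum>a\<in>A. \<Sum>b\<in>B. f a b)"
proof -
  have "f a b \<le> (\<Sum>b\<in>B. f a b)" using assms by (intro member_le_sum) auto
  also have "\<dots> \<le> (\<Sum>a\<in>A. \<Sum>b\<in>B. f a b)"
    using assms by (intro member_le_sum[where f = "\<lambda>a. \<Sum>b\<in>B. f a b"]) (auto intro: sum_nonneg)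
  finally show ?thesis .
qed

context sft_cylinder
begin

definition dev :: "('v edge stream \<Rightarrow> complex) \<Rightarrow> 'v edge stream \<Rightarrow> complex" where
  "dev \<phi> = (\<lambda>p. \<phi> p - Q \<phi> p)"

lemma dev_linear: "dev (\<lambda>p. a * \<phi> p + b * \<psi> p) = (\<lambda>p. a * dev \<phi> p + b * dev \<psi> p)"
  by (simp add: dev_def Q_linear algebra_simps)

lemma V_D:
  assumes "\<phi> \<in> V"
  shows "p \<notin> P \<Longrightarrow> \<phi> p = 0" "norm (\<phi> p) \<le> N \<phi>"
proof -
  have l: "lip_le (N \<phi>) \<phi>" by (rule lip_le_norm[OF assms])
  show z: "p \<notin> P \<Longrightarrow> \<phi> p = 0" using l unfolding lip_le_def by blast
  show "norm (\<phi> p) \<le> N \<phi>"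
  proof (cases "p \<in> P")
    case True
    then show ?thesis using l unfolding lip_le_def by blast
  next
    case False
    then show ?thesis using z N_nonneg[OF assms] by simp
  qed
qed

lemma Z_dev: "\<phi> \<in> V \<Longrightarrow> Z (dev \<phi>) (N \<phi>)"
  unfolding dev_def by (intro Z_diff_Q V_D lip_le_osc lip_le_norm N_nonneg)

definition cyl :: "('v edge stream \<Rightarrow> complex) \<Rightarrow> bool" where
  "cyl \<phi> \<longleftrightarrow> (\<forall>p. p \<notin> P \<longrightarrow> \<phi> p = 0) \<and> (\<forall>p\<in>P. \<phi> p = \<phi> (bp p))"

lemma cylI: "(\<And>p. p \<notin> P \<Longrightarrow> \<phi> p = 0) \<Longrightarrow> (\<And>p. p \<in> P \<Longrightarrow> \<phi> p = \<phi> (bp p)) \<Longrightarrow> cyl \<phi>"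
  unfolding cyl_def by blast

lemma cylD: "cyl \<phi> \<Longrightarrow> p \<notin> P \<Longrightarrow> \<phi> p = 0" "cyl \<phi> \<Longrightarrow> p \<in> P \<Longrightarrow> \<phi> p = \<phi> (bp p)"
  unfolding cyl_def by blast+

lemma cyl_cong:
  assumes "cyl \<phi>" "p \<in> P" "p' \<in> P" "stake n p = stake n p'"
  shows "\<phi> p = \<phi> p'"
  using cylD(2)[OF assms(1,2)] cylD(2)[OF assms(1,3)] assms(4) by simp

lemma cyl_eqI:
  assumes "cyl \<phi>" "cyl \<psi>" "\<And>w. w \<in> W \<Longrightarrow> \<phi> (base w) = \<psi> (base w)"
  shows "\<phi> = \<psi>"
proof
  fix p
  show "\<phi> p = \<psi> p"
    using cylD[OF assms(1), of p] cylD[OF assms(2), of p] assms(3)[OF W_I] by (cases "p \<in> P") auto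
qed

lemma cyl_lincomb:
  assumes "cyl \<phi>" "cyl \<psi>"
  shows "cyl (\<lambda>p. a * \<phi> p + b * \<psi> p)"
proof (rule cylI)
  fix p assume "p \<notin> P"
  then show "a * \<phi> p + b * \<psi> p = 0" using cylD(1)[OF assms(1)] cylD(1)[OF assms(2)] by simp
next
  fix p assume "p \<in> P"
  then show "a * \<phi> p + b * \<psi> p = a * \<phi> (bp p) + b * \<psi> (bp p)"
    using cylD(2)[OF assms(1)] cylD(2)[OF assms(2)] by metis
qed

text \<open>Prepending one letter to two paths of a cylinder leaves them in a common cylinder. This
  is the invariance that makes \<open>L\<close> block triangular.\<close>

lemma cyl_L:
  assumes "cyl \<phi>"
  shows "cyl (L \<phi>)"
proof (rule cylI)
  fix p assume p: "p \<in> P"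
  have s: "stake n p = stake n (bp p)" using base(2)[OF W_I[OF p]] by simp
  have "\<phi> (e ## p) = \<phi> (e ## bp p)" if "e \<in> pre p" for e
    using that pre_P[OF p that] pre_P[OF bp_bp(2)[OF p]] pre_cong[OF s]
    by (intro cyl_cong[OF assms _ _ stake_Stream_cong[OF s]]) auto
  then show "L \<phi> p = L \<phi> (bp p)" using p bp_bp(2)[OF p] pre_cong[OF s] by (simp add: L_eq)
qed (simp add: L_eq)

lemma cyl_dev: "cyl \<phi> \<Longrightarrow> dev \<phi> = (\<lambda>_. 0)"
  unfolding dev_def Q_def using cylD[of \<phi>] by auto

lemma cyl_norm_le:
  assumes "cyl \<phi>"
  shows "norm (\<phi> p) \<le> (\<Sum>w\<in>W. norm (\<phi> (base w)))"
proof (cases "p \<in> P")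
  case True
  have "norm (\<phi> (bp p)) \<le> (\<Sum>w\<in>W. norm (\<phi> (base w)))"
    using True finite_W by (intro member_le_sum[where f = "\<lambda>w. norm (\<phi> (base w))"]) auto
  then show ?thesis using cylD(2)[OF assms True] by simp
next
  case False
  then show ?thesis using cylD(1)[OF assms False] by (simp add: sum_nonneg)
qed

lemma cyl_V:
  assumes "cyl \<phi>"
  shows "\<phi> \<in> V"
proof (rule lip_le_imp(1)[OF lip_leI])
  show "osc \<phi> 0" unfolding osc_def
  proof (intro ballI impI)
    fix p p' assume "p \<in> P" "p' \<in> P" "stake n p = stake n p'"
    then have "\<phi> p = \<phi> p'" by (rule cyl_cong[OF assms])
    then show "norm (\<phi> p - \<phi> p') \<le> 0 * dst p p'" by simp
  qed
  show "p \<notin> P \<Longrightarrow> \<phi> p = 0" for p by (rule cylD(1)[OF assms])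
  show "norm (\<phi> p) \<le> (\<Sum>w\<in>W. norm (\<phi> (base w)))" for p by (rule cyl_norm_le[OF assms])
qed simp

definition ind :: "'v edge list \<Rightarrow> 'v edge stream \<Rightarrow> complex" where
  "ind w p = (if p \<in> P \<and> stake n p = w then 1 else 0)"

lemma cyl_ind: "cyl (ind w)"
  by (intro cylI) (auto simp: ind_def bp_bp base)

lemma cyl_expand:
  assumes "cyl \<phi>"
  shows "\<phi> = (\<lambda>p. \<Sum>w\<in>W. \<phi> (base w) * ind w p)"
proof
  fix p
  show "\<phi> p = (\<Sum>w\<in>W. \<phi> (base w) * ind w p)"
  proof (cases "p \<in> P")
    case True
    have "(\<Sum>w\<in>W. \<phi> (base w) * ind w p) = (\<Sum>w\<in>W. if w = stake n p then \<phi> (base w) else 0)"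
      using True by (intro sum.cong) (auto simp: ind_def)
    then show ?thesis using True finite_W cylD(2)[OF assms True] by simp
  qed (use cylD(1)[OF assms] in \<open>simp add: ind_def\<close>)
qed

text \<open>The matrix of \<open>L\<close> on cylinder functions in the basis of indicators, with
  the word of evaluation as row index.\<close>

definition T :: "'v edge list \<Rightarrow> 'v edge list \<Rightarrow> complex" where
  "T w w' = L (ind w') (base w)"

lemma L_sum: "L (\<lambda>p. \<Sum>i\<in>I. a i * \<phi> i p) p = (\<Sum>i\<in>I. a i * L (\<phi> i) p)"
proof (cases "p \<in> P")
  case True
  have "(\<Sum>e\<in>pre p. \<Sum>i\<in>I. a i * \<phi> i (e ## p)) = (\<Sum>i\<in>I. \<Sum>e\<in>pre p. a i * \<phi> i (e ## p))"
    by (rule sum.swap)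
  then show ?thesis using True by (simp add: L_eq sum_distrib_left)
qed (simp add: L_eq)

lemma L_cyl_base:
  assumes "cyl \<phi>"
  shows "L \<phi> (base w) = (\<Sum>w'\<in>W. T w w' * \<phi> (base w'))"
  by (subst cyl_expand[OF assms], subst L_sum) (simp add: T_def mult.commute)

lemma cyl_of_base: "cyl (\<lambda>p. if p \<in> P then c (stake n p) else 0)"
  by (rule cylI) (auto simp: bp_bp base)

text \<open>A matrix applied to the values at the base points, with the result extended to a
  cylinder function.\<close>

definition K :: "('v edge list \<Rightarrow> 'v edge list \<Rightarrow> complex) \<Rightarrow> ('v edge stream \<Rightarrow> complex) \<Rightarrow> 'v edge stream \<Rightarrow> complex" where
  "K c \<psi> p = (if p \<in> P then \<Sum>w\<in>W. c (stake n p) w * \<psi> (base w) else 0)"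

lemma K_cyl: "cyl (K c \<psi>)"
  unfolding K_def[abs_def] by (rule cyl_of_base)

lemma K_linear: "K c (\<lambda>p. a * \<phi> p + b * \<psi> p) p = a * K c \<phi> p + b * K c \<psi> p"
  by (simp add: K_def sum.distrib sum_distrib_left algebra_simps)

lemma K_base: "w \<in> W \<Longrightarrow> K c \<psi> (base w) = (\<Sum>w'\<in>W. c w w' * \<psi> (base w'))"
  by (simp add: K_def base)

text \<open>
  In the decomposition of \<open>V\<close> into cylinder functions and functions vanishing at the base points the
  transfer operator is block triangular, with diagonal blocks the matrix \<open>T\<close> and \<open>M\<close>. The resolvent is
  assembled from the Neumann series \<open>S l\<close> of \<open>M\<close> and the inverse matrix \<open>c\<close> of \<open>l - T\<close>; the factor \<open>\<mu>\<close>
  makes room for multiplying the resolvent by a scalar.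
\<close>

definition block_op :: "complex \<Rightarrow> complex \<Rightarrow> ('v edge list \<Rightarrow> 'v edge list \<Rightarrow> complex) \<Rightarrow>
    ('v edge stream \<Rightarrow> complex) \<Rightarrow> 'v edge stream \<Rightarrow> complex" where
  "block_op l \<mu> c \<phi> p = \<mu> * S l (dev \<phi>) p + K c (\<lambda>p. \<phi> p + L (S l (dev \<phi>)) p) p"

lemma block_op_linear:
  assumes "\<phi> \<in> V" "\<psi> \<in> V" "norm l > \<kappa>"
  shows "block_op l \<mu> c (\<lambda>p. a * \<phi> p + b * \<psi> p) = (\<lambda>p. a * block_op l \<mu> c \<phi> p + b * block_op l \<mu> c \<psi> p)"
proof
  fix p
  have S: "S l (dev (\<lambda>p. a * \<phi> p + b * \<psi> p)) = (\<lambda>p. a * S l (dev \<phi>) p + b * S l (dev \<psi>) p)"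
    unfolding dev_linear by (rule S_linear[OF Z_dev[OF assms(1)] Z_dev[OF assms(2)] assms(3)])
  have KK: "(\<lambda>p. (a * \<phi> p + b * \<psi> p) + L (S l (dev (\<lambda>p. a * \<phi> p + b * \<psi> p))) p) =
     (\<lambda>p. a * (\<phi> p + L (S l (dev \<phi>)) p) + b * (\<psi> p + L (S l (dev \<psi>)) p))"
    unfolding S L_linear by (simp add: algebra_simps)
  have "K c (\<lambda>p. (a * \<phi> p + b * \<psi> p) + L (S l (dev (\<lambda>p. a * \<phi> p + b * \<psi> p))) p) p =
     a * K c (\<lambda>p. \<phi> p + L (S l (dev \<phi>)) p) p + b * K c (\<lambda>p. \<psi> p + L (S l (dev \<psi>)) p) p"
    unfolding KK by (rule K_linear)
  then show "block_op l \<mu> c (\<lambda>p. a * \<phi> p + b * \<psi> p) p = a * block_op l \<mu> c \<phi> p + b * block_op l \<mu> c \<psi> p"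
    unfolding block_op_def fun_cong[OF S, of p] by (simp only: distrib_left mult_ac add_ac)
qed

text \<open>The constant is fixed before \<open>l\<close>, \<open>\<mu>\<close>, \<open>c\<close>
  and \<open>\<phi>\<close>: a holomorphic family needs one bound for all parameters near a pole,
  and a gap \<open>\<delta>\<close> and a bound \<open>B\<close> are all that is known about
  them.\<close>

lemma block_op_bound:
  assumes \<delta>: "\<delta> > 0"
  obtains C where "\<And>l \<mu> c \<phi>. norm l \<ge> \<kappa> + \<delta> \<Longrightarrow> norm \<mu> \<le> B \<Longrightarrow>
      (\<And>w w'. w \<in> W \<Longrightarrow> w' \<in> W \<Longrightarrow> norm (c w w') \<le> B) \<Longrightarrow> \<phi> \<in> V \<Longrightarrow> lip_le (C * N \<phi>) (block_op l \<mu> c \<phi>)"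
proof -
  \<comment> \<open>Per unit of \<open>N \<phi>\<close>: \<open>B / \<delta>\<close> bounds the
    Neumann part, and the matrix part has \<open>card W\<close> entries of size \<open>B\<close>
    acting on \<open>\<phi> + L (S l (dev \<phi>))\<close>, of size at most
    \<open>1 + q / \<delta>\<close>.\<close>
  define A where "A = B / \<delta> + card W * B * (1 + q / \<delta>)"
  show thesis
  proof (rule that[of "B / \<delta> + 2 * A / \<theta> ^ n"])
    fix l \<mu> :: complex and c :: "'v edge list \<Rightarrow> 'v edge list \<Rightarrow> complex" and \<phi>
    assume l: "norm l \<ge> \<kappa> + \<delta>" and \<mu>: "norm \<mu> \<le> B"
      and c: "\<And>w w'. w \<in> W \<Longrightarrow> w' \<in> W \<Longrightarrow> norm (c w w') \<le> B" and \<phi>: "\<phi> \<in> V"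
    have l\<kappa>: "norm l > \<kappa>" using l \<delta> by linarith
    have B: "B \<ge> 0" using \<mu> norm_ge_zero order_trans by blast
    have N0: "N \<phi> \<ge> 0" by (rule N_nonneg[OF \<phi>])
    let ?S = "S l (dev \<phi>)" and ?D = "N \<phi> / (norm l - \<kappa>)"
    have ZS: "Z ?S ?D" by (rule S_Z[OF Z_dev[OF \<phi>] l\<kappa>])
    have D: "?D \<le> N \<phi> / \<delta>" using l \<delta> N0 by (intro divide_left_mono) auto
    have supS: "norm (?S p) \<le> N \<phi> / \<delta>" if "p \<in> P" for p using Z_bound[OF ZS that] D by linarith
    have supL: "norm (\<phi> p + L ?S p) \<le> N \<phi> * (1 + q / \<delta>)" if "p \<in> P" for p
    proof -
      have "norm (L ?S p) \<le> q * (N \<phi> / \<delta>)" using supS that by (rule L_sup)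
      then show ?thesis using norm_triangle_ineq[of "\<phi> p" "L ?S p"] V_D(2)[OF \<phi>, of p] by (simp add: algebra_simps)
    qed
    let ?K = "K c (\<lambda>p. \<phi> p + L ?S p)"
    have supK: "norm (?K p) \<le> card W * (B * (N \<phi> * (1 + q / \<delta>)))" if p: "p \<in> P" for p
    proof -
      have "norm (?K p) \<le> (\<Sum>w\<in>W. B * (N \<phi> * (1 + q / \<delta>)))"
        unfolding K_def if_P[OF p]
      proof (rule sum_norm_le)
        fix w assume w: "w \<in> W"
        show "norm (c (stake n p) w * (\<phi> (base w) + L ?S (base w))) \<le> B * (N \<phi> * (1 + q / \<delta>))"
          unfolding norm_mult by (intro mult_mono c W_I[OF p] w supL base B norm_ge_zero)
      qed
      then show ?thesis by simp
    qed
    have "lip_le (B * (N \<phi> / \<delta>) + 2 * (A * N \<phi>) / \<theta> ^ n) (block_op l \<mu> c \<phi>)"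
    proof (rule lip_leI)
      fix p assume p: "p \<in> P"
      have "norm (\<mu> * ?S p) \<le> B * (N \<phi> / \<delta>)"
        unfolding norm_mult by (intro mult_mono \<mu> supS[OF p] B norm_ge_zero)
      then have "norm (block_op l \<mu> c \<phi> p) \<le> B * (N \<phi> / \<delta>) + card W * (B * (N \<phi> * (1 + q / \<delta>)))"
        unfolding block_op_def using supK[OF p] norm_triangle_ineq[of "\<mu> * ?S p" "?K p"] by linarith
      also have "\<dots> = A * N \<phi>" unfolding A_def by (simp add: algebra_simps)
      finally show "norm (block_op l \<mu> c \<phi> p) \<le> A * N \<phi>" .
    next
      show "osc (block_op l \<mu> c \<phi>) (B * (N \<phi> / \<delta>))" unfolding osc_def
      proof (intro ballI impI)
        fix p p' assume p: "p \<in> P" "p' \<in> P" "stake n p = stake n p'"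
        have "?K p = ?K p'" by (rule cyl_cong[OF K_cyl p])
        then have "norm (block_op l \<mu> c \<phi> p - block_op l \<mu> c \<phi> p') = norm \<mu> * norm (?S p - ?S p')"
          unfolding block_op_def by (simp add: norm_mult[symmetric] algebra_simps)
        also have "\<dots> \<le> B * (N \<phi> / \<delta> * dst p p')"
        proof (rule mult_mono)
          have "norm (?S p - ?S p') \<le> ?D * dst p p'" by (rule oscD[OF ZD(3)[OF ZS] p])
          also have "\<dots> \<le> N \<phi> / \<delta> * dst p p'" using D dst_nonneg by (rule mult_right_mono)
          finally show "norm (?S p - ?S p') \<le> N \<phi> / \<delta> * dst p p'" .
        qed (use \<mu> B in auto)
        finally show "norm (block_op l \<mu> c \<phi> p - block_op l \<mu> c \<phi> p') \<le> B * (N \<phi> / \<delta>) * dst p p'" by simp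
      qed
    next
      show "0 \<le> B * (N \<phi> / \<delta>)" using B N0 \<delta> by simp
    next
      fix p assume "p \<notin> P"
      then show "block_op l \<mu> c \<phi> p = 0" unfolding block_op_def using ZD(1)[OF ZS] by (simp add: K_def)
    qed
    then show "lip_le ((B / \<delta> + 2 * A / \<theta> ^ n) * N \<phi>) (block_op l \<mu> c \<phi>)" by (simp add: algebra_simps)
  qed
qed

lemma L_V:
  assumes "\<phi> \<in> V"
  shows "L \<phi> \<in> V"
proof (rule lip_le_imp(1)[OF lip_leI])
  show "osc (L \<phi>) (\<kappa> * N \<phi>)" by (intro osc_L lip_le_osc lip_le_norm N_nonneg assms)
  show "norm (L \<phi> p) \<le> q * N \<phi>" if "p \<in> P" for p using V_D(2)[OF assms] that by (rule L_sup)
  show "\<kappa> * N \<phi> \<ge> 0" using \<kappa>_pos N_nonneg[OF assms] by simp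
qed (simp add: L_eq)

text \<open>In the expansion of \<open>A \<phi>\<close> by indicators of words the coefficients are
  its base-point values. These evaluations are the functionals of a decomposition, and the trace
  becomes a diagonal sum although \<open>A\<close> acts on all of \<open>V\<close>.\<close>

lemma finite_rank_of_cyl_range:
  assumes cyl: "\<And>\<phi>. \<phi> \<in> V \<Longrightarrow> cyl (A \<phi>)"
    and lin: "\<And>\<phi> \<psi> a b. \<phi> \<in> V \<Longrightarrow> \<psi> \<in> V \<Longrightarrow> A (\<lambda>p. a * \<phi> p + b * \<psi> p) = (\<lambda>p. a * A \<phi> p + b * A \<psi> p)"
  shows "finite_rank V A" "finite_rank_trace V A = (\<Sum>w\<in>W. A (ind w) (base w))"
proof -
  obtain h where h: "bij_betw h {0..<card W} W" using ex_bij_betw_nat_finite[OF finite_W] by blast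
  have reindex: "(\<Sum>w\<in>W. f w) = (\<Sum>i<card W. f (h i))" for f :: "_ \<Rightarrow> complex"
    using sum.reindex_bij_betw[OF h, of f] by (simp add: atLeast0LessThan)
  have "rank_decomposition V A (card W) (\<lambda>i \<phi>. A \<phi> (base (h i))) (\<lambda>i. ind (h i))"
    unfolding rank_decomposition_def
  proof (intro conjI allI impI ballI)
    fix \<phi> assume "\<phi> \<in> V"
    from cyl_expand[OF cyl[OF this]] show "A \<phi> = (\<lambda>p. \<Sum>i<card W. A \<phi> (base (h i)) * ind (h i) p)"
      unfolding reindex .
  qed (use lin cyl_V[OF cyl_ind] in auto)
  then show "finite_rank V A" "finite_rank_trace V A = (\<Sum>w\<in>W. A (ind w) (base w))"
    unfolding finite_rank_def reindex using finite_rank_trace_eq[OF lin_closed_V] by blast+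
qed

end

text \<open>The hypotheses say that \<open>adj l / d l\<close> is the inverse of the matrix \<open>l - T\<close>.\<close>

locale sft_resolvent = sft_cylinder E r q n \<theta>
  for E :: "'v edge set" and r q n \<theta> +
  fixes adj :: "'v edge list \<Rightarrow> 'v edge list \<Rightarrow> complex poly" and d :: "complex poly"
  assumes d_nz: "d \<noteq> 0"
    and adj_right: "\<And>x i j. i \<in> W \<Longrightarrow> j \<in> W \<Longrightarrow>
       x * poly (adj i j) x - (\<Sum>k\<in>W. T i k * poly (adj k j) x) = (if i = j then poly d x else 0)"
    and adj_left: "\<And>x i j. i \<in> W \<Longrightarrow> j \<in> W \<Longrightarrow>
       x * poly (adj i j) x - (\<Sum>k\<in>W. poly (adj i k) x * T k j) = (if i = j then poly d x else 0)"
    and d_eigenvector: "\<And>x. poly d x = 0 \<Longrightarrow>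
       \<exists>v. (\<exists>i\<in>W. v i \<noteq> 0) \<and> (\<forall>i\<in>W. (\<Sum>k\<in>W. T i k * v k) = x * v i)"
begin

abbreviation "cf l \<equiv> \<lambda>w w'. poly (adj w w') l / poly d l"

abbreviation "Res l \<equiv> block_op l 1 (cf l)"

lemma K_right_inverse:
  assumes l: "poly d l \<noteq> 0" and w: "w \<in> W"
  shows "l * K (cf l) \<psi> (base w) - L (K (cf l) \<psi>) (base w) = \<psi> (base w)"
proof -
  have "l * K (cf l) \<psi> (base w) - L (K (cf l) \<psi>) (base w) =
     l * (\<Sum>j\<in>W. cf l w j * \<psi> (base j)) - (\<Sum>k\<in>W. T w k * (\<Sum>j\<in>W. cf l k j * \<psi> (base j)))"
    unfolding L_cyl_base[OF K_cyl] using w by (simp add: K_base)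
  also have "(\<Sum>k\<in>W. T w k * (\<Sum>j\<in>W. cf l k j * \<psi> (base j))) =
     (\<Sum>k\<in>W. \<Sum>j\<in>W. T w k * poly (adj k j) l / poly d l * \<psi> (base j))"
    by (simp add: sum_distrib_left mult.assoc)
  also have "\<dots> = (\<Sum>j\<in>W. \<Sum>k\<in>W. T w k * poly (adj k j) l / poly d l * \<psi> (base j))"
    by (rule sum.swap)
  also have "\<dots> = (\<Sum>j\<in>W. (\<Sum>k\<in>W. T w k * poly (adj k j) l) / poly d l * \<psi> (base j))"
    by (simp add: sum_distrib_right sum_divide_distrib)
  also have "l * (\<Sum>j\<in>W. cf l w j * \<psi> (base j)) - \<dots> =
     (\<Sum>j\<in>W. (l * poly (adj w j) l - (\<Sum>k\<in>W. T w k * poly (adj k j) l)) / poly d l * \<psi> (base j))"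
    by (simp add: sum_distrib_left sum_subtractf[symmetric] diff_divide_distrib algebra_simps)
  also have "\<dots> = (\<Sum>j\<in>W. if w = j then \<psi> (base j) else 0)"
    using l w by (intro sum.cong refl) (simp add: adj_right)
  finally show ?thesis using w finite_W by simp
qed

lemma K_left_inverse:
  assumes l: "poly d l \<noteq> 0" and v: "cyl v"
  shows "K (cf l) (\<lambda>p. l * v p - L v p) = v"
proof (rule cyl_eqI[OF K_cyl v])
  fix w assume w: "w \<in> W"
  have "K (cf l) (\<lambda>p. l * v p - L v p) (base w) =
     (\<Sum>j\<in>W. cf l w j * (l * v (base j) - (\<Sum>k\<in>W. T j k * v (base k))))"
    unfolding L_cyl_base[OF v, symmetric] using w by (simp add: K_base)
  also have "\<dots> = (\<Sum>j\<in>W. l * cf l w j * v (base j)) - (\<Sum>j\<in>W. \<Sum>k\<in>W. poly (adj w j) l * T j k / poly d l * v (base k))"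
    by (simp add: sum_distrib_left sum_subtractf algebra_simps)
  also have "(\<Sum>j\<in>W. \<Sum>k\<in>W. poly (adj w j) l * T j k / poly d l * v (base k)) =
     (\<Sum>k\<in>W. \<Sum>j\<in>W. poly (adj w j) l * T j k / poly d l * v (base k))"
    by (rule sum.swap)
  also have "\<dots> = (\<Sum>k\<in>W. (\<Sum>j\<in>W. poly (adj w j) l * T j k) / poly d l * v (base k))"
    by (simp add: sum_distrib_right sum_divide_distrib)
  also have "(\<Sum>j\<in>W. l * cf l w j * v (base j)) - \<dots> =
     (\<Sum>k\<in>W. (l * poly (adj w k) l - (\<Sum>j\<in>W. poly (adj w j) l * T j k)) / poly d l * v (base k))"
    by (simp add: sum_subtractf[symmetric] diff_divide_distrib algebra_simps)
  also have "\<dots> = (\<Sum>k\<in>W. if w = k then v (base k) else 0)"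
    using l w by (intro sum.cong refl) (simp add: adj_left)
  finally show "K (cf l) (\<lambda>p. l * v p - L v p) (base w) = v (base w)" using w finite_W by simp
qed

text \<open>The Neumann part \<open>U\<close> solves the equation modulo cylinder functions. What
  \<open>M\<close> discards, \<open>Q (L U)\<close>, is handed to the matrix inverse together with
  \<open>Q \<phi>\<close>, and the two contributions add up to \<open>\<phi>\<close>.\<close>

lemma Res_right_inverse:
  assumes l: "norm l > \<kappa>" "poly d l \<noteq> 0" and \<phi>: "\<phi> \<in> V"
  shows "l * Res l \<phi> p - L (Res l \<phi>) p = \<phi> p"
proof (cases "p \<in> P")
  case True
  define U where "U = S l (dev \<phi>)"
  define v where "v = K (cf l) (\<lambda>p. \<phi> p + L U p)"
  have v: "cyl v" unfolding v_def by (rule K_cyl)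
  have R: "Res l \<phi> = (\<lambda>p. 1 * U p + 1 * v p)" unfolding block_op_def[abs_def] U_def v_def by simp
  have "l * v (bp p) - L v (bp p) = \<phi> (bp p) + L U (bp p)"
    unfolding v_def by (rule K_right_inverse[OF l(2) W_I[OF True]])
  then have "l * v p - L v p = \<phi> (bp p) + L U (bp p)"
    using cylD(2)[OF v True] cylD(2)[OF cyl_L[OF v] True] by simp
  moreover have "l * U p - (L U p - L U (bp p)) = \<phi> p - \<phi> (bp p)"
    using S_equation[OF Z_dev[OF \<phi>] l(1), of p] True unfolding U_def M_def dev_def Q_def by simp
  ultimately show ?thesis unfolding R L_linear by (simp add: algebra_simps)
next
  case False
  then show ?thesis using V_D(1)[OF \<phi>] ZD(1)[OF S_Z[OF Z_dev[OF \<phi>] l(1)]]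
    by (simp add: L_eq block_op_def K_def)
qed

text \<open>The deviation of an eigenfunction is an eigenfunction of \<open>M\<close>; since
  \<open>M ^^ m\<close> is bounded by \<open>\<kappa> ^ m\<close> and
  \<open>norm l > \<kappa>\<close>, it must vanish. What remains is a cylinder function, which the
  inverse matrix sends to zero.\<close>

lemma Res_injective:
  assumes l: "norm l > \<kappa>" "poly d l \<noteq> 0" and \<phi>: "\<phi> \<in> V" and eq: "\<And>p. l * \<phi> p = L \<phi> p"
  shows "\<phi> = (\<lambda>_. 0)"
proof -
  have l0: "norm l > 0" using l \<kappa>_pos by linarith
  let ?w = "dev \<phi>" and ?v = "Q \<phi>"
  have v: "cyl ?v" by (rule cylI) (auto simp: Q_def bp_bp)
  have \<phi>_eq: "\<phi> = (\<lambda>p. 1 * ?v p + 1 * ?w p)" by (simp add: dev_def)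
  \<comment> \<open>The cylinder part does not contribute, because \<open>L\<close> keeps it a
    cylinder function, which the projection in \<open>M\<close> removes.\<close>
  have "M \<phi> = M ?w"
  proof
    fix p
    have "M \<phi> p = M ?v p + M ?w p" by (subst \<phi>_eq, subst M_linear) simp
    moreover have "M ?v p = 0" using cyl_dev[OF cyl_L[OF v]] unfolding M_def dev_def by (rule fun_cong)
    ultimately show "M \<phi> p = M ?w p" by simp
  qed
  moreover have "M \<phi> = (\<lambda>p. l * ?w p)"
    unfolding M_def[abs_def] Q_def dev_def using eq by (auto simp: algebra_simps)
  ultimately have Mw: "M ?w = (\<lambda>p. l * ?w p)" by simp
  have iter: "(M ^^ m) ?w = (\<lambda>p. l ^ m * ?w p)" for m
  proof (induction m)
    case (Suc m)
    have "M (\<lambda>p. l ^ m * ?w p + 0 * ?w p) = (\<lambda>p. l ^ m * M ?w p + 0 * M ?w p)" by (rule M_linear)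
    then show ?case using Suc Mw by (simp add: mult_ac)
  qed simp
  have w0: "?w p = 0" if p: "p \<in> P" for p
  proof -
    have "norm (?w p) \<le> (\<kappa> / norm l) ^ m * N \<phi>" for m
    proof -
      have "norm l ^ m * norm (?w p) \<le> \<kappa> ^ m * N \<phi>"
        using Z_bound[OF Z_M_iterate[OF Z_dev[OF \<phi>]] p, of m] unfolding iter by (simp add: norm_mult norm_power)
      then show ?thesis using l0 by (simp add: power_divide field_simps)
    qed
    moreover have "(\<lambda>m. (\<kappa> / norm l) ^ m * N \<phi>) \<longlonglongrightarrow> 0 * N \<phi>"
      using l l0 \<kappa>_pos by (intro tendsto_mult tendsto_const LIMSEQ_power_zero) simp
    ultimately have "norm (?w p) \<le> 0 * N \<phi>" by (intro LIMSEQ_le_const) auto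
    then show ?thesis by simp
  qed
  have "\<phi> p = ?v p" for p
    using w0[of p] V_D(1)[OF \<phi>] unfolding dev_def Q_def by (cases "p \<in> P") auto
  then have \<phi>v: "\<phi> = ?v" by blast
  then have "cyl \<phi>" using v by simp
  then have "K (cf l) (\<lambda>p. l * \<phi> p - L \<phi> p) = \<phi>" by (rule K_left_inverse[OF l(2)])
  then show ?thesis using eq by (auto simp: K_def fun_eq_iff split: if_splits)
qed

lemma Res_V:
  assumes l: "norm l > \<kappa>"
  shows "bounded_operator V N (Res l)"
proof -
  define B where "B = 1 + (\<Sum>w\<in>W. \<Sum>w'\<in>W. norm (cf l w w'))"
  define \<delta> where "\<delta> = norm l - \<kappa>"
  have B: "norm (1::complex) \<le> B" unfolding B_def by (simp add: sum_nonneg)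
  have cB: "norm (cf l w w') \<le> B" if "w \<in> W" "w' \<in> W" for w w'
    using member_le_double_sum[OF finite_W finite_W that, of "\<lambda>w w'. norm (cf l w w')"] by (simp add: B_def)
  have "\<delta> > 0" using l by (simp add: \<delta>_def)
  then obtain C where C: "\<And>l' \<mu> c \<phi>. norm l' \<ge> \<kappa> + \<delta> \<Longrightarrow> norm \<mu> \<le> B \<Longrightarrow>
      (\<And>w w'. w \<in> W \<Longrightarrow> w' \<in> W \<Longrightarrow> norm (c w w') \<le> B) \<Longrightarrow> \<phi> \<in> V \<Longrightarrow> lip_le (C * N \<phi>) (block_op l' \<mu> c \<phi>)"
    using block_op_bound[of \<delta> B] by metis
  show ?thesis
  proof (rule bounded_operatorI)
    fix \<phi> assume "\<phi> \<in> V"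
    then show "lip_le (C * N \<phi>) (Res l \<phi>)" using C B cB by (simp add: \<delta>_def)
  qed (rule block_op_linear[OF _ _ l])
qed

lemma bounded_operatorD:
  assumes "bounded_operator V N A"
  shows "\<phi> \<in> V \<Longrightarrow> A \<phi> \<in> V"
    "\<phi> \<in> V \<Longrightarrow> \<psi> \<in> V \<Longrightarrow> A (\<lambda>p. a * \<phi> p + b * \<psi> p) = (\<lambda>p. a * A \<phi> p + b * A \<psi> p)"
  using assms unfolding bounded_operator_def by blast+

lemma V_lincomb: "\<phi> \<in> V \<Longrightarrow> \<psi> \<in> V \<Longrightarrow> (\<lambda>p. a * \<phi> p + b * \<psi> p) \<in> V"
  by (rule lin_closedD[OF lin_closed_V])

lemma shifted_L_V: "\<phi> \<in> V \<Longrightarrow> (\<lambda>p. l * \<phi> p - L \<phi> p) \<in> V"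
  using V_lincomb[of \<phi> "L \<phi>" l "-1"] L_V by simp

text \<open>Only the right inverse is computed. The left one follows by applying it to
  \<open>l * \<phi> - L \<phi>\<close> and using injectivity.\<close>

lemma Res_inverse:
  assumes l: "norm l > \<kappa>" "poly d l \<noteq> 0"
  shows "is_inverse_operator V N (\<lambda>\<phi> p. l * \<phi> p - L \<phi> p) (Res l)"
  unfolding is_inverse_operator_def
proof (intro conjI ballI)
  show "bounded_operator V N (Res l)" by (rule Res_V[OF l(1)])
next
  fix \<phi> assume \<phi>: "\<phi> \<in> V"
  show "(\<lambda>p. l * Res l \<phi> p - L (Res l \<phi>) p) = \<phi>" using Res_right_inverse[OF l \<phi>] by blast
  define \<psi> where "\<psi> = (\<lambda>p. l * \<phi> p - L \<phi> p)"
  define \<xi> where "\<xi> = (\<lambda>p. 1 * Res l \<psi> p + (-1) * \<phi> p)"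
  have \<psi>: "\<psi> \<in> V" unfolding \<psi>_def by (rule shifted_L_V[OF \<phi>])
  have "\<xi> \<in> V" unfolding \<xi>_def by (intro V_lincomb bounded_operatorD(1)[OF Res_V[OF l(1)] \<psi>] \<phi>)
  moreover have "l * \<xi> p = L \<xi> p" for p
    using Res_right_inverse[OF l \<psi>, of p] unfolding \<xi>_def L_linear \<psi>_def by (simp add: algebra_simps)
  ultimately have "\<xi> = (\<lambda>_. 0)" by (rule Res_injective[OF l])
  then show "Res l (\<lambda>p. l * \<phi> p - L \<phi> p) = \<phi>" unfolding \<xi>_def \<psi>_def by (simp add: fun_eq_iff)
qed

text \<open>The inverse picked by \<open>SOME\<close> is unspecified off \<open>V\<close>, but on
  \<open>V\<close> a left inverse agrees with the right inverse \<open>Res l\<close>.\<close>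

lemma resolvent_eq:
  assumes l: "norm l > \<kappa>" "poly d l \<noteq> 0" and \<phi>: "\<phi> \<in> V"
  shows "resolvent V N L l \<phi> = Res l \<phi>"
proof -
  have "is_inverse_operator V N (\<lambda>\<phi> p. l * \<phi> p - L \<phi> p) (resolvent V N L l)"
    unfolding resolvent_def
    by (rule someI[of "is_inverse_operator V N (\<lambda>\<phi> p. l * \<phi> p - L \<phi> p)", OF Res_inverse[OF l]])
  then have "resolvent V N L l (\<lambda>p. l * \<psi> p - L \<psi> p) = \<psi>" if "\<psi> \<in> V" for \<psi>
    using that unfolding is_inverse_operator_def by blast
  from this[OF bounded_operatorD(1)[OF Res_V[OF l(1)] \<phi>]] show ?thesis
    using Res_right_inverse[OF l \<phi>] by simp
qed

lemma eigenfunction: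
  assumes "poly d l = 0"
  obtains \<phi> where "cyl \<phi>" "\<And>p. L \<phi> p = l * \<phi> p" "\<phi> \<noteq> (\<lambda>_. 0)"
proof -
  obtain v where v: "\<exists>i\<in>W. v i \<noteq> 0" "\<And>i. i \<in> W \<Longrightarrow> (\<Sum>k\<in>W. T i k * v k) = l * v i"
    using d_eigenvector[OF assms] by blast
  define \<phi> where "\<phi> = (\<lambda>p. if p \<in> P then v (stake n p) else 0)"
  have c: "cyl \<phi>" unfolding \<phi>_def by (rule cyl_of_base)
  have b: "\<phi> (base w) = v w" if "w \<in> W" for w using base[OF that] by (simp add: \<phi>_def)
  have "L \<phi> = (\<lambda>p. l * \<phi> p + 0 * \<phi> p)"
  proof (rule cyl_eqI[OF cyl_L[OF c] cyl_lincomb[OF c c]])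
    fix w assume w: "w \<in> W"
    have "L \<phi> (base w) = (\<Sum>w'\<in>W. T w w' * v w')" unfolding L_cyl_base[OF c] using b by simp
    then show "L \<phi> (base w) = l * \<phi> (base w) + 0 * \<phi> (base w)" using v(2)[OF w] b[OF w] by simp
  qed
  then show thesis using that[OF c] v(1) b by (metis add.right_neutral mult_zero_left)
qed

lemma d_root_spectrum:
  assumes "poly d l = 0"
  shows "l \<in> spectrum V N L"
proof (rule ccontr)
  assume "l \<notin> spectrum V N L"
  then obtain B where B: "is_inverse_operator V N (\<lambda>\<phi> p. l * \<phi> p - L \<phi> p) B"
    unfolding spectrum_def by blast
  obtain \<phi> where \<phi>: "cyl \<phi>" "\<And>p. L \<phi> p = l * \<phi> p" "\<phi> \<noteq> (\<lambda>_. 0)" using eigenfunction[OF assms] by blast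
  have z: "cyl (\<lambda>_. 0)" by (rule cylI) auto
  have inv: "B (\<lambda>p. l * \<psi> p - L \<psi> p) = \<psi>" if "\<psi> \<in> V" for \<psi>
    using B that unfolding is_inverse_operator_def by blast
  have "(\<lambda>p. l * \<phi> p - L \<phi> p) = (\<lambda>p. l * 0 - L (\<lambda>_. 0) p)"
    using \<phi>(2) by (auto simp: L_eq)
  with inv[OF cyl_V[OF \<phi>(1)]] inv[OF cyl_V[OF z]] have "\<phi> = (\<lambda>_. 0)" by simp
  then show False using \<phi>(3) by simp
qed

text \<open>An eigenfunction attains its maximal modulus at a base point, and \<open>L\<close>
  enlarges sup norms by at most \<open>q\<close>. Hence the matrix resolvent has no pole where
  \<open>norm l > q\<close>.\<close>

lemma d_root_norm:
  assumes "poly d l = 0"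
  shows "norm l \<le> q"
proof -
  obtain \<phi> where \<phi>: "cyl \<phi>" "\<And>p. L \<phi> p = l * \<phi> p" "\<phi> \<noteq> (\<lambda>_. 0)" using eigenfunction[OF assms] by blast
  have Wne: "W \<noteq> {}" using P_ne unfolding W_def by simp
  define m where "m = Max ((\<lambda>w. norm (\<phi> (base w))) ` W)"
  have le: "norm (\<phi> p) \<le> m" if "p \<in> P" for p
    unfolding m_def using cylD(2)[OF \<phi>(1) that] that finite_W by (auto intro!: Max_ge)
  have "m \<in> (\<lambda>w. norm (\<phi> (base w))) ` W" unfolding m_def using finite_W Wne by (intro Max_in) auto
  then obtain w where w: "w \<in> W" "m = norm (\<phi> (base w))" by blast
  have "\<exists>p. \<phi> p \<noteq> 0" using \<phi>(3) by auto
  then obtain p where "p \<in> P" "\<phi> p \<noteq> 0" using cylD(1)[OF \<phi>(1)] by blast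
  then have m: "m > 0" using le[of p] by (meson less_le_trans zero_less_norm_iff)
  have "norm l * m = norm (L \<phi> (base w))" using \<phi>(2) w(2) by (simp add: norm_mult)
  also have "\<dots> \<le> q * m" using le base(1)[OF w(1)] by (rule L_sup)
  finally show ?thesis using m by simp
qed

end

subsection \<open>Spectral projectors and traces\<close>

lemma poly_analytic: "poly (c :: complex poly) analytic_on A"
proof -
  have "poly c holomorphic_on UNIV"
    unfolding holomorphic_on_def using poly_DERIV field_differentiable_def by blast
  then show ?thesis using analytic_on_holomorphic by blast
qed

context sft_resolvent
begin

lemma open_outside_disc: "open {l::complex. norm l > \<kappa>}"
  by (intro open_Collect_less continuous_intros)

lemma S_analytic:
  assumes "\<phi> \<in> V" "norm l0 > \<kappa>"
  shows "(\<lambda>l. S l (dev \<phi>) p) analytic_on {l0}"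
  unfolding analytic_at using S_holomorphic[OF Z_dev[OF assms(1)]] open_outside_disc assms(2) by blast

lemma L_S_analytic:
  assumes "\<phi> \<in> V" "norm l0 > \<kappa>"
  shows "(\<lambda>l. L (S l (dev \<phi>)) p) analytic_on {l0}"
proof (cases "p \<in> P")
  case True
  have "(\<lambda>l. \<Sum>e\<in>pre p. S l (dev \<phi>) (e ## p)) analytic_on {l0}"
    by (intro analytic_intros S_analytic[OF assms])
  then show ?thesis using True by (simp add: L_eq)
qed (simp add: L_eq)

lemma cf_meromorphic: "(\<lambda>l. cf l w w') meromorphic_on {l0}"
  by (intro meromorphic_intros analytic_on_imp_meromorphic_on poly_analytic)

lemma Res_meromorphic:
  assumes "\<phi> \<in> V" "norm l0 > \<kappa>"
  shows "(\<lambda>l. Res l \<phi> p) meromorphic_on {l0}"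
proof -
  have "(\<lambda>l. K (cf l) (\<lambda>p. \<phi> p + L (S l (dev \<phi>)) p) p) meromorphic_on {l0}"
  proof (cases "p \<in> P")
    case True
    show ?thesis unfolding K_def if_P[OF True]
      by (intro meromorphic_on_sum meromorphic_on_mult cf_meromorphic meromorphic_on_add meromorphic_on_const
          analytic_on_imp_meromorphic_on[OF L_S_analytic[OF assms]])
  qed (simp add: K_def meromorphic_on_const)
  then show ?thesis unfolding block_op_def
    by (intro meromorphic_intros analytic_on_imp_meromorphic_on[OF S_analytic[OF assms]])
qed

lemma eventually_resolvent_set:
  assumes "norm l0 > \<kappa>"
  shows "\<forall>\<^sub>F l in at l0. norm l > \<kappa> \<and> poly d l \<noteq> 0"
proof -
  have "\<forall>\<^sub>F l in at l0. norm l > \<kappa>"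
    using eventually_at_in_open'[OF open_outside_disc, of l0] assms by simp
  moreover have "\<forall>\<^sub>F l in at l0. l \<notin> {l. poly d l = 0}"
    using islimpt_finite[OF poly_roots_finite[OF d_nz], of l0] unfolding islimpt_iff_eventually by blast
  ultimately show ?thesis by eventually_elim simp
qed

lemma riesz_projector_eq:
  assumes "\<phi> \<in> V" "norm l0 > \<kappa>"
  shows "riesz_projector V N L l0 \<phi> p = residue (\<lambda>l. Res l \<phi> p) l0"
  unfolding riesz_projector_def
  by (rule residue_cong[OF eventually_mono[OF eventually_resolvent_set[OF assms(2)]] refl])
     (simp add: resolvent_eq[OF _ _ assms(1)])

text \<open>By functional calculus this should be the \<open>k\<close>-th power of
  \<open>L - l0\<close> applied to the Riesz projection, which \<open>riesz_power\<close> confirms;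
  residues of scalar functions are easier to handle than powers.\<close>

definition riesz_moment :: "complex \<Rightarrow> nat \<Rightarrow> ('v edge stream \<Rightarrow> complex) \<Rightarrow> 'v edge stream \<Rightarrow> complex" where
  "riesz_moment l0 k \<phi> p = residue (\<lambda>l. (l - l0) ^ k * Res l \<phi> p) l0"

lemma riesz_moment_integrand_meromorphic:
  assumes "\<phi> \<in> V" "norm l0 > \<kappa>"
  shows "(\<lambda>l. (l - l0) ^ k * Res l \<phi> p) meromorphic_on {l0}"
  by (intro meromorphic_intros Res_meromorphic[OF assms])

text \<open>\<open>L\<close> is pointwise a finite sum and so passes through the residue. Replacing
  \<open>L (Res l \<phi>)\<close> by \<open>l * Res l \<phi> - \<phi>\<close> raises the power of
  \<open>l - l0\<close> and leaves a term polynomial in \<open>l\<close>, without residue.\<close>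

lemma riesz_moment_Suc:
  assumes \<phi>: "\<phi> \<in> V" and l0: "norm l0 > \<kappa>"
  shows "L (riesz_moment l0 k \<phi>) p - l0 * riesz_moment l0 k \<phi> p = riesz_moment l0 (Suc k) \<phi> p"
proof -
  let ?h = "\<lambda>p l. (l - l0) ^ k * Res l \<phi> p"
  note mer = riesz_moment_integrand_meromorphic[OF \<phi> l0]
  have Lr: "L (riesz_moment l0 k \<phi>) p = residue (\<lambda>l. L (\<lambda>p. ?h p l) p) l0"
  proof (cases "p \<in> P")
    case True
    then show ?thesis using residue_sum_meromorphic[of "pre p" "\<lambda>e. ?h (e ## p)" l0] mer
      by (simp add: L_eq riesz_moment_def)
  qed (simp add: L_eq residue_const)
  have Lm: "(\<lambda>l. L (\<lambda>p. ?h p l) p) meromorphic_on {l0}"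
    unfolding L_eq using mer by (cases "p \<in> P") (auto intro!: meromorphic_on_sum)
  have "L (riesz_moment l0 k \<phi>) p - l0 * riesz_moment l0 k \<phi> p = residue (\<lambda>l. L (\<lambda>p. ?h p l) p + (- l0) * ?h p l) l0"
    unfolding Lr riesz_moment_def
    by (subst residue_add_meromorphic[OF Lm], intro meromorphic_intros mer, subst residue_cmult_meromorphic[OF mer]) simp
  also have "\<dots> = residue (\<lambda>l. (l - l0) ^ Suc k * Res l \<phi> p + (- \<phi> p) * (l - l0) ^ k) l0"
  proof (rule residue_cong[OF eventually_mono[OF eventually_resolvent_set[OF l0]] refl])
    fix l assume l: "norm l > \<kappa> \<and> poly d l \<noteq> 0"
    have LR: "L (Res l \<phi>) p = l * Res l \<phi> p - \<phi> p"
      using Res_right_inverse[OF conjunct1[OF l] conjunct2[OF l] \<phi>, of p] by (simp add: algebra_simps)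
    show "L (\<lambda>p. ?h p l) p + (- l0) * ?h p l = (l - l0) ^ Suc k * Res l \<phi> p + (- \<phi> p) * (l - l0) ^ k"
      unfolding L_cmult LR by (simp add: algebra_simps)
  qed
  also have "\<dots> = riesz_moment l0 (Suc k) \<phi> p + residue (\<lambda>l. (- \<phi> p) * (l - l0) ^ k) l0"
    unfolding riesz_moment_def by (intro residue_add_meromorphic mer) (intro meromorphic_intros)
  also have "residue (\<lambda>l. (- \<phi> p) * (l - l0) ^ k) l0 = 0"
    by (intro residue_analytic analytic_intros)
  finally show ?thesis by simp
qed

lemma riesz_power:
  assumes "\<phi> \<in> V" "norm l0 > \<kappa>"
  shows "((\<lambda>\<psi> p. L \<psi> p - l0 * \<psi> p) ^^ k) (riesz_projector V N L l0 \<phi>) = riesz_moment l0 k \<phi>"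
proof (induction k)
  case 0
  then show ?case using riesz_projector_eq[OF assms] by (simp add: riesz_moment_def fun_eq_iff)
next
  case (Suc k)
  then show ?case using riesz_moment_Suc[OF assms] by simp
qed

text \<open>The values of \<open>Res l \<phi>\<close> at \<open>p\<close> and at its base point
  differ by the Neumann part alone, which is holomorphic for \<open>norm l > \<kappa>\<close> and
  has no residue.\<close>

lemma riesz_moment_cyl:
  assumes \<phi>: "\<phi> \<in> V" and l0: "norm l0 > \<kappa>"
  shows "cyl (riesz_moment l0 k \<phi>)"
proof (rule cylI)
  fix p assume p: "p \<notin> P"
  have "riesz_moment l0 k \<phi> p = residue (\<lambda>_. 0) l0" unfolding riesz_moment_def
  proof (rule residue_cong[OF eventually_mono[OF eventually_resolvent_set[OF l0]] refl])
    fix l assume "norm l > \<kappa> \<and> poly d l \<noteq> 0"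
    then have "Res l \<phi> p = 0" using V_D(1)[OF bounded_operatorD(1)[OF Res_V \<phi>] p] by blast
    then show "(l - l0) ^ k * Res l \<phi> p = 0" by simp
  qed
  then show "riesz_moment l0 k \<phi> p = 0" by (simp add: residue_const)
next
  fix p assume p: "p \<in> P"
  have "riesz_moment l0 k \<phi> p = residue (\<lambda>l. (l - l0) ^ k * Res l \<phi> (bp p) + (l - l0) ^ k * S l (dev \<phi>) p) l0"
    unfolding riesz_moment_def
  proof (rule residue_cong[OF eventually_mono[OF eventually_resolvent_set[OF l0]] refl])
    fix l assume l: "norm l > \<kappa> \<and> poly d l \<noteq> 0"
    have "S l (dev \<phi>) (bp p) = 0" using ZD(2)[OF S_Z[OF Z_dev[OF \<phi>]] W_I[OF p]] l by blast
    then have "Res l \<phi> p = Res l \<phi> (bp p) + S l (dev \<phi>) p"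
      using cylD(2)[OF K_cyl p] unfolding block_op_def by simp
    then show "(l - l0) ^ k * Res l \<phi> p = (l - l0) ^ k * Res l \<phi> (bp p) + (l - l0) ^ k * S l (dev \<phi>) p"
      by (simp add: algebra_simps)
  qed
  also have "\<dots> = riesz_moment l0 k \<phi> (bp p) + residue (\<lambda>l. (l - l0) ^ k * S l (dev \<phi>) p) l0"
    unfolding riesz_moment_def
    by (intro residue_add_meromorphic riesz_moment_integrand_meromorphic[OF \<phi> l0] analytic_on_imp_meromorphic_on
        analytic_intros S_analytic[OF \<phi> l0])
  also have "residue (\<lambda>l. (l - l0) ^ k * S l (dev \<phi>) p) l0 = 0"
    by (intro residue_analytic analytic_intros S_analytic[OF \<phi> l0])
  finally show "riesz_moment l0 k \<phi> p = riesz_moment l0 k \<phi> (bp p)" by simp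
qed

lemma riesz_moment_linear:
  assumes \<phi>: "\<phi> \<in> V" "\<psi> \<in> V" and l0: "norm l0 > \<kappa>"
  shows "riesz_moment l0 k (\<lambda>p. a * \<phi> p + b * \<psi> p) = (\<lambda>p. a * riesz_moment l0 k \<phi> p + b * riesz_moment l0 k \<psi> p)"
proof
  fix p
  note mer = riesz_moment_integrand_meromorphic[OF \<phi>(1) l0] riesz_moment_integrand_meromorphic[OF \<phi>(2) l0]
  have "riesz_moment l0 k (\<lambda>p. a * \<phi> p + b * \<psi> p) p =
     residue (\<lambda>l. a * ((l - l0) ^ k * Res l \<phi> p) + b * ((l - l0) ^ k * Res l \<psi> p)) l0"
    unfolding riesz_moment_def
  proof (rule residue_cong[OF eventually_mono[OF eventually_resolvent_set[OF l0]] refl])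
    fix l assume "norm l > \<kappa> \<and> poly d l \<noteq> 0"
    then have "Res l (\<lambda>p. a * \<phi> p + b * \<psi> p) = (\<lambda>p. a * Res l \<phi> p + b * Res l \<psi> p)"
      using block_op_linear[OF \<phi>] by blast
    then show "(l - l0) ^ k * Res l (\<lambda>p. a * \<phi> p + b * \<psi> p) p =
      a * ((l - l0) ^ k * Res l \<phi> p) + b * ((l - l0) ^ k * Res l \<psi> p)" by (simp add: algebra_simps)
  qed
  also have "\<dots> = a * riesz_moment l0 k \<phi> p + b * riesz_moment l0 k \<psi> p"
    unfolding riesz_moment_def
    by (subst residue_add_meromorphic; (intro meromorphic_intros mer)?) (simp add: residue_cmult_meromorphic mer)
  finally show "riesz_moment l0 k (\<lambda>p. a * \<phi> p + b * \<psi> p) p = a * riesz_moment l0 k \<phi> p + b * riesz_moment l0 k \<psi> p" .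
qed

text \<open>In contrast to \<open>cyl\<close>, nothing is demanded off \<open>P\<close>, where the
  function of a reduction is arbitrary.\<close>

definition depends :: "('v edge stream \<Rightarrow> complex) \<Rightarrow> bool" where
  "depends g \<longleftrightarrow> (\<forall>p\<in>P. \<forall>p'\<in>P. stake n p = stake n p' \<longrightarrow> g p = g p')"

lemma mult_V:
  assumes g: "depends g" and \<phi>: "\<phi> \<in> V"
  shows "(\<lambda>p. g p * \<phi> p) \<in> V"
proof -
  define A where "A = (\<Sum>w\<in>W. norm (g (base w)))"
  have gb: "g p = g (bp p)" if "p \<in> P" for p
    using g that bp_bp(2)[OF that] base(2)[OF W_I[OF that]] unfolding depends_def by metis
  have A: "norm (g p) \<le> A" if "p \<in> P" for p
  proof -
    have "norm (g (bp p)) \<le> A" unfolding A_def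
      using that finite_W by (intro member_le_sum[where f = "\<lambda>w. norm (g (base w))"]) auto
    then show ?thesis using gb[OF that] by simp
  qed
  have A0: "A \<ge> 0" unfolding A_def by (simp add: sum_nonneg)
  show ?thesis
  proof (rule lip_le_imp(1)[OF lip_leI])
    fix p assume "p \<in> P"
    then show "norm (g p * \<phi> p) \<le> A * N \<phi>"
      unfolding norm_mult by (intro mult_mono A V_D[OF \<phi>] A0 norm_ge_zero)
  next
    show "osc (\<lambda>p. g p * \<phi> p) (A * N \<phi>)" unfolding osc_def
    proof (intro ballI impI)
      fix p p' assume p: "p \<in> P" "p' \<in> P" "stake n p = stake n p'"
      have "g p' = g p" using g p unfolding depends_def by metis
      then have "norm (g p * \<phi> p - g p' * \<phi> p') = norm (g p) * norm (\<phi> p - \<phi> p')"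
        by (simp add: norm_mult[symmetric] algebra_simps)
      also have "\<dots> \<le> A * (N \<phi> * dst p p')"
        by (intro mult_mono A p oscD[OF lip_le_osc[OF lip_le_norm[OF \<phi>]]] A0 norm_ge_zero)
      finally show "norm (g p * \<phi> p - g p' * \<phi> p') \<le> A * N \<phi> * dst p p'" by simp
    qed
  qed (use V_D(1)[OF \<phi>] A0 N_nonneg[OF \<phi>] in auto)
qed

lemma cyl_mult_ind:
  assumes "depends g"
  shows "cyl (\<lambda>p. g p * ind w p)"
proof (rule cylI)
  fix p assume p: "p \<in> P"
  have "g p = g (bp p)"
    using assms p bp_bp(2)[OF p] base(2)[OF W_I[OF p]] unfolding depends_def by metis
  then show "g p * ind w p = g (bp p) * ind w (bp p)" using cylD(2)[OF cyl_ind p] by simp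
qed (simp add: ind_def)

text \<open>The deviation of a cylinder function is zero, so the Neumann part disappears and only
  the matrix acts.\<close>

lemma Res_cyl:
  assumes "cyl \<psi>"
  shows "Res l \<psi> = K (cf l) \<psi>"
proof -
  have zero: "(M ^^ m) (\<lambda>_. 0) p = 0" for m p
    using M_iterate_linear[of m 0 "\<lambda>_. 0" 0 "\<lambda>_. 0"] by (simp add: fun_eq_iff)
  have "S l (dev \<psi>) = (\<lambda>_. 0)"
    unfolding cyl_dev[OF assms] S_def zero by simp
  moreover have "L (\<lambda>_. 0) p = 0" for p by (cases "p \<in> P") (simp_all add: L_eq)
  ultimately show ?thesis unfolding block_op_def[abs_def] by simp
qed

definition F :: "('v edge stream \<Rightarrow> complex) \<Rightarrow> complex \<Rightarrow> complex" where
  "F g l = (\<Sum>w\<in>W. cf l w w * g (base w))"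

lemma F_eq:
  assumes "depends g"
  shows "F g l = (\<Sum>w\<in>W. Res l (\<lambda>p. g p * ind w p) (base w))"
  unfolding F_def
proof (intro sum.cong refl)
  fix w assume w: "w \<in> W"
  have "Res l (\<lambda>p. g p * ind w p) (base w) = (\<Sum>w'\<in>W. cf l w w' * (g (base w') * ind w (base w')))"
    unfolding Res_cyl[OF cyl_mult_ind[OF assms]] by (rule K_base[OF w])
  also have "\<dots> = (\<Sum>w'\<in>W. if w' = w then cf l w w * g (base w) else 0)"
    by (intro sum.cong) (auto simp: ind_def base)
  finally show "cf l w w * g (base w) = Res l (\<lambda>p. g p * ind w p) (base w)" using w finite_W by simp
qed

lemma F_meromorphic: "F g meromorphic_on A"
  unfolding F_def[abs_def] meromorphic_on_meromorphic_at[of _ A]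
  by (intro ballI meromorphic_on_sum meromorphic_on_mult cf_meromorphic meromorphic_on_const)

lemma F_analytic: "poly d l \<noteq> 0 \<Longrightarrow> F g analytic_on {l}"
  unfolding F_def[abs_def] by (auto intro!: analytic_intros poly_analytic)

theorem trace_formula:
  fixes k :: nat
  assumes g: "depends g" and l0: "norm l0 > \<kappa>"
  defines "A \<equiv> \<lambda>\<phi>. ((\<lambda>\<psi> p. L \<psi> p - l0 * \<psi> p) ^^ k) (riesz_projector V N L l0 (\<lambda>p. g p * \<phi> p))"
  shows "finite_rank V A" "finite_rank_trace V A = residue (\<lambda>l. (l - l0) ^ k * F g l) l0"
proof -
  have A: "A \<phi> = riesz_moment l0 k (\<lambda>p. g p * \<phi> p)" if "\<phi> \<in> V" for \<phi>
    unfolding A_def by (rule riesz_power[OF mult_V[OF g that] l0])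
  have cyl: "cyl (A \<phi>)" if "\<phi> \<in> V" for \<phi>
    unfolding A[OF that] by (rule riesz_moment_cyl[OF mult_V[OF g that] l0])
  have lin: "A (\<lambda>p. a * \<phi> p + b * \<psi> p) = (\<lambda>p. a * A \<phi> p + b * A \<psi> p)" if V: "\<phi> \<in> V" "\<psi> \<in> V" for \<phi> \<psi> a b
  proof -
    have "A (\<lambda>p. a * \<phi> p + b * \<psi> p) = riesz_moment l0 k (\<lambda>p. g p * (a * \<phi> p + b * \<psi> p))"
      by (rule A[OF V_lincomb[OF V]])
    also have "(\<lambda>p. g p * (a * \<phi> p + b * \<psi> p)) = (\<lambda>p. a * (g p * \<phi> p) + b * (g p * \<psi> p))"
      by (simp add: algebra_simps)
    also have "riesz_moment l0 k \<dots> = (\<lambda>p. a * A \<phi> p + b * A \<psi> p)"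
      unfolding A[OF V(1)] A[OF V(2)] by (rule riesz_moment_linear[OF mult_V[OF g V(1)] mult_V[OF g V(2)] l0])
    finally show ?thesis .
  qed
  show "finite_rank V A" using cyl lin by (rule finite_rank_of_cyl_range)
  have "finite_rank_trace V A = (\<Sum>w\<in>W. A (ind w) (base w))"
    using cyl lin by (rule finite_rank_of_cyl_range)
  also have "\<dots> = (\<Sum>w\<in>W. residue (\<lambda>l. (l - l0) ^ k * Res l (\<lambda>p. g p * ind w p) (base w)) l0)"
    unfolding A[OF cyl_V[OF cyl_ind]] riesz_moment_def ..
  also have "\<dots> = residue (\<lambda>l. \<Sum>w\<in>W. (l - l0) ^ k * Res l (\<lambda>p. g p * ind w p) (base w)) l0"
    by (intro residue_sum_meromorphic[symmetric] riesz_moment_integrand_meromorphic cyl_V cyl_mult_ind g l0)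
  also have "(\<lambda>l. \<Sum>w\<in>W. (l - l0) ^ k * Res l (\<lambda>p. g p * ind w p) (base w)) = (\<lambda>l. (l - l0) ^ k * F g l)"
    unfolding F_eq[OF g] by (simp add: sum_distrib_left)
  finally show "finite_rank_trace V A = residue (\<lambda>l. (l - l0) ^ k * F g l) l0" .
qed

lemma L_iterate_linear: "(L ^^ m) (\<lambda>p. a * \<phi> p + b * \<psi> p) = (\<lambda>p. a * (L ^^ m) \<phi> p + b * (L ^^ m) \<psi> p)"
  by (induction m) (simp_all add: L_linear)

lemma L_iterate_sup:
  fixes A :: real
  assumes "\<And>p. p \<in> P \<Longrightarrow> norm (\<phi> p) \<le> A" "p \<in> P"
  shows "norm ((L ^^ m) \<phi> p) \<le> q ^ m * A"
  using assms(2)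
proof (induction m arbitrary: p)
  case (Suc m)
  have "norm (L ((L ^^ m) \<phi>) p) \<le> q * (q ^ m * A)" by (rule L_sup[OF Suc.IH Suc.prems])
  then show ?case by (simp add: mult.assoc)
qed (use assms in simp)

text \<open>With \<open>\<psi> = l * v - L v\<close> the partial sums telescope to
  \<open>l * v\<close> minus a remainder of order \<open>(q / norm l) ^ k\<close>. This links the
  trace of the resolvent to the traces of the powers of \<open>L\<close>.\<close>

lemma Res_Neumann:
  assumes l: "norm l > q" and \<psi>: "cyl \<psi>" and p: "p \<in> P"
  shows "(\<lambda>m. (L ^^ m) \<psi> p / l ^ m) sums (l * Res l \<psi> p)"
proof -
  have l0: "norm l > 0" "l \<noteq> 0" using l by (auto intro: le_less_trans[of 0 "real q"])
  have "\<kappa> \<le> q" using \<theta>_less by (simp add: mult_left_le)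
  then have lk: "norm l > \<kappa>" using l by linarith
  have dl: "poly d l \<noteq> 0" using d_root_norm[of l] l by linarith
  define v where "v = Res l \<psi>"
  have vV: "v \<in> V" unfolding v_def by (rule bounded_operatorD(1)[OF Res_V[OF lk] cyl_V[OF \<psi>]])
  have step: "l * (L ^^ m) v p = (L ^^ m) \<psi> p + (L ^^ Suc m) v p" for m
  proof -
    have "\<psi> = (\<lambda>p. l * v p + (-1) * L v p)"
      using Res_right_inverse[OF lk dl cyl_V[OF \<psi>]] unfolding v_def by (simp add: fun_eq_iff)
    then have "(L ^^ m) \<psi> = (\<lambda>p. l * (L ^^ m) v p + (-1) * (L ^^ m) (L v) p)"
      by (simp only: L_iterate_linear[of m l v "-1" "L v", symmetric])
    then show ?thesis by (simp add: funpow_swap1)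
  qed
  have partial: "(\<Sum>m<k. (L ^^ m) \<psi> p / l ^ m) = l * v p - l * ((L ^^ k) v p / l ^ k)" for k
  proof (induction k)
    case (Suc k)
    have "(L ^^ k) \<psi> p / l ^ k = (l * (L ^^ k) v p - (L ^^ Suc k) v p) / l ^ k"
      using step[of k] by simp
    also have "\<dots> = l * ((L ^^ k) v p / l ^ k) - l * ((L ^^ Suc k) v p / l ^ Suc k)"
      using l0 by (simp add: diff_divide_distrib)
    finally show ?case using Suc by simp
  qed simp
  have "(\<lambda>k. (L ^^ k) v p / l ^ k) \<longlonglongrightarrow> 0"
  proof (rule Lim_null_comparison)
    have "norm ((L ^^ k) v p / l ^ k) \<le> (q / norm l) ^ k * N v" for k
      using L_iterate_sup[OF V_D(2)[OF vV] p, of k] l0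
      by (simp add: norm_divide norm_power power_divide divide_right_mono)
    then show "\<forall>\<^sub>F k in sequentially. norm ((L ^^ k) v p / l ^ k) \<le> (q / norm l) ^ k * N v" by simp
    have "(\<lambda>k. (q / norm l) ^ k * N v) \<longlonglongrightarrow> 0 * N v"
      using l l0 by (intro tendsto_mult tendsto_const LIMSEQ_power_zero) simp
    then show "(\<lambda>k. (q / norm l) ^ k * N v) \<longlonglongrightarrow> 0" by simp
  qed
  then have "(\<lambda>k. l * v p - l * ((L ^^ k) v p / l ^ k)) \<longlonglongrightarrow> l * v p - l * 0"
    by (intro tendsto_intros)
  then show ?thesis unfolding sums_def partial v_def by simp
qed

definition tr :: "('v edge stream \<Rightarrow> complex) \<Rightarrow> nat \<Rightarrow> complex" where
  "tr g m = (\<Sum>w\<in>W. (L ^^ m) (\<lambda>p. g p * ind w p) (base w))"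

text \<open>The term for \<open>m = 0\<close> is split off because closed paths have positive
  length.\<close>

lemma F_sums:
  assumes "norm l > q" and g: "depends g"
  shows "(\<lambda>m. tr g (Suc m) / l ^ Suc m) sums (l * F g l - tr g 0)"
proof -
  have "(\<lambda>m. \<Sum>w\<in>W. (L ^^ m) (\<lambda>p. g p * ind w p) (base w) / l ^ m) sums
     (\<Sum>w\<in>W. l * Res l (\<lambda>p. g p * ind w p) (base w))"
    by (intro sums_sum Res_Neumann cyl_mult_ind g base assms)
  then have "(\<lambda>m. tr g m / l ^ m) sums (l * F g l)"
    unfolding F_eq[OF g] tr_def by (simp add: sum_divide_distrib sum_distrib_left)
  then show ?thesis using sums_Suc_iff[of "\<lambda>m. tr g m / l ^ m" "l * F g l - tr g 0"] by simp
qed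

end

subsection \<open>The spectral parameter\<close>

lemma eigval_exp: "q > 0 \<Longrightarrow> eigval q s = exp (- (1/2 + \<i> * s) * ln (of_nat q))"
  by (simp add: eigval_def powr_def)

lemma eigval_nz: "q > 0 \<Longrightarrow> eigval q s \<noteq> 0"
  by (simp add: eigval_exp)

lemma eigval_deriv:
  assumes "q > 0"
  shows "(eigval q has_field_derivative (- \<i> * ln (real q) * eigval q s)) (at s)"
proof -
  have "((\<lambda>s. exp (- (1/2 + \<i> * s) * ln (of_nat q))) has_field_derivative
     (- \<i> * ln (real q) * eigval q s)) (at s)"
    using assms by (auto intro!: derivative_eq_intros simp: eigval_exp)
  moreover have "eigval q = (\<lambda>s. exp (- (1/2 + \<i> * s) * ln (of_nat q)))"
    using eigval_exp[OF assms] by blast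
  ultimately show ?thesis by simp
qed

lemma eigval_holomorphic: "q > 0 \<Longrightarrow> eigval q holomorphic_on A"
  unfolding holomorphic_on_def using eigval_deriv field_differentiable_at_within field_differentiable_def by blast

lemma eigval_analytic: "q > 0 \<Longrightarrow> eigval q analytic_on A"
  using eigval_holomorphic[of q UNIV] analytic_on_holomorphic by blast

lemma norm_eigval: "q > 0 \<Longrightarrow> norm (eigval q s) = real q powr (Im s - 1/2)"
  by (simp add: eigval_def norm_powr_real_powr)

lemma powr_eq_inverse_eigval: "of_nat q powr (1/2 + \<i> * s) = 1 / eigval q s"
  unfolding eigval_def by (simp only: powr_minus inverse_eq_divide div_by_1 divide_divide_eq_right mult_1)

text \<open>The norm of \<open>eigval q s\<close> is \<open>q\<close> to the power
  \<open>Im s - 1/2\<close>. For \<open>t = 1\<close> this translates \<open>norm l > q\<close> into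
  the half-plane of absolute convergence, for \<open>t = \<theta>\<close> it describes the
  half-plane of continuation.\<close>

lemma norm_eigval_gt:
  assumes "q > 1" "0 < t"
  shows "norm (eigval q s) > real q * t \<longleftrightarrow> Im s > 3/2 + ln t / ln (real q)"
proof -
  have q: "real q > 1" "ln (real q) > 0" using assms by auto
  have "real q powr (ln t / ln (real q)) = t" using assms q by (simp add: powr_def)
  then have "real q powr (1 + ln t / ln (real q)) = real q * t" using q by (simp add: powr_add)
  then have "norm (eigval q s) > real q * t \<longleftrightarrow> real q powr (Im s - 1/2) > real q powr (1 + ln t / ln (real q))"
    using assms by (simp add: norm_eigval)
  also have "\<dots> \<longleftrightarrow> Im s - 1/2 > 1 + ln t / ln (real q)" using q by (intro powr_less_cancel_iff) simp
  finally show ?thesis by (simp only: less_diff_eq) (simp add: algebra_simps)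
qed

lemma half_plane_iff: "q > 1 \<Longrightarrow> 0 < \<theta> \<Longrightarrow> s \<in> half_plane q \<theta> \<longleftrightarrow> norm (eigval q s) > real q * \<theta>"
  unfolding half_plane_def by (simp add: norm_eigval_gt)

lemma dquot_iterate_diff:
  assumes "f holomorphic_on ball a r" "g holomorphic_on ball a r" "z \<in> ball a r"
  shows "(dquot a ^^ i) (\<lambda>w. f w - g w) z = (dquot a ^^ i) f z - (dquot a ^^ i) g z"
  using assms(3)
proof (induction i arbitrary: z)
  case (Suc i)
  have hol: "(dquot a ^^ j) h holomorphic_on ball a r" if "h holomorphic_on ball a r" for j h
    by (induction j) (use that dquot_holomorphic in auto)
  have "dquot a ((dquot a ^^ i) (\<lambda>w. f w - g w)) z =
      dquot a (\<lambda>z. 1 * (dquot a ^^ i) f z + (-1) * (dquot a ^^ i) g z) z"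
    by (rule dquot_cong[OF _ Suc.prems]) (simp add: Suc.IH)
  also have "\<dots> = 1 * dquot a ((dquot a ^^ i) f) z + (-1) * dquot a ((dquot a ^^ i) g) z"
    by (rule dquot_linear[OF hol[OF assms(1)] hol[OF assms(2)] Suc.prems])
  finally show ?case by simp
qed simp

context sft_resolvent
begin

section \<open>Meromorphy of the resolvent in \<open>s\<close>\<close>

lemma block_op_scale: "block_op l (a * \<mu>) (\<lambda>w w'. a * c w w') \<phi> p = a * block_op l \<mu> c \<phi> p"
  unfolding block_op_def K_def by (simp add: algebra_simps sum_distrib_left)

lemma block_op_cong: "(\<And>w w'. w \<in> W \<Longrightarrow> w' \<in> W \<Longrightarrow> c w w' = c' w w') \<Longrightarrow> block_op l \<mu> c \<phi> p = block_op l \<mu> c' \<phi> p"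
  unfolding block_op_def K_def by simp

text \<open>Let \<open>m\<close> be the order of the root \<open>eigval q s0\<close> of
  \<open>d\<close>. As \<open>eigval q\<close> has nonzero derivative, \<open>d\<close> composed
  with it is \<open>(s - s0) ^ m\<close> times a nonvanishing \<open>D\<close>, so multiplying by
  this power clears the pole and leaves entries with denominator \<open>D\<close>. The further
  factor \<open>eigval q s\<close> appears because \<open>1 - L / l\<close> has inverse
  \<open>l\<close> times that of \<open>l - L\<close>.\<close>

lemma resolvent_local_family:
  assumes q: "q > 1" and l0: "norm (eigval q s0) > \<kappa>"
  obtains \<rho> m \<mu> c where "\<rho> > 0" "hol_family s0 \<rho> (\<lambda>s. block_op (eigval q s) (\<mu> s) (c s))"
    "\<And>s. \<mu> s = (s - s0) ^ m * eigval q s"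
    "\<And>s. s \<in> ball s0 \<rho> \<Longrightarrow> norm (eigval q s) > \<kappa>"
    "\<And>s \<phi> p. s \<in> ball s0 \<rho> - {s0} \<Longrightarrow>
       eigval q s * Res (eigval q s) \<phi> p = block_op (eigval q s) (\<mu> s) (c s) \<phi> p / (s - s0) ^ m"
proof -
  define u where "u = eigval q"
  have q0: "q > 0" using q by simp
  have hol_u: "u holomorphic_on A" for A unfolding u_def by (rule eigval_holomorphic[OF q0])
  obtain e where e: "d = [:- u s0, 1:] ^ order (u s0) d * e" "\<not> [:- u s0, 1:] dvd e"
    using order_decomp[OF d_nz] by blast
  define m where "m = order (u s0) d"
  define h where "h = dquot s0 u"
  define D where "D z = h z ^ m * poly e (u z)" for z
  have hol_h: "h holomorphic_on UNIV"
  proof -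
    have "h holomorphic_on ball s0 R" for R unfolding h_def by (rule dquot_holomorphic[OF hol_u])
    then have "h field_differentiable at z" for z
      by (metis centre_in_ball dist_commute holomorphic_on_imp_differentiable_at mem_ball open_ball less_add_one)
    then show ?thesis unfolding holomorphic_on_def by (auto intro: field_differentiable_at_within)
  qed
  have "deriv u s0 \<noteq> 0" unfolding u_def DERIV_imp_deriv[OF eigval_deriv[OF q0]]
    using q eigval_nz[OF q0] by simp
  then have "h s0 \<noteq> 0" by (simp add: h_def dquot_def)
  moreover have "poly e (u s0) \<noteq> 0" using e(2) by (simp add: poly_eq_0_iff_dvd)
  ultimately have D0: "D s0 \<noteq> 0" by (simp add: D_def)
  have hol_poly: "(\<lambda>z. poly a (u z)) holomorphic_on A" for a A
    using holomorphic_on_compose[OF hol_u[of A] analytic_imp_holomorphic[OF poly_analytic]] by (simp add: o_def)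
  have hol_D: "D holomorphic_on UNIV" unfolding D_def[abs_def]
    by (intro holomorphic_intros hol_h hol_poly)
  have dD: "poly d (u z) = (z - s0) ^ m * D z" for z
  proof -
    have "poly d (u z) = (u z - u s0) ^ m * poly e (u z)"
      using arg_cong[OF e(1), of "\<lambda>p. poly p (u z)"] by (simp add: m_def)
    also have "u z - u s0 = (z - s0) * h z" using dquot_expand[of u z s0] by (simp add: h_def)
    finally show ?thesis by (simp add: D_def power_mult_distrib)
  qed
  \<comment> \<open>Half of the gap to \<open>\<kappa>\<close>; by continuity the other half remains
    as the uniform gap required by \<open>block_op_bound\<close>.\<close>
  define \<delta> where "\<delta> = (norm (u s0) - \<kappa>) / 2"
  have \<delta>: "\<delta> > 0" using l0 by (simp add: \<delta>_def u_def)
  have "isCont D s0" "isCont u s0"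
    using hol_D hol_u[of UNIV] by (auto simp: holomorphic_on_imp_continuous_on continuous_on_eq_continuous_at
        dest!: holomorphic_on_imp_continuous_on)
  then have "\<forall>\<^sub>F z in nhds s0. D z \<noteq> 0 \<and> norm (u z) > \<kappa> + \<delta>"
    using D0 \<delta> by (intro eventually_conj tendsto_imp_eventually_ne[of D] order_tendstoD(1)[of "\<lambda>z. norm (u z)"])
      (auto simp: isCont_def tendsto_at_iff_tendsto_nhds \<delta>_def field_simps intro!: tendsto_norm)
  then obtain R where R: "R > 0" "\<And>z. dist z s0 < R \<Longrightarrow> D z \<noteq> 0 \<and> norm (u z) > \<kappa> + \<delta>"
    unfolding eventually_nhds_metric by blast
  \<comment> \<open>The smaller radius puts a compact ball inside the region where \<open>D\<close>
    does not vanish, so that \<open>b\<close> below, which dominates \<open>\<mu>\<close> and every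
    entry of \<open>c\<close>, is bounded.\<close>
  define \<rho> where "\<rho> = R / 2"
  have \<rho>: "\<rho> > 0" "cball s0 \<rho> \<subseteq> ball s0 R" using R by (auto simp: \<rho>_def)
  have good: "D z \<noteq> 0" "norm (u z) > \<kappa> + \<delta>" if "z \<in> ball s0 R" for z
    using R(2)[of z] that by (auto simp: dist_commute)
  define \<mu> where "\<mu> s = (s - s0) ^ m * u s" for s
  define c where "c s = (\<lambda>w w'. u s * poly (adj w w') (u s) / D s)" for s
  have hol_c: "(\<lambda>s. c s w w') holomorphic_on ball s0 R" for w w'
    unfolding c_def using good(1)
    by (intro holomorphic_intros hol_u hol_poly holomorphic_on_subset[OF hol_D]) auto
  have hol_\<mu>: "\<mu> holomorphic_on A" for A unfolding \<mu>_def[abs_def] by (intro holomorphic_intros hol_u)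
  define b where "b s = norm (\<mu> s) + (\<Sum>w\<in>W. \<Sum>w'\<in>W. norm (c s w w'))" for s
  have "continuous_on (cball s0 \<rho>) b" unfolding b_def[abs_def]
    by (intro continuous_intros holomorphic_on_imp_continuous_on hol_\<mu> holomorphic_on_subset[OF hol_c \<rho>(2)])
  then have "bounded (b ` cball s0 \<rho>)"
    by (intro compact_imp_bounded compact_continuous_image) auto
  then obtain B where B0: "\<forall>x\<in>b ` cball s0 \<rho>. norm x \<le> B" unfolding bounded_iff by blast
  have B: "b s \<le> B" if "s \<in> cball s0 \<rho>" for s
  proof -
    have "norm (b s) \<le> B" using B0 that by blast
    then show ?thesis by simp
  qed
  obtain C where C: "\<And>l \<mu> c \<phi>. norm l \<ge> \<kappa> + \<delta> \<Longrightarrow> norm \<mu> \<le> B \<Longrightarrow>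
      (\<And>w w'. w \<in> W \<Longrightarrow> w' \<in> W \<Longrightarrow> norm (c w w') \<le> B) \<Longrightarrow> \<phi> \<in> V \<Longrightarrow> lip_le (C * N \<phi>) (block_op l \<mu> c \<phi>)"
    using block_op_bound[OF \<delta>, of B] by metis
  have ballR: "s \<in> ball s0 R" if "s \<in> ball s0 \<rho>" for s using that \<rho>(2) ball_subset_cball by blast
  have gt: "norm (u s) > \<kappa>" if "s \<in> ball s0 \<rho>" for s using good(2)[OF ballR[OF that]] \<delta> by linarith
  have "hol_family s0 \<rho> (\<lambda>s. block_op (u s) (\<mu> s) (c s))"
    unfolding hol_family_def
  proof (intro conjI ballI allI exI)
    fix s \<phi> \<psi> x y assume s: "s \<in> ball s0 \<rho>" and V: "\<phi> \<in> V" "\<psi> \<in> V"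
    show "block_op (u s) (\<mu> s) (c s) (\<lambda>p. x * \<phi> p + y * \<psi> p) =
      (\<lambda>p. x * block_op (u s) (\<mu> s) (c s) \<phi> p + y * block_op (u s) (\<mu> s) (c s) \<psi> p)"
      by (rule block_op_linear[OF V gt[OF s]])
  next
    fix \<phi> p assume V: "\<phi> \<in> V"
    have sub: "u ` ball s0 \<rho> \<subseteq> {l. norm l > \<kappa>}" using gt by blast
    have S: "(\<lambda>s. S (u s) (dev \<phi>) p) holomorphic_on ball s0 \<rho>" for p
      using holomorphic_on_compose_gen[OF hol_u S_holomorphic[OF Z_dev[OF V]] sub] by (simp add: o_def)
    have LS: "(\<lambda>s. L (S (u s) (dev \<phi>)) p) holomorphic_on ball s0 \<rho>" for p
    proof (cases "p \<in> P")
      case True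
      have "(\<lambda>s. \<Sum>e\<in>pre p. S (u s) (dev \<phi>) (e ## p)) holomorphic_on ball s0 \<rho>"
        by (intro holomorphic_intros S)
      then show ?thesis using True by (simp add: L_eq)
    qed (simp add: L_eq)
    have "(\<lambda>s. K (c s) (\<lambda>p. \<phi> p + L (S (u s) (dev \<phi>)) p) p) holomorphic_on ball s0 \<rho>"
    proof (cases "p \<in> P")
      case True
      show ?thesis unfolding K_def if_P[OF True]
        by (intro holomorphic_intros LS holomorphic_on_subset[OF hol_c]) (use ballR in blast)
    qed (simp add: K_def)
    then show "(\<lambda>s. block_op (u s) (\<mu> s) (c s) \<phi> p) holomorphic_on ball s0 \<rho>"
      unfolding block_op_def by (intro holomorphic_intros S hol_\<mu>)
  next
    fix s \<phi> assume s: "s \<in> ball s0 \<rho>" and V: "\<phi> \<in> V"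
    have bB: "b s \<le> B" using B s by simp
    have "norm (\<mu> s) \<le> b s" unfolding b_def by (simp add: sum_nonneg)
    moreover have "norm (c s w w') \<le> b s" if "w \<in> W" "w' \<in> W" for w w'
      using member_le_double_sum[where f = "\<lambda>w w'. norm (c s w w')", OF finite_W finite_W that norm_ge_zero]
        norm_ge_zero[of "\<mu> s"] unfolding b_def by linarith
    ultimately show "lip_le (C * N \<phi>) (block_op (u s) (\<mu> s) (c s) \<phi>)"
      using bB good(2)[OF ballR[OF s]] by (intro C V) force+
  qed
  moreover have "u s * Res (u s) \<phi> p = block_op (u s) (\<mu> s) (c s) \<phi> p / (s - s0) ^ m"
    if s: "s \<in> ball s0 \<rho> - {s0}" for s \<phi> p
  proof -
    have ne: "s \<noteq> s0" "D s \<noteq> 0" using s good(1)[OF ballR] by auto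
    have "block_op (u s) (\<mu> s) (c s) \<phi> p = block_op (u s) (\<mu> s * 1) (\<lambda>w w'. \<mu> s * cf (u s) w w') \<phi> p"
      unfolding c_def mult_1_right by (rule block_op_cong) (use ne in \<open>simp add: \<mu>_def dD\<close>)
    also have "\<dots> = (s - s0) ^ m * (u s * Res (u s) \<phi> p)" unfolding block_op_scale by (simp add: \<mu>_def)
    finally show ?thesis using ne by simp
  qed
  ultimately show thesis using that[of \<rho> \<mu> c m] \<rho>(1) gt unfolding u_def \<mu>_def by blast
qed

text \<open>For finite rank, the polar coefficients must be cylinder functions:
  \<open>G s \<phi>\<close> at \<open>p\<close> and at its base point differ by
  \<open>(s - s0) ^ m\<close> times a holomorphic function, so the Taylor coefficients of index
  \<open>m - j < m\<close> agree.\<close>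

lemma resolvent_meromorphic:
  assumes q: "q > 1"
  shows "operator_meromorphic_on V N (\<lambda>s \<phi> p. eigval q s * Res (eigval q s) \<phi> p) (half_plane q \<theta>)"
  unfolding operator_meromorphic_on_def
proof
  fix s0 assume "s0 \<in> half_plane q \<theta>"
  then have l0: "norm (eigval q s0) > \<kappa>" using half_plane_iff[OF q \<theta>_pos] by simp
  obtain \<rho> m \<mu> c where \<rho>: "\<rho> > 0" and G: "hol_family s0 \<rho> (\<lambda>s. block_op (eigval q s) (\<mu> s) (c s))"
    and \<mu>: "\<And>s. \<mu> s = (s - s0) ^ m * eigval q s"
    and gt: "\<And>s. s \<in> ball s0 \<rho> \<Longrightarrow> norm (eigval q s) > \<kappa>"
    and eq: "\<And>s \<phi> p. s \<in> ball s0 \<rho> - {s0} \<Longrightarrow>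
       eigval q s * Res (eigval q s) \<phi> p = block_op (eigval q s) (\<mu> s) (c s) \<phi> p / (s - s0) ^ m"
    by (rule resolvent_local_family[OF q l0], rule that)
  define G where "G = (\<lambda>s. block_op (eigval q s) (\<mu> s) (c s))"
  have fam: "hol_family s0 \<rho> G" using G unfolding G_def .
  define A where "A = (\<lambda>j \<phi> p. (dquot s0 ^^ (m - j)) (\<lambda>s. G s \<phi> p) s0)"
  have pp: "principal_part V N (\<lambda>s \<phi> p. eigval q s * Res (eigval q s) \<phi> p) s0 m A"
    unfolding A_def by (rule principal_part_of_family[OF fam \<rho>]) (simp add: eq G_def)
  have "finite_rank V (A j)" if j: "j \<in> {1..m}" for j
  proof (rule finite_rank_of_cyl_range)
    have bo: "bounded_operator V N (A j)" using pp j unfolding principal_part_def by blast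
    fix \<phi> \<psi> a b assume "\<phi> \<in> V" "\<psi> \<in> V"
    then show "A j (\<lambda>p. a * \<phi> p + b * \<psi> p) = (\<lambda>p. a * A j \<phi> p + b * A j \<psi> p)"
      by (rule bounded_operatorD(2)[OF bo])
  next
    have bo: "bounded_operator V N (A j)" using pp j unfolding principal_part_def by blast
    fix \<phi> assume \<phi>: "\<phi> \<in> V"
    show "cyl (A j \<phi>)"
    proof (rule cylI)
      fix p assume "p \<notin> P"
      then show "A j \<phi> p = 0" by (rule V_D(1)[OF bounded_operatorD(1)[OF bo \<phi>]])
    next
      fix p assume p: "p \<in> P"
      have hol: "(\<lambda>s. G s \<phi> p) holomorphic_on ball s0 \<rho>" for p
        using fam \<phi> unfolding hol_family_def by blast
      define v where "v s = eigval q s * S (eigval q s) (dev \<phi>) p" for s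
      have sub: "eigval q ` ball s0 \<rho> \<subseteq> {l. norm l > \<kappa>}" using gt by blast
      have "eigval q holomorphic_on ball s0 \<rho>" using q by (intro eigval_holomorphic) simp
      moreover from this have "(\<lambda>s. S (eigval q s) (dev \<phi>) p) holomorphic_on ball s0 \<rho>"
        using holomorphic_on_compose_gen[OF _ S_holomorphic[OF Z_dev[OF \<phi>]] sub] by (simp add: o_def)
      ultimately have v: "v holomorphic_on ball s0 \<rho>" unfolding v_def[abs_def] by (rule holomorphic_on_mult)
      have diff: "G s \<phi> p - G s \<phi> (bp p) = (s - s0) ^ m * v s" if "s \<in> ball s0 \<rho>" for s
      proof -
        have "S (eigval q s) (dev \<phi>) (bp p) = 0"
          by (rule ZD(2)[OF S_Z[OF Z_dev[OF \<phi>] gt[OF that]] W_I[OF p]])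
        then show ?thesis using cylD(2)[OF K_cyl p] unfolding G_def block_op_def v_def by (simp add: \<mu>)
      qed
      have s0: "s0 \<in> ball s0 \<rho>" using \<rho> by simp
      have "A j \<phi> p - A j \<phi> (bp p) = (dquot s0 ^^ (m - j)) (\<lambda>s. G s \<phi> p - G s \<phi> (bp p)) s0"
        unfolding A_def by (rule dquot_iterate_diff[OF hol hol s0, symmetric])
      also have "\<dots> = (s0 - s0) ^ (m - (m - j)) * v s0"
        by (rule dquot_iterate_power[OF v diff _ s0]) auto
      also have "\<dots> = 0" using j by simp
      finally show "A j \<phi> p = A j \<phi> (bp p)" by simp
    qed
  qed
  with pp show "\<exists>n A. principal_part V N (\<lambda>s \<phi> p. eigval q s * Res (eigval q s) \<phi> p) s0 n A \<and>
      (\<forall>j\<in>{1..n}. finite_rank V (A j))" by blast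
qed

theorem resolvent_continuation:
  assumes q: "q > 1"
  shows "is_resolvent_continuation P q \<theta> (\<lambda>s \<phi> p. eigval q s * Res (eigval q s) \<phi> p)"
  unfolding is_resolvent_continuation_def
\<comment> \<open>Above \<open>3/2\<close> one has \<open>norm (eigval q s) > q\<close>, so
  \<open>d\<close> has no root there and \<open>Res\<close> is a genuine inverse.\<close>
proof (intro conjI exI[of _ "3/2"] allI impI)
  show "operator_meromorphic_on V N (\<lambda>s \<phi> p. eigval q s * Res (eigval q s) \<phi> p) (half_plane q \<theta>)"
    by (rule resolvent_meromorphic[OF q])
next
  fix s assume s: "3/2 < Im s"
  define l where "l = eigval q s"
  have lq: "norm l > q" using norm_eigval_gt[OF q, of 1 s] s by (simp add: l_def)
  have "\<kappa> \<le> q" using \<theta>_less by (simp add: mult_left_le)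
  then have lk: "norm l > \<kappa>" using lq by linarith
  have dl: "poly d l \<noteq> 0" using d_root_norm[of l] lq by linarith
  have l0: "l \<noteq> 0" unfolding l_def using q by (intro eigval_nz) simp
  have bo: "bounded_operator V N (Res l)" by (rule Res_V[OF lk])
  have inv: "Res l (\<lambda>p. l * \<phi> p - L \<phi> p) = \<phi>" if "\<phi> \<in> V" for \<phi>
    using Res_inverse[OF lk dl] that unfolding is_inverse_operator_def by blast
  show "is_inverse_operator V N (\<lambda>\<phi> p. \<phi> p - of_nat q powr (1/2 + \<i> * s) * L \<phi> p) (\<lambda>\<phi> p. eigval q s * Res (eigval q s) \<phi> p)"
    unfolding is_inverse_operator_def powr_eq_inverse_eigval l_def[symmetric]
  proof (intro conjI ballI)
    obtain C where C: "\<And>\<phi>. \<phi> \<in> V \<Longrightarrow> N (Res l \<phi>) \<le> C * N \<phi>"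
      using bo unfolding bounded_operator_def by blast
    show "bounded_operator V N (\<lambda>\<phi> p. l * Res l \<phi> p)"
    proof (rule bounded_operatorI[where K = "norm l * C"])
      fix \<phi> assume \<phi>: "\<phi> \<in> V"
      have "lip_le (norm l * N (Res l \<phi>) + norm (0::complex) * N (Res l \<phi>)) (\<lambda>p. l * Res l \<phi> p + 0 * Res l \<phi> p)"
        by (intro lip_le_lincomb lip_le_norm bounded_operatorD(1)[OF bo \<phi>])
      then show "lip_le (norm l * C * N \<phi>) (\<lambda>p. l * Res l \<phi> p)"
        using C[OF \<phi>] by (auto elim!: lip_le_mono simp: mult.assoc intro!: mult_left_mono)
    next
      fix \<phi> \<psi> a b assume "\<phi> \<in> V" "\<psi> \<in> V"
      from bounded_operatorD(2)[OF bo this]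
      show "(\<lambda>p. l * Res l (\<lambda>p. a * \<phi> p + b * \<psi> p) p) = (\<lambda>p. a * (l * Res l \<phi> p) + b * (l * Res l \<psi> p))"
        by (simp add: algebra_simps)
    qed
  next
    fix \<phi> assume \<phi>: "\<phi> \<in> V"
    have V: "(\<lambda>p. l * \<phi> p - L \<phi> p) \<in> V" by (rule shifted_L_V[OF \<phi>])
    have "(\<lambda>p. \<phi> p - 1 / l * L \<phi> p) = (\<lambda>p. (1 / l) * (l * \<phi> p - L \<phi> p) + 0 * (l * \<phi> p - L \<phi> p))"
      using l0 by (simp add: field_simps)
    then show "(\<lambda>p. l * Res l (\<lambda>p. \<phi> p - 1 / l * L \<phi> p) p) = \<phi>"
      using bounded_operatorD(2)[OF bo V V, of "1 / l" 0] inv[OF \<phi>] l0 by simp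
    show "(\<lambda>p. l * Res l \<phi> p - 1 / l * L (\<lambda>p. l * Res l \<phi> p) p) = \<phi>"
      using Res_right_inverse[OF lk dl \<phi>] l0 unfolding L_cmult by simp
  qed
qed

subsection \<open>The continued zeta function\<close>

definition zeta_cont :: "('v edge stream \<Rightarrow> complex) \<Rightarrow> complex \<Rightarrow> complex" where
  "zeta_cont g s = eigval q s * F g (eigval q s) - tr g 0"

lemma zeta_cont_sums:
  assumes "q > 1" "depends g" "Im s > 3/2"
  shows "(\<lambda>m. tr g (Suc m) / eigval q s ^ Suc m) sums zeta_cont g s"
  unfolding zeta_cont_def using norm_eigval_gt[OF assms(1), of 1 s] assms(3) by (intro F_sums assms(2)) simp

lemma zeta_cont_meromorphic: "q > 1 \<Longrightarrow> zeta_cont g meromorphic_on A"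
  unfolding zeta_cont_def[abs_def]
  by (intro meromorphic_on_diff meromorphic_on_mult meromorphic_on_const
      meromorphic_on_compose[OF F_meromorphic[of g UNIV]] analytic_on_imp_meromorphic_on eigval_analytic) auto

lemma zeta_cont_analytic:
  assumes "q > 1" "poly d (eigval q s0) \<noteq> 0"
  shows "zeta_cont g analytic_on {s0}"
proof -
  have u: "eigval q analytic_on {s0}" using assms by (intro eigval_analytic) simp
  have "(F g \<circ> eigval q) analytic_on {s0}"
    using analytic_on_compose[OF u] F_analytic[OF assms(2)] by simp
  then show ?thesis unfolding zeta_cont_def[abs_def] by (intro analytic_intros u) (simp add: o_def)
qed

text \<open>Since \<open>eigval q\<close> has derivative \<open>- \<i> * ln q\<close> times itself,
  the factor \<open>eigval q s\<close> in \<open>zeta_cont\<close> equals \<open>\<i> / ln q\<close>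
  times that derivative, which is the Jacobian of the change of variables. The constant
  \<open>tr g 0\<close> contributes only an analytic term.\<close>

lemma residue_zeta_cont:
  fixes k :: nat
  assumes q: "q > 1"
  shows "residue (\<lambda>s. zeta_cont g s * (eigval q s - eigval q s0) ^ k) s0 =
     \<i> / ln (real q) * residue (\<lambda>l. (l - eigval q s0) ^ k * F g l) (eigval q s0)"
proof -
  define u where "u = eigval q"
  have q0: "q > 0" using q by simp
  have lnq: "complex_of_real (ln (real q)) \<noteq> 0" using q by simp
  have u: "u analytic_on A" for A unfolding u_def by (rule eigval_analytic[OF q0])
  have du: "deriv u s = - \<i> * ln (real q) * u s" for s
    unfolding u_def by (rule DERIV_imp_deriv[OF eigval_deriv[OF q0]])
  define H where "H l = \<i> / ln (real q) * ((l - u s0) ^ k * F g l)" for l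
  have H: "H meromorphic_on A" for A unfolding H_def[abs_def]
    by (intro meromorphic_on_mult meromorphic_on_power meromorphic_on_diff F_meromorphic
        meromorphic_on_const meromorphic_on_id)
  have eq: "zeta_cont g s * (u s - u s0) ^ k = deriv u s * H (u s) + (- tr g 0) * (u s - u s0) ^ k" for s
  proof -
    have "deriv u s * H (u s) = (- \<i> * \<i>) * (ln (real q) / ln (real q)) * (u s * F g (u s) * (u s - u s0) ^ k)"
      unfolding du H_def by (simp add: mult_ac)
    also have "\<dots> = u s * F g (u s) * (u s - u s0) ^ k" using lnq by simp
    finally show ?thesis unfolding zeta_cont_def u_def[symmetric] by (simp add: algebra_simps)
  qed
  have an: "(\<lambda>s. (- tr g 0) * (u s - u s0) ^ k) analytic_on {s0}" by (intro analytic_intros u)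
  have "(\<lambda>s. deriv u s * H (u s)) meromorphic_on {s0}" unfolding du
    by (intro meromorphic_on_mult meromorphic_on_const analytic_on_imp_meromorphic_on[OF u]
        meromorphic_on_compose[OF H[of UNIV] u]) auto
  then have "residue (\<lambda>s. zeta_cont g s * (u s - u s0) ^ k) s0 = residue (\<lambda>s. deriv u s * H (u s)) s0"
    unfolding eq by (subst residue_add_meromorphic)
      (simp_all add: analytic_on_imp_meromorphic_on[OF an, simplified] residue_analytic[OF an, simplified])
  also have "\<dots> = residue H (u s0)"
    using eigval_nz[OF q0] lnq by (intro residue_change_of_variables H u) (simp add: du, simp add: u_def)
  also have "\<dots> = \<i> / ln (real q) * residue (\<lambda>l. (l - u s0) ^ k * F g l) (u s0)"
    unfolding H_def[abs_def]
    by (intro residue_cmult_meromorphic meromorphic_on_mult meromorphic_on_power meromorphic_on_diff F_meromorphic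
        meromorphic_on_const meromorphic_on_id)
  finally show ?thesis unfolding u_def .
qed

end

subsection \<open>Periodic streams\<close>

lemma stream_eqI: "(\<And>i. p !! i = p' !! i) \<Longrightarrow> p = p'"
  using stream_first_difference by metis

lemma snth_cycle:
  assumes "c \<noteq> []"
  shows "cycle c !! i = c ! (i mod length c)"
proof -
  have "cycle c !! i = shd (sdrop i (cycle c))" by simp
  also have "\<dots> = hd (rotate (i mod length c) c)" using assms by (simp add: sdrop_cycle del: sdrop_simps)
  also have "\<dots> = c ! (i mod length c)" using assms by (simp add: hd_rotate_conv_nth)
  finally show ?thesis .
qed

lemma sdrop_mult_period:
  assumes "sdrop d p = p"
  shows "sdrop (k * d) p = p"
proof (induction k)
  case (Suc k)
  have "sdrop (Suc k * d) p = sdrop (k * d) (sdrop d p)" by simp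
  then show ?case using Suc assms by simp
qed simp

text \<open>A Euclidean step on periods: it makes the least period divide every period.\<close>

lemma sdrop_mod_period:
  assumes "sdrop a p = p" "sdrop d p = p"
  shows "sdrop (a mod d) p = p"
proof -
  have "sdrop a p = sdrop (a mod d) (sdrop (a div d * d) p)" by simp
  then show ?thesis using assms sdrop_mult_period[OF assms(2)] by simp
qed

lemma snth_mod_period:
  assumes "sdrop d p = p"
  shows "p !! i = p !! (i mod d)"
proof -
  have "p !! i = sdrop (i div d * d) p !! (i mod d)" by (simp add: sdrop_snth)
  then show ?thesis using sdrop_mult_period[OF assms] by simp
qed

lemma cycle_stake_period:
  assumes "sdrop d p = p" "d \<ge> 1"
  shows "cycle (stake d p) = p"
proof (rule stream_eqI)
  fix i
  have ne: "stake d p \<noteq> []" using assms(2) by simp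
  have "stake d p ! (i mod d) = p !! (i mod d)"
    using shift_snth_less[of "i mod d" "stake d p" "sdrop d p"] assms(2) by (simp add: stake_sdrop)
  then show "cycle (stake d p) !! i = p !! i"
    using snth_cycle[OF ne, of i] snth_mod_period[OF assms(1), of i] by simp
qed

lemma cycle_concat_replicate:
  assumes "c \<noteq> []" "m \<ge> 1"
  shows "cycle (concat (replicate m c)) = cycle c"
proof -
  have "stake (m * length c) (cycle c) = concat (replicate m c)" using assms by simp
  moreover have "cycle (stake (m * length c) (cycle c)) = cycle c"
    using assms by (intro cycle_stake_period sdrop_mult_period) (auto simp: Suc_le_eq)
  ultimately show ?thesis by simp
qed

lemma cycle_in_sft_paths_iff:
  assumes c: "c \<noteq> []"
  shows "cycle c \<in> sft_paths E r \<longleftrightarrow> set c \<subseteq> E \<and> successively r c \<and> r (last c) (hd c)"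
proof
  let ?l = "length c"
  assume *: "cycle c \<in> sft_paths E r"
  then have "set c \<subseteq> E" using c unfolding sft_paths_def by simp
  have r: "r (c ! (i mod ?l)) (c ! (Suc i mod ?l))" for i
    using * c unfolding sft_paths_iff by (metis snth_cycle)
  have "successively r c" unfolding successively_conv_nth
  proof (intro allI impI)
    fix i assume "Suc i < ?l"
    then show "r (c ! i) (c ! Suc i)" using r[of i] by simp
  qed
  moreover have "r (last c) (hd c)" using r[of "?l - 1"] c by (simp add: last_conv_nth hd_conv_nth)
  ultimately show "set c \<subseteq> E \<and> successively r c \<and> r (last c) (hd c)" using \<open>set c \<subseteq> E\<close> by blast
next
  let ?l = "length c"
  assume *: "set c \<subseteq> E \<and> successively r c \<and> r (last c) (hd c)"
  have l: "?l > 0" using c by simp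
  show "cycle c \<in> sft_paths E r" unfolding sft_paths_iff
  proof (intro allI conjI)
    fix i
    have il: "i mod ?l < ?l" using l by simp
    then show "cycle c !! i \<in> E" using * unfolding snth_cycle[OF c] by (meson nth_mem subsetD)
    show "r (cycle c !! i) (cycle c !! Suc i)"
    proof (cases "Suc (i mod ?l) = ?l")
      case True
      then have "Suc i mod ?l = 0" by (metis mod_Suc)
      moreover have "i mod ?l = ?l - 1" using True by simp
      ultimately show ?thesis unfolding snth_cycle[OF c] using * c by (simp add: last_conv_nth hd_conv_nth)
    next
      case False
      then have "Suc i mod ?l = Suc (i mod ?l)" by (simp add: mod_Suc)
      moreover have "Suc (i mod ?l) < ?l" using False il by linarith
      ultimately show ?thesis unfolding snth_cycle[OF c] using * by (simp add: successively_conv_nth)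
    qed
  qed
qed

subsection \<open>Traces and periodic points\<close>

lemma (in sft) finite_preimages: "finite {p' \<in> P. sdrop m p' = p}"
proof (rule finite_surj[OF finite_words[of m], of _ "\<lambda>xs. xs @- p"])
  show "{p' \<in> P. sdrop m p' = p} \<subseteq> (\<lambda>xs. xs @- p) ` {xs. set xs \<subseteq> E \<and> length xs = m}"
  proof
    fix p' assume "p' \<in> {p' \<in> P. sdrop m p' = p}"
    then have "p' = stake m p' @- p" "stake m p' \<in> {xs. set xs \<subseteq> E \<and> length xs = m}"
      using stake_sdrop[of m p'] set_stake_sft_paths[of p' E r m] by auto
    then show "p' \<in> (\<lambda>xs. xs @- p) ` {xs. set xs \<subseteq> E \<and> length xs = m}" by (rule image_eqI)
  qed
qed

text \<open>The preimages under \<open>Suc m\<close> shifts are grouped by their image under the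
  first \<open>m\<close> shifts.\<close>

lemma (in sft) L_iterate:
  assumes "p \<in> P"
  shows "(L ^^ m) \<phi> p = (\<Sum>p'\<in>{p' \<in> P. sdrop m p' = p}. \<phi> p')"
  using assms
proof (induction m arbitrary: p)
  case 0
  then have "{p' \<in> P. sdrop 0 p' = p} = {p}" by auto
  then show ?case by simp
next
  case (Suc m)
  let ?S = "{p' \<in> P. sdrop (Suc m) p' = p}" and ?T = "{x \<in> P. stl x = p}"
  have stl: "sdrop (Suc m) p' = stl (sdrop m p')" for p' :: "'v edge stream" by (simp only: sdrop.simps sdrop_stl)
  have "(L ^^ Suc m) \<phi> p = (\<Sum>y\<in>?T. (L ^^ m) \<phi> y)" by (simp add: transfer_def)
  also have "\<dots> = (\<Sum>y\<in>?T. \<Sum>p'\<in>{p' \<in> ?S. sdrop m p' = y}. \<phi> p')"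
  proof (rule sum.cong[OF refl])
    fix y assume y: "y \<in> ?T"
    then have "{p' \<in> ?S. sdrop m p' = y} = {p' \<in> P. sdrop m p' = y}" unfolding stl by blast
    then show "(L ^^ m) \<phi> y = (\<Sum>p'\<in>{p' \<in> ?S. sdrop m p' = y}. \<phi> p')" using Suc.IH[of y] y by (simp only: mem_Collect_eq)
  qed
  also have "\<dots> = (\<Sum>p'\<in>?S. \<phi> p')"
  proof (rule sum.group[OF finite_preimages])
    show "finite ?T" using finite_preimages[of 1 p] by simp
    show "sdrop m ` ?S \<subseteq> ?T" unfolding stl using sft_paths_sdrop by blast
  qed
  finally show ?case .
qed

context sft_resolvent
begin

text \<open>
  A summand of the trace is a path whose first \<open>n\<close> letters reappear after \<open>m\<close> steps, continued
  as prescribed by the base point; replacing the tail by the periodic one gives the bijection.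
\<close>

lemma trace_periodic:
  assumes g: "depends g" and m: "m \<ge> 1"
  shows "tr g m = (\<Sum>u\<in>{u \<in> P. sdrop m u = u}. g u)"
proof -
  define T' where "T' = {p' \<in> P. sdrop m p' = bp p'}"
  have T'W: "T' = (\<Union>w\<in>W. {p' \<in> P. sdrop m p' = base w \<and> stake n p' = w})"
    unfolding T'_def by auto
  have fin: "finite T'"
    unfolding T'W using finite_W by (intro finite_UN_I finite_subset[OF _ finite_preimages]) auto
  have "tr g m = (\<Sum>w\<in>W. \<Sum>p'\<in>{p' \<in> P. sdrop m p' = base w}. g p' * ind w p')"
    unfolding tr_def by (intro sum.cong refl L_iterate base)
  also have "\<dots> = (\<Sum>w\<in>W. \<Sum>p'\<in>{p' \<in> T'. stake n p' = w}. g p')"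
  proof (rule sum.cong[OF refl])
    fix w assume "w \<in> W"
    have "(\<Sum>p'\<in>{p' \<in> T'. stake n p' = w}. g p') = (\<Sum>p'\<in>{p' \<in> T'. stake n p' = w}. g p' * ind w p')"
      by (intro sum.cong refl) (simp add: ind_def T'_def)
    also have "\<dots> = (\<Sum>p'\<in>{p' \<in> P. sdrop m p' = base w}. g p' * ind w p')"
      by (intro sum.mono_neutral_left finite_preimages) (auto simp: T'_def ind_def)
    finally show "(\<Sum>p'\<in>{p' \<in> P. sdrop m p' = base w}. g p' * ind w p') = (\<Sum>p'\<in>{p' \<in> T'. stake n p' = w}. g p')" ..
  qed
  also have "\<dots> = (\<Sum>p'\<in>T'. g p')"
    by (rule sum.group[OF fin finite_W]) (auto simp: T'_def)
  also have "\<dots> = (\<Sum>u\<in>{u \<in> P. sdrop m u = u}. g u)"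
  proof (rule sum.reindex_bij_witness[of _ "\<lambda>u. stake m u @- bp u" "\<lambda>p. cycle (stake m p)"])
    fix u assume "u \<in> {u \<in> P. sdrop m u = u}"
    then have u: "u \<in> P" "sdrop m u = u" by auto
    let ?p = "stake m u @- bp u"
    have b: "bp u \<in> P" "stake n (bp u) = stake n u" using base[OF W_I[OF u(1)]] by auto
    \<comment> \<open>Agreement goes beyond index \<open>m\<close>, since \<open>n \<ge> 1\<close>;
      this makes the transition at the seam from \<open>m - 1\<close> to \<open>m\<close>
      admissible.\<close>
    have s: "?p !! i = u !! i" if "i < n + m" for i
    proof (cases "i < m")
      case True
      then show ?thesis using shift_snth_less[of i "stake m u" "sdrop m u"] by (simp add: stake_sdrop)
    next
      case False
      then have "?p !! i = bp u !! (i - m)" by simp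
      also have "\<dots> = u !! (i - m)" using b(2) False that unfolding stake_eq_iff by simp
      also have "\<dots> = u !! i" using arg_cong[OF u(2), of "\<lambda>p. p !! (i - m)"] False by (simp add: sdrop_snth)
      finally show ?thesis .
    qed
    have st: "stake n ?p = stake n u" unfolding stake_eq_iff using s by simp
    have sd: "sdrop m ?p = bp u" by (simp add: sdrop_shift)
    show "cycle (stake m ?p) = u" using cycle_stake_period[OF u(2) m] by (simp add: stake_shift)
    have "?p \<in> P" unfolding sft_paths_iff
    proof
      fix i
      show "?p !! i \<in> E \<and> r (?p !! i) (?p !! Suc i)"
      proof (cases "i < m")
        case True
        then show ?thesis using s[of i] s[of "Suc i"] n_pos u(1) unfolding sft_paths_iff by simp
      next
        case False
        then have "?p !! i = bp u !! (i - m)" "?p !! Suc i = bp u !! Suc (i - m)" by (simp_all add: Suc_diff_le del: snth.simps)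
        then show ?thesis using b(1) unfolding sft_paths_iff by simp
      qed
    qed
    then show "?p \<in> T'" unfolding T'_def using sd st by simp
  next
    fix p assume "p \<in> T'"
    then have p: "p \<in> P" "sdrop m p = bp p" unfolding T'_def by auto
    let ?u = "cycle (stake m p)"
    have ne: "stake m p \<noteq> []" using m by simp
    have b: "bp p \<in> P" "stake n (bp p) = stake n p" using base[OF W_I[OF p(1)]] by auto
    have per: "p !! (m + i) = p !! i" if "i < n" for i
      using arg_cong[OF p(2), of "\<lambda>p. p !! i"] b(2) that unfolding stake_eq_iff by (simp add: sdrop_snth)
    have u_eq: "?u !! i = p !! (i mod m)" for i
    proof -
      have "stake m p ! (i mod m) = p !! (i mod m)"
        using shift_snth_less[of "i mod m" "stake m p" "sdrop m p"] m by (simp add: stake_sdrop)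
      then show ?thesis using snth_cycle[OF ne, of i] by simp
    qed
    \<comment> \<open>As \<open>sdrop m p\<close> shares its first \<open>n\<close> letters with
      \<open>p\<close>, the letters of \<open>p\<close> recur with period \<open>m\<close> up to
      index \<open>n + m\<close>; beyond that the two streams may differ.\<close>
    have s: "?u !! i = p !! i" if "i < n + m" for i
      using that
    proof (induction i rule: less_induct)
      case (less i)
      show ?case
      proof (cases "i < m")
        case True
        then show ?thesis unfolding u_eq by simp
      next
        case False
        then have "?u !! i = ?u !! (i - m)" unfolding u_eq by (simp add: le_mod_geq)
        also have "\<dots> = p !! (i - m)" using less False m by simp
        also have "\<dots> = p !! i" using per[of "i - m"] less.prems False by simp
        finally show ?thesis .
      qed
    qed
    have "?u \<in> P" unfolding sft_paths_iff
    proof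
      fix i
      have "?u !! i = ?u !! (i mod m)" "?u !! Suc i = ?u !! Suc (i mod m)"
        unfolding u_eq by (simp_all add: mod_simps)
      moreover have "i mod m < m" using m by simp
      ultimately show "?u !! i \<in> E \<and> r (?u !! i) (?u !! Suc i)"
        using s[of "i mod m"] s[of "Suc (i mod m)"] n_pos p(1) unfolding sft_paths_iff by simp
    qed
    moreover have "sdrop m ?u = ?u" using sdrop_cycle_eq[OF ne] by simp
    ultimately show "?u \<in> {u \<in> P. sdrop m u = u}" by simp
    have st: "stake n ?u = stake n p" unfolding stake_eq_iff using s by simp
    have "stake m ?u = stake m p" using stake_cycle_eq[OF ne] by simp
    then show "stake m ?u @- bp ?u = p" unfolding st p(2)[symmetric] by (simp add: stake_sdrop)
    show "g ?u = g p" using g st \<open>?u \<in> P\<close> p(1) unfolding depends_def by metis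
  qed
  finally show ?thesis .
qed

text \<open>For \<open>g = 1\<close> the trace formula counts periodic points, and each diagonal
  entry of the \<open>m\<close>-th power of \<open>L\<close> is at most
  \<open>q ^ m\<close>.\<close>

lemma card_periodic:
  assumes m: "m \<ge> 1"
  shows "card {u \<in> P. sdrop m u = u} \<le> card W * q ^ m"
proof -
  have "tr (\<lambda>_. 1) m = (\<Sum>u\<in>{u \<in> P. sdrop m u = u}. 1)"
    by (rule trace_periodic[OF _ m]) (simp add: depends_def)
  then have "norm (of_nat (card {u \<in> P. sdrop m u = u}) :: complex) = norm (tr (\<lambda>_. 1) m)" by simp
  also have "\<dots> \<le> (\<Sum>w\<in>W. real q ^ m * 1)"
    unfolding tr_def
  proof (rule sum_norm_le)
    fix w assume w: "w \<in> W"
    show "norm ((L ^^ m) (\<lambda>p. 1 * ind w p) (base w)) \<le> real q ^ m * 1"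
      using L_iterate_sup[of "\<lambda>p. 1 * ind w p" 1 "base w" m] base[OF w] by (simp add: ind_def)
  qed
  finally have "real (card {u \<in> P. sdrop m u = u}) \<le> real (card W * q ^ m)" by simp
  then show "card {u \<in> P. sdrop m u = u} \<le> card W * q ^ m" by (simp only: of_nat_le_iff)
qed

end

subsection \<open>Closed paths\<close>

lemma powr_of_nat_mult: "x \<noteq> 0 \<Longrightarrow> (x :: complex) powr (a * of_nat l) = (x powr a) ^ l"
  by (simp add: powr_def exp_of_nat_mult[symmetric] mult_ac)

text \<open>A left-infinite path is stored from its last edge backwards, hence the exchanged
  arguments for \<open>Minus\<close>.\<close>

definition side_rel :: "side \<Rightarrow> 'v edge \<Rightarrow> 'v edge \<Rightarrow> bool" where
  "side_rel \<epsilon> a b = (case \<epsilon> of Plus \<Rightarrow> follows a b | Minus \<Rightarrow> follows b a)"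

lemma half_paths_sft: "half_paths G \<epsilon> = sft_paths (parcs G) (side_rel \<epsilon>)"
  by (cases \<epsilon>) (auto simp: sft_paths_def side_rel_def)

locale regular_graph =
  fixes G :: "'v pair_pre_digraph" and q :: nat
  assumes q: "q > 1" and graph: "pair_graph G" and verts_ne: "pverts G \<noteq> {}"
    and regular: "\<And>v. v \<in> pverts G \<Longrightarrow> out_degree (with_proj G) v = q + 1"
begin

abbreviation "E \<equiv> parcs G"

lemma finite_E: "finite E" and no_loop: "e \<in> E \<Longrightarrow> fst e \<noteq> snd e"
  and sym: "(a, b) \<in> E \<Longrightarrow> (b, a) \<in> E" and ends: "e \<in> E \<Longrightarrow> fst e \<in> pverts G" "e \<in> E \<Longrightarrow> snd e \<in> pverts G"
proof -
  interpret pair_graph G by (rule graph)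
  show "finite E" by (rule pair_finite_arcs)
  show "e \<in> E \<Longrightarrow> fst e \<noteq> snd e" by (rule pair_no_loops)
  show "(a, b) \<in> E \<Longrightarrow> (b, a) \<in> E" by (rule arcs_symmetric)
  show "e \<in> E \<Longrightarrow> fst e \<in> pverts G" "e \<in> E \<Longrightarrow> snd e \<in> pverts G" by (auto intro: arc_fst_in_verts arc_snd_in_verts)
qed

lemma swap_E: "e \<in> E \<Longrightarrow> prod.swap e \<in> E"
  using sym by (cases e) auto

lemma card_out: "v \<in> pverts G \<Longrightarrow> card {e \<in> E. fst e = v} = q + 1"
  using regular unfolding out_degree_def out_arcs_def by simp

text \<open>Of the \<open>q + 1\<close> edges leaving the endpoint of \<open>a\<close>, exactly the
  reversed edge is forbidden.\<close>

lemma card_follows: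
  assumes "a \<in> E"
  shows "card {b \<in> E. follows a b} = q"
proof -
  have "{b \<in> E. follows a b} = {e \<in> E. fst e = snd a} - {prod.swap a}"
    by (auto simp: follows_def)
  moreover have "prod.swap a \<in> {e \<in> E. fst e = snd a}" using swap_E[OF assms] by simp
  ultimately show ?thesis using card_out[OF ends(2)[OF assms]] finite_E by simp
qed

lemma follows_swap: "follows (prod.swap b) (prod.swap a) \<longleftrightarrow> follows a b"
  unfolding follows_def by (cases a; cases b) auto

lemma card_follows':
  assumes "b \<in> E"
  shows "card {a \<in> E. follows a b} = q"
proof -
  have "bij_betw prod.swap {a \<in> E. follows a b} {c \<in> E. follows (prod.swap b) c}"
    by (rule bij_betwI[where g = prod.swap])
      (auto simp: swap_E follows_swap intro: follows_swap[THEN iffD1] simp del: swap_simp)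
  then show ?thesis using card_follows[OF swap_E[OF assms]] bij_betw_same_card by fastforce
qed

lemma E_ne: "E \<noteq> {}"
proof -
  obtain v where v: "v \<in> pverts G" using verts_ne by blast
  have "{e \<in> E. fst e = v} \<noteq> {}" using card_out[OF v] by (metis Suc_eq_plus1 card.empty nat.distinct(1))
  then show ?thesis by blast
qed

lemma sft: "sft E (side_rel \<epsilon>) q"
proof
  show "card {a \<in> E. side_rel \<epsilon> a b} \<le> q" if "b \<in> E" for b
    using card_follows[OF that] card_follows'[OF that] by (cases \<epsilon>) (simp_all add: side_rel_def)
  show "\<exists>b\<in>E. side_rel \<epsilon> a b" if "a \<in> E" for a
  proof -
    have "{b \<in> E. follows a b} \<noteq> {}" "{b \<in> E. follows b a} \<noteq> {}"
      using card_follows[OF that] card_follows'[OF that] q by (metis card.empty not_less_zero)+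
    then show ?thesis by (cases \<epsilon>) (auto simp: side_rel_def)
  qed
qed (use finite_E E_ne q in auto)

lemma no_backtrack: "follows a b \<Longrightarrow> follows b a \<Longrightarrow> a \<in> E \<Longrightarrow> False"
  unfolding follows_def by (cases a; cases b) auto

lemma not_follows_self: "a \<in> E \<Longrightarrow> \<not> follows a a"
  using no_loop unfolding follows_def by metis

text \<open>The graph excludes lengths 1 and 2: a single closed edge would be a loop, and two edges
  would backtrack. Admissibility of the periodic stream therefore already forces length at least
  3.\<close>

lemma closed_path_iff: "closed_path G c \<longleftrightarrow> c \<noteq> [] \<and> cycle c \<in> sft_paths E follows"
proof (cases "c = []")
  case False
  have "length c \<ge> 3" if c: "set c \<subseteq> E" "successively follows c" "follows (last c) (hd c)"
  proof (rule ccontr)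
    assume "\<not> length c \<ge> 3"
    then consider a where "c = [a]" | a b where "c = [a, b]"
      using False by (cases c; cases "tl c"; cases "tl (tl c)") auto
    then show False
      using c not_follows_self no_backtrack by cases auto
  qed
  then show ?thesis using False unfolding closed_path_def cycle_in_sft_paths_iff[OF False] by blast
qed (simp add: closed_path_def)

lemma closed_path_ne: "closed_path G c \<Longrightarrow> c \<noteq> []"
  unfolding closed_path_iff by blast

definition closed_paths :: "nat \<Rightarrow> 'v edge list set" where
  "closed_paths m = {c. closed_path G c \<and> length c = m}"

lemma finite_closed_paths: "finite (closed_paths m)"
  by (rule finite_subset[OF _ finite_lists_length_eq[OF finite_E, of m]]) (auto simp: closed_paths_def closed_path_def)

lemma half_periodic: "half \<epsilon> (periodic_path c) = cycle (case \<epsilon> of Plus \<Rightarrow> c | Minus \<Rightarrow> rev c)"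
  by (cases \<epsilon>) (simp_all add: periodic_path_def)

lemma cycle_rev_side:
  assumes "c \<noteq> []"
  shows "cycle (rev c) \<in> sft_paths E (side_rel Minus) \<longleftrightarrow> cycle c \<in> sft_paths E follows"
  using assms unfolding cycle_in_sft_paths_iff[OF assms] cycle_in_sft_paths_iff[OF assms[folded rev_is_Nil_conv[of c]]]
  by (simp add: side_rel_def[abs_def] last_rev hd_rev)

text \<open>Here \<open>m\<close> is any period, not the least one, so repetitions of shorter closed
  paths are included, as the trace requires.\<close>

lemma bij_half_periodic:
  assumes "m \<ge> 1"
  shows "bij_betw (\<lambda>c. half \<epsilon> (periodic_path c)) (closed_paths m) {u \<in> half_paths G \<epsilon>. sdrop m u = u}"
proof (rule bij_betwI[where g = "\<lambda>u. (case \<epsilon> of Plus \<Rightarrow> stake m u | Minus \<Rightarrow> rev (stake m u))"])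
  show "(\<lambda>c. half \<epsilon> (periodic_path c)) \<in> closed_paths m \<rightarrow> {u \<in> half_paths G \<epsilon>. sdrop m u = u}"
  proof
    fix c assume c: "c \<in> closed_paths m"
    then have ne: "c \<noteq> []" "length c = m" using closed_path_ne by (auto simp: closed_paths_def)
    have "cycle c \<in> sft_paths E follows" using c unfolding closed_paths_def closed_path_iff by simp
    then have "half \<epsilon> (periodic_path c) \<in> half_paths G \<epsilon>"
      using cycle_rev_side[OF ne(1)] unfolding half_periodic half_paths_sft
      by (cases \<epsilon>) (simp_all add: side_rel_def[abs_def])
    moreover have "sdrop m (half \<epsilon> (periodic_path c)) = half \<epsilon> (periodic_path c)"
      using ne sdrop_cycle_eq[of c] sdrop_cycle_eq[of "rev c"] unfolding half_periodic by (cases \<epsilon>) auto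
    ultimately show "half \<epsilon> (periodic_path c) \<in> {u \<in> half_paths G \<epsilon>. sdrop m u = u}" by simp
  qed
  show "(\<lambda>u. (case \<epsilon> of Plus \<Rightarrow> stake m u | Minus \<Rightarrow> rev (stake m u))) \<in> {u \<in> half_paths G \<epsilon>. sdrop m u = u} \<rightarrow> closed_paths m"
  proof
    fix u assume "u \<in> {u \<in> half_paths G \<epsilon>. sdrop m u = u}"
    then have u: "u \<in> sft_paths E (side_rel \<epsilon>)" "cycle (stake m u) = u"
      unfolding half_paths_sft using cycle_stake_period[OF _ assms] by blast+
    have ne: "stake m u \<noteq> []" using assms by simp
    show "(case \<epsilon> of Plus \<Rightarrow> stake m u | Minus \<Rightarrow> rev (stake m u)) \<in> closed_paths m"
    proof (cases \<epsilon>)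
      case Plus
      then show ?thesis using u ne by (simp add: closed_paths_def closed_path_iff side_rel_def[abs_def])
    next
      case Minus
      then have "cycle (rev (stake m u)) \<in> sft_paths E follows"
        using u ne cycle_rev_side[of "rev (stake m u)"] by simp
      then show ?thesis using ne Minus by (simp add: closed_paths_def closed_path_iff)
    qed
  qed
  show "(case \<epsilon> of Plus \<Rightarrow> stake m (half \<epsilon> (periodic_path c)) | Minus \<Rightarrow> rev (stake m (half \<epsilon> (periodic_path c)))) = c"
    if "c \<in> closed_paths m" for c
  proof -
    have ne: "c \<noteq> []" "length c = m" using that closed_path_ne by (auto simp: closed_paths_def)
    then show ?thesis using stake_cycle_eq[of c] stake_cycle_eq[of "rev c"] unfolding half_periodic by (cases \<epsilon>) auto
  qed
  show "half \<epsilon> (periodic_path (case \<epsilon> of Plus \<Rightarrow> stake m u | Minus \<Rightarrow> rev (stake m u))) = u"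
    if "u \<in> {u \<in> half_paths G \<epsilon>. sdrop m u = u}" for u
  proof -
    have "cycle (stake m u) = u" using cycle_stake_period[OF _ assms] that by blast
    then show ?thesis unfolding half_periodic by (cases \<epsilon>) simp_all
  qed
qed

lemma shift_Plus_periodic:
  fixes c :: "'v edge list"
  assumes "c \<noteq> []"
  shows "(shift Plus ^^ k) (periodic_path c) = periodic_path (rotate k c)"
proof (induction k)
  case (Suc k)
  have *: "shift Plus (periodic_path c) = periodic_path (rotate1 c)" if "c \<noteq> []" for c :: "'v edge list"
  proof -
    obtain x xs where c: "c = x # xs" using \<open>c \<noteq> []\<close> by (cases c) auto
    have "cycle (x # rev xs) = x ## cycle (rev xs @ [x])" by (rule cycle_Cons)
    then show ?thesis unfolding c periodic_path_def by (simp add: cycle_Cons)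
  qed
  show ?case using *[of "rotate k c"] assms Suc by simp
qed simp

lemma shift_Minus_Plus: "shift Minus (shift Plus x) = x"
  by (cases x) simp

lemma shift_Minus_periodic:
  fixes c :: "'v edge list"
  assumes "c \<noteq> []"
  shows "(shift Minus ^^ k) (periodic_path (rotate k c)) = periodic_path c"
proof -
  have "(shift Minus ^^ k) ((shift Plus ^^ k) x) = x" for x :: "'v edge stream \<times> 'v edge stream"
  proof (induction k)
    case (Suc k)
    have "(shift Minus ^^ Suc k) y = (shift Minus ^^ k) (shift Minus y)" for y :: "'v edge stream \<times> 'v edge stream"
      by (simp only: funpow_Suc_right o_apply)
    then show ?case using Suc by (simp add: shift_Minus_Plus del: funpow.simps(2)) (simp add: shift_Minus_Plus)
  qed simp
  then show ?thesis using shift_Plus_periodic[OF assms, of k] by metis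
qed

lemma closed_path_rotate: "closed_path G c \<Longrightarrow> closed_path G (rotate k c)"
proof -
  assume c: "closed_path G c"
  then have "sdrop (k mod length c) (cycle c) \<in> sft_paths E follows"
    unfolding closed_path_iff by (intro sft_paths_sdrop) simp
  then have "cycle (rotate k c) \<in> sft_paths E follows"
    using closed_path_ne[OF c] by (simp add: sdrop_cycle rotate_conv_mod[of k] del: sdrop_simps)
  then show ?thesis using closed_path_ne[OF c] unfolding closed_path_iff by simp
qed

lemma bij_rotate_closed_paths: "bij_betw (rotate k) (closed_paths m) (closed_paths m)"
proof -
  have "inj_on (rotate k) (closed_paths m)"
    by (rule inj_on_subset[OF inj_fn[OF inj_rotate1, folded rotate_def] subset_UNIV])
  moreover have "rotate k ` closed_paths m \<subseteq> closed_paths m" using closed_path_rotate by (auto simp: closed_paths_def)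
  ultimately show ?thesis using finite_closed_paths by (simp add: bij_betw_def endo_inj_surj)
qed

lemma periodic_in_paths:
  assumes "closed_path G c"
  shows "periodic_path c \<in> paths G"
proof -
  have ne: "c \<noteq> []" by (rule closed_path_ne[OF assms])
  have 1: "cycle c \<in> half_paths G Plus" "cycle (rev c) \<in> half_paths G Minus"
    using assms cycle_rev_side[OF ne] unfolding half_paths_sft closed_path_iff by (auto simp: side_rel_def[abs_def])
  have "follows (last c) (hd c)" using assms by (simp add: closed_path_def)
  then show ?thesis using 1 ne by (simp add: paths_def periodic_path_def hd_rev)
qed

text \<open>Shifting a periodic chain rotates its closed path, and rotation permutes the closed
  paths of length \<open>m\<close>. The \<open>k\<close> shifts of the reduction are thus invisible
  in the sum.\<close>

lemma sum_closed_paths_reduction: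
  assumes red: "is_reduction G \<epsilon> f k g" and m: "m \<ge> 1"
  shows "(\<Sum>c\<in>closed_paths m. f (periodic_path c)) = (\<Sum>u\<in>{u \<in> half_paths G \<epsilon>. sdrop m u = u}. g u)"
proof -
  have ne: "c \<noteq> []" if "c \<in> closed_paths m" for c using that closed_path_ne by (auto simp: closed_paths_def)
  have "(\<Sum>c\<in>closed_paths m. f (periodic_path c)) = (\<Sum>c\<in>closed_paths m. f ((shift \<epsilon> ^^ k) (periodic_path c)))"
  proof (cases \<epsilon>)
    case Plus
    have "(\<Sum>c\<in>closed_paths m. f (periodic_path c)) = (\<Sum>c\<in>closed_paths m. f (periodic_path (rotate k c)))"
      by (rule sum.reindex_bij_betw[OF bij_rotate_closed_paths, symmetric])
    then show ?thesis unfolding Plus using shift_Plus_periodic[OF ne] by simp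
  next
    case Minus
    have "(\<Sum>c\<in>closed_paths m. f ((shift Minus ^^ k) (periodic_path c))) =
       (\<Sum>c\<in>closed_paths m. f ((shift Minus ^^ k) (periodic_path (rotate k c))))"
      by (rule sum.reindex_bij_betw[OF bij_rotate_closed_paths, symmetric])
    then show ?thesis unfolding Minus using shift_Minus_periodic[OF ne] by simp
  qed
  also have "\<dots> = (\<Sum>c\<in>closed_paths m. g (half \<epsilon> (periodic_path c)))"
    using red periodic_in_paths unfolding is_reduction_def closed_paths_def by (intro sum.cong) auto
  also have "\<dots> = (\<Sum>u\<in>{u \<in> half_paths G \<epsilon>. sdrop m u = u}. g u)"
    by (rule sum.reindex_bij_betw[OF bij_half_periodic[OF m]])
  finally show ?thesis .
qed

subsection \<open>Primitive closed paths\<close>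

text \<open>The least period of the stream divides \<open>length c\<close>, because the remainder of
  the division would be a smaller period.\<close>

lemma least_period:
  assumes c: "closed_path G c"
  obtains c' where "closed_path G c'" "cycle c' = cycle c" "length c' \<le> length c"
    "c = concat (replicate (length c div length c') c')"
    "\<And>e. 0 < e \<Longrightarrow> sdrop e (cycle c) = cycle c \<Longrightarrow> length c' \<le> e"
proof -
  have ne: "c \<noteq> []" by (rule closed_path_ne[OF c])
  have per: "sdrop (length c) (cycle c) = cycle c" by (rule sdrop_cycle_eq[OF ne])
  define e where "e = (LEAST e. 0 < e \<and> sdrop e (cycle c) = cycle c)"
  have e: "0 < e" "sdrop e (cycle c) = cycle c"
    using LeastI[of "\<lambda>e. 0 < e \<and> sdrop e (cycle c) = cycle c" "length c"] per ne unfolding e_def by auto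
  have le: "e \<le> e'" if "0 < e'" "sdrop e' (cycle c) = cycle c" for e'
    unfolding e_def using that by (intro Least_le) simp
  have md: "length c mod e = 0"
    using le[OF _ sdrop_mod_period[OF per e(2)]] mod_less_divisor[OF e(1), of "length c"] by fastforce
  define c' where "c' = stake e (cycle c)"
  have c': "cycle c' = cycle c" "c' \<noteq> []" "length c' = e"
    unfolding c'_def using cycle_stake_period[OF e(2)] e(1) by auto
  have "c = stake (length c) (cycle c')" unfolding c'(1) using ne by simp
  then have "c = concat (replicate (length c div length c') c')"
    using stake_cycle_eq_mod_0[OF c'(2), of "length c"] c'(3) md by simp
  moreover have "closed_path G c'" using c c' unfolding closed_path_iff by simp
  ultimately show thesis using that[of c'] c' le per ne by simp
qed

text \<open>Turns the condition on repetitions of lists into one on periods of the stream, which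
  behaves well under rotation.\<close>

lemma primitive_path_iff:
  "primitive_path G c \<longleftrightarrow> closed_path G c \<and> (\<forall>e. 0 < e \<and> e < length c \<longrightarrow> sdrop e (cycle c) \<noteq> cycle c)"
proof (cases "closed_path G c")
  case c: True
  have ne: "c \<noteq> []" by (rule closed_path_ne[OF c])
  have "(\<exists>c' m. closed_path G c' \<and> length c' < length c \<and> c = concat (replicate m c')) \<longleftrightarrow>
     (\<exists>e. 0 < e \<and> e < length c \<and> sdrop e (cycle c) = cycle c)"
  proof
    assume "\<exists>c' m. closed_path G c' \<and> length c' < length c \<and> c = concat (replicate m c')"
    then obtain c' m where c': "closed_path G c'" "length c' < length c" "c = concat (replicate m c')" by blast
    have ne': "c' \<noteq> []" by (rule closed_path_ne[OF c'(1)])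
    have "m \<ge> 1" using c'(3) ne by (cases m) auto
    then have "cycle c = cycle c'" unfolding c'(3) by (rule cycle_concat_replicate[OF ne'])
    then have "sdrop (length c') (cycle c) = cycle c" using sdrop_cycle_eq[OF ne'] by simp
    then show "\<exists>e. 0 < e \<and> e < length c \<and> sdrop e (cycle c) = cycle c" using c'(2) ne' by blast
  next
    assume "\<exists>e. 0 < e \<and> e < length c \<and> sdrop e (cycle c) = cycle c"
    then obtain e where e: "0 < e" "e < length c" "sdrop e (cycle c) = cycle c" by blast
    obtain c' where c': "closed_path G c'" "c = concat (replicate (length c div length c') c')"
      "\<And>e. 0 < e \<Longrightarrow> sdrop e (cycle c) = cycle c \<Longrightarrow> length c' \<le> e"
      by (rule least_period[OF c], rule that)
    have "length c' < length c" using c'(3)[OF e(1,3)] e(2) by simp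
    then show "\<exists>c' m. closed_path G c' \<and> length c' < length c \<and> c = concat (replicate m c')"
      using c'(1,2) by blast
  qed
  then show ?thesis using c unfolding primitive_path_def by blast
qed (simp add: primitive_path_def)

lemma primitive_closed: "primitive_path G c \<Longrightarrow> closed_path G c"
  by (simp add: primitive_path_def)

lemma primitive_unique:
  assumes "primitive_path G c" "primitive_path G c'" "cycle c = cycle c'"
  shows "c = c'"
proof -
  have ne: "c \<noteq> []" "c' \<noteq> []" using assms primitive_closed closed_path_ne by auto
  have "\<not> length c < length c'"
    using assms(2,3) ne sdrop_cycle_eq[OF ne(1)] unfolding primitive_path_iff by (metis length_greater_0_conv)
  moreover have "\<not> length c' < length c"
    using assms(1,3) ne sdrop_cycle_eq[OF ne(2)] unfolding primitive_path_iff by (metis length_greater_0_conv)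
  ultimately have "length c = length c'" by simp
  then show ?thesis using stake_cycle_eq[OF ne(1)] stake_cycle_eq[OF ne(2)] assms(3) by metis
qed

definition power_path :: "'v edge list \<times> nat \<Rightarrow> 'v edge list" where
  "power_path = (\<lambda>(c, m). concat (replicate m c))"

lemma length_power_path: "length (power_path (c, m)) = m * length c"
  unfolding power_path_def by (induction m) auto

lemma cycle_power_path: "c \<noteq> [] \<Longrightarrow> m \<ge> 1 \<Longrightarrow> cycle (power_path (c, m)) = cycle c"
  unfolding power_path_def by (simp add: cycle_concat_replicate)

lemma periodic_power_path:
  assumes "c \<noteq> []" "m \<ge> 1"
  shows "periodic_path (power_path (c, m)) = periodic_path c"
proof -
  have "rev (concat (replicate m c)) = concat (replicate m (rev c))"
    by (simp add: rev_concat rev_map[symmetric] map_replicate)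
  then show ?thesis using assms cycle_concat_replicate[of c m] cycle_concat_replicate[of "rev c" m]
    unfolding periodic_path_def power_path_def by simp
qed

text \<open>The least period supplies the primitive root. It is unique because root and power
  generate the same stream, and the length then fixes the exponent.\<close>

lemma bij_power_path: "bij_betw power_path ({c. primitive_path G c} \<times> {1..}) {c. closed_path G c}"
  unfolding bij_betw_def
proof (intro conjI equalityI subsetI inj_onI)
  fix x y assume x: "x \<in> {c. primitive_path G c} \<times> {1..}" and y: "y \<in> {c. primitive_path G c} \<times> {1..}"
    and eq: "power_path x = power_path y"
  obtain c m c' m' where xy: "x = (c, m)" "y = (c', m')" by (cases x, cases y) auto
  have c: "primitive_path G c" "primitive_path G c'" "m \<ge> 1" "m' \<ge> 1" using x y xy by auto
  have ne: "c \<noteq> []" "c' \<noteq> []" using c primitive_closed closed_path_ne by auto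
  have "cycle c = cycle c'" using eq cycle_power_path ne c xy by metis
  then have cc: "c = c'" by (rule primitive_unique[OF c(1,2)])
  have "m * length c = m' * length c'" using eq length_power_path xy by metis
  then show "x = y" using cc ne xy by simp
next
  fix c assume "c \<in> power_path ` ({c. primitive_path G c} \<times> {1..})"
  then obtain c' m where c': "c = power_path (c', m)" "primitive_path G c'" "m \<ge> 1" by auto
  have "closed_path G c'" using c' primitive_closed by blast
  then have "closed_path G c" unfolding c'(1) closed_path_iff using c'(3) cycle_power_path
    by (auto simp: power_path_def)
  then show "c \<in> {c. closed_path G c}" by simp
next
  fix c assume "c \<in> {c. closed_path G c}"
  then have c: "closed_path G c" by simp
  obtain c' where c': "closed_path G c'" "cycle c' = cycle c" "length c' \<le> length c"
    "c = concat (replicate (length c div length c') c')"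
    "\<And>e. 0 < e \<Longrightarrow> sdrop e (cycle c) = cycle c \<Longrightarrow> length c' \<le> e"
    by (rule least_period[OF c], rule that)
  have "primitive_path G c'" using c'(1,5) unfolding primitive_path_iff c'(2) by (meson leD)
  moreover have "length c div length c' \<ge> 1"
    using c'(3) closed_path_ne[OF c'(1)] by (simp add: Suc_le_eq div_greater_zero_iff)
  ultimately show "c \<in> power_path ` ({c. primitive_path G c} \<times> {1..})"
    using c'(4) by (intro image_eqI[of _ _ "(c', length c div length c')"]) (simp_all add: power_path_def)
qed

abbreviation rotations :: "'v edge list \<Rightarrow> 'v edge list set" where
  "rotations c \<equiv> {rotate k c | k. True}"

lemma primitive_rotate:
  assumes "primitive_path G c"
  shows "primitive_path G (rotate k c)"
  unfolding primitive_path_iff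
proof (intro conjI allI impI notI)
  have c: "closed_path G c" by (rule primitive_closed[OF assms])
  then have ne: "c \<noteq> []" by (rule closed_path_ne)
  show "closed_path G (rotate k c)" by (rule closed_path_rotate[OF c])
  fix e assume e: "0 < e \<and> e < length (rotate k c)" and eq: "sdrop e (cycle (rotate k c)) = cycle (rotate k c)"
  define j where "j = k mod length c"
  have jl: "j < length c" using ne by (simp add: j_def)
  have rot: "cycle (rotate k c) = sdrop j (cycle c)"
    using sdrop_cycle[OF ne, of j] jl by (simp add: j_def rotate_conv_mod[of k] del: sdrop_simps)
  have per: "sdrop (length c) (cycle c) = cycle c" by (rule sdrop_cycle_eq[OF ne])
  have "cycle c = sdrop (length c - j) (sdrop j (cycle c))" using jl per by simp
  also have "\<dots> = sdrop (length c - j) (sdrop e (sdrop j (cycle c)))" using eq rot by simp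
  also have "\<dots> = sdrop e (sdrop (length c) (cycle c))" using jl by (simp add: add.commute)
  also have "\<dots> = sdrop e (cycle c)" by (simp only: per)
  finally have "sdrop e (cycle c) = cycle c" ..
  then show False using assms e unfolding primitive_path_iff by simp
qed

text \<open>Two equal rotations would give a period below \<open>length c\<close>. Hence a class has
  exactly \<open>length c\<close> members, matching the number of shifts in a zeta term.\<close>

lemma inj_rotations:
  assumes "primitive_path G c"
  shows "inj_on (\<lambda>k. rotate k c) {..<length c}"
proof -
  have ne: "c \<noteq> []" using assms primitive_closed closed_path_ne by blast
  have per: "sdrop (length c) (cycle c) = cycle c" by (rule sdrop_cycle_eq[OF ne])
  have "False" if "k < j" "j < length c" "rotate k c = rotate j c" for k j
  proof -
    have "sdrop k (cycle c) = sdrop j (cycle c)"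
      using sdrop_cycle[OF ne, of k] sdrop_cycle[OF ne, of j] that by simp
    then have "sdrop (length c - k) (sdrop k (cycle c)) = sdrop (length c - k) (sdrop j (cycle c))" by simp
    moreover have "j + (length c - k) = length c + (j - k)" using that by simp
    ultimately have "sdrop (length c) (cycle c) = sdrop (j - k) (sdrop (length c) (cycle c))"
      using that unfolding sdrop_add by simp
    then have "sdrop (j - k) (cycle c) = cycle c" unfolding per by simp
    moreover have "0 < j - k" "j - k < length c" using that by auto
    ultimately show False using assms unfolding primitive_path_iff by blast
  qed
  then show ?thesis by (intro inj_onI) (metis lessThan_iff linorder_neqE_nat)
qed

lemma rotations_eq: "c \<noteq> [] \<Longrightarrow> rotations c = (\<lambda>k. rotate k c) ` {..<length c}"
  using rotate_conv_mod[of _ c] by (auto simp: image_iff) (metis lessThan_iff length_greater_0_conv mod_less_divisor)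

lemma primitive_cycles_eq: "primitive_cycles G = rotations ` {c. primitive_path G c}"
proof -
  have "{(c, rotate k c) |c k. primitive_path G c} `` {c} = rotations c" if "primitive_path G c" for c
    using that by auto
  then show ?thesis unfolding primitive_cycles_def quotient_def by auto
qed

lemma rotations_rotate:
  assumes "c' \<in> rotations c"
  shows "rotations c' = rotations c"
proof -
  have sub: "rotations (rotate k c) \<subseteq> rotations c" for k c :: "_"
    by (auto simp: rotate_rotate)
  obtain k where k: "c' = rotate k c" using assms by blast
  \<comment> \<open>The inverse rotation with a natural exponent: adding \<open>k\<close> gives a
    multiple of the length.\<close>
  have "c = rotate (length c * k - k) c'" if "c \<noteq> []"
  proof -
    have "length c * k - k + k = length c * k" using that by (cases "length c") auto
    then show ?thesis unfolding k rotate_rotate by (simp add: rotate_conv_mod[of "length c * k"])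
  qed
  then have "c \<in> rotations c'" using k by (cases "c = []") auto
  then obtain j where "c = rotate j c'" by blast
  then show ?thesis using sub[of j c'] sub[of k c] k by auto
qed

text \<open>The rotation classes partition the primitive paths, so a sum over classes may be
  replaced by a sum over primitive paths.\<close>

lemma bij_snd_cycles: "bij_betw snd (Sigma (primitive_cycles G) (\<lambda>C. C)) {c. primitive_path G c}"
proof (rule bij_betwI[where g = "\<lambda>c. (rotations c, c)"])
  have self: "c \<in> rotations c" for c :: "'v edge list" by (auto intro: exI[of _ 0])
  show "snd \<in> Sigma (primitive_cycles G) (\<lambda>C. C) \<rightarrow> {c. primitive_path G c}"
    unfolding primitive_cycles_eq using primitive_rotate by auto
  show "(\<lambda>c. (rotations c, c)) \<in> {c. primitive_path G c} \<rightarrow> Sigma (primitive_cycles G) (\<lambda>C. C)"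
    unfolding primitive_cycles_eq using self by blast
  show "(rotations (snd x), snd x) = x" if "x \<in> Sigma (primitive_cycles G) (\<lambda>C. C)" for x
  proof -
    obtain C c where x: "x = (C, c)" "C \<in> primitive_cycles G" "c \<in> C" using \<open>x \<in> _\<close> by auto
    then obtain c0 where "C = rotations c0" unfolding primitive_cycles_eq by blast
    then have "rotations c = C" using rotations_rotate[of c c0] x(3) by simp
    then show ?thesis using x(1) by simp
  qed
qed simp

end

subsection \<open>The zeta function as a power series\<close>

text \<open>On the connected half-plane the meromorphic difference is either zero or nonzero off a
  sparse set, and it vanishes on an open part. Only agreement on a punctured neighbourhood can be
  expected, which is all that poles and residues depend on.\<close>

lemma zeta_continuation_unique:
  assumes q: "q > 1" and \<theta>: "0 < \<theta>" "\<theta> < 1" and s0: "s0 \<in> half_plane q \<theta>"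
    and Z: "Z meromorphic_on half_plane q \<theta>" "Z' meromorphic_on half_plane q \<theta>"
    and eq: "\<And>s. Im s > 3/2 \<Longrightarrow> Z s = Z' s"
  shows "\<forall>\<^sub>F s in at s0. Z s = Z' s"
proof -
  let ?H = "half_plane q \<theta>"
  have H: "open ?H" "topological_space_class.connected ?H" unfolding half_plane_def
    by (intro open_halfspace_Im_gt, intro convex_connected convex_halfspace_Im_gt)
  have "ln \<theta> / ln (real q) < 0" using q \<theta> by (simp add: divide_less_0_iff)
  \<comment> \<open>A point with imaginary part above \<open>3/2\<close>; it lies in the half-plane
    because \<open>ln \<theta>\<close> is negative.\<close>
  define s1 where "s1 = Complex 0 2"
  have s1: "s1 \<in> ?H" using \<open>ln \<theta> / ln (real q) < 0\<close> by (simp add: half_plane_def s1_def)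
  have "(\<lambda>s. Z s - Z' s) meromorphic_on ?H" by (intro meromorphic_on_diff Z)
  then consider "\<forall>\<^sub>F s in cosparse ?H. Z s - Z' s = 0" | "\<forall>\<^sub>F s in cosparse ?H. Z s - Z' s \<noteq> 0"
    using meromorphic_imp_constant_or_avoid[OF _ H, of "\<lambda>s. Z s - Z' s" 0] by blast
  then show ?thesis
  proof cases
    case 1
    then have "\<forall>\<^sub>F s in at s0. Z s - Z' s = 0" using eventually_cosparse_open_eq[OF H(1)] s0 by blast
    then show ?thesis by simp
  next
    case 2
    then have "\<forall>\<^sub>F s in at s1. Z s - Z' s \<noteq> 0" using eventually_cosparse_open_eq[OF H(1)] s1 by blast
    moreover have "\<forall>\<^sub>F s in at s1. s \<in> {s. Im s > 3/2}"
      by (rule eventually_at_in_open'[OF open_halfspace_Im_gt]) (simp add: s1_def)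
    ultimately have "\<forall>\<^sub>F s in at s1. False" by eventually_elim (use eq in auto)
    then show ?thesis by simp
  qed
qed

context regular_graph
begin

lemma sft_resolvent_exists:
  assumes "n \<ge> 1" "0 < \<theta>" "\<theta> < 1"
  obtains adj d where "sft_resolvent E (side_rel \<epsilon>) q n \<theta> adj d"
proof -
  interpret sft E "side_rel \<epsilon>" q by (rule sft)
  interpret sft_cylinder E "side_rel \<epsilon>" q n \<theta> using assms by unfold_locales
  obtain adj d where "d \<noteq> 0"
    "\<And>x i j. i \<in> W \<Longrightarrow> j \<in> W \<Longrightarrow>
       x * poly (adj i j) x - (\<Sum>k\<in>W. T i k * poly (adj k j) x) = (if i = j then poly d x else 0)"
    "\<And>x i j. i \<in> W \<Longrightarrow> j \<in> W \<Longrightarrow>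
       x * poly (adj i j) x - (\<Sum>k\<in>W. poly (adj i k) x * T k j) = (if i = j then poly d x else 0)"
    "\<And>x. poly d x = 0 \<Longrightarrow> \<exists>v. (\<exists>i\<in>W. v i \<noteq> 0) \<and> (\<forall>i\<in>W. (\<Sum>k\<in>W. T i k * v k) = x * v i)"
    by (rule matrix_resolvent_polynomials[OF finite_W, of T], rule that)
  then have "sft_resolvent E (side_rel \<epsilon>) q n \<theta> adj d" by unfold_locales
  then show thesis by (rule that)
qed

lemma card_closed_paths: "\<exists>K. \<forall>m. real (card (closed_paths m)) \<le> K * real q ^ m"
proof -
  \<comment> \<open>The count involves neither a function \<open>g\<close> nor
    \<open>\<theta>\<close>, so \<open>n = 1\<close> and \<open>\<theta> = 1/2\<close> are arbitrary
    admissible choices.\<close>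
  obtain adj d where R: "sft_resolvent E (side_rel Plus) q 1 (1/2) adj d"
    by (rule sft_resolvent_exists[of 1 "1/2" Plus]) auto
  interpret sft_resolvent E "side_rel Plus" q 1 "1/2" adj d by (rule R)
  have "real (card (closed_paths m)) \<le> real (card W) * real q ^ m" for m
  proof (cases "m = 0")
    case True
    then have "closed_paths m = {}" using closed_path_ne by (auto simp: closed_paths_def)
    then show ?thesis by simp
  next
    case False
    have "card (closed_paths m) = card {u \<in> half_paths G Plus. sdrop m u = u}"
      using bij_betw_same_card[OF bij_half_periodic[of m Plus]] False by simp
    also have "\<dots> \<le> card W * q ^ m" using card_periodic[of m] False unfolding half_paths_sft by simp
    finally have "real (card (closed_paths m)) \<le> real (card W * q ^ m)" by (simp only: of_nat_le_iff)
    then show ?thesis by simp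
  qed
  then show ?thesis by blast
qed

lemma loc_const_bounded:
  assumes "f \<in> loc_const G"
  obtains B where "\<And>p. p \<in> paths G \<Longrightarrow> norm (f p) \<le> B"
proof -
  obtain k where k: "\<forall>p\<in>paths G. \<forall>p'\<in>paths G.
     stake k (fst p) = stake k (fst p') \<and> stake k (snd p) = stake k (snd p') \<longrightarrow> f p = f p'"
    using assms unfolding loc_const_def by blast
  define w where "w p = (stake k (fst p), stake k (snd p))" for p :: "'v edge stream \<times> 'v edge stream"
  have kw: "f p = f p'" if "p \<in> paths G" "p' \<in> paths G" "w p = w p'" for p p'
  proof -
    have "stake k (fst p) = stake k (fst p') \<and> stake k (snd p) = stake k (snd p')" using that(3) by (simp add: w_def)
    then show ?thesis using k that(1,2) by blast
  qed
  define h where "h x = f (SOME p. p \<in> paths G \<and> w p = x)" for x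
  let ?X = "{xs. set xs \<subseteq> E \<and> length xs = k}"
  have "w ` paths G \<subseteq> ?X \<times> ?X"
  proof
    fix x assume "x \<in> w ` paths G"
    then obtain p where p: "p \<in> paths G" "x = w p" by blast
    then have "fst p \<in> half_paths G Plus" "snd p \<in> half_paths G Minus" by (auto simp: paths_def)
    then have "set (stake k (fst p)) \<subseteq> E" "set (stake k (snd p)) \<subseteq> E"
      unfolding half_paths_sft by (auto dest: subsetD[OF set_stake_sft_paths])
    then show "x \<in> ?X \<times> ?X" using p(2) by (simp add: w_def)
  qed
  then have fin: "finite (h ` w ` paths G)"
    using finite_lists_length_eq[OF finite_E, of k] by (meson finite_SigmaI finite_imageI finite_subset)
  have "f p = h (w p)" if p: "p \<in> paths G" for p
  proof -
    have "\<exists>p'. p' \<in> paths G \<and> w p' = w p" using p by blast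
    then have "(SOME p'. p' \<in> paths G \<and> w p' = w p) \<in> paths G \<and> w (SOME p'. p' \<in> paths G \<and> w p' = w p) = w p"
      by (rule someI_ex)
    then have "f (SOME p'. p' \<in> paths G \<and> w p' = w p) = f p" using kw[OF _ p] by blast
    then show ?thesis unfolding h_def by simp
  qed
  then have "norm (f p) \<le> (\<Sum>y\<in>h ` w ` paths G. norm y)" if "p \<in> paths G" for p
    using that fin by (intro member_le_sum[where f = norm]) auto
  then show thesis by (rule that)
qed

text \<open>\<open>f\<close> is evaluated at one base point only; the sum over shifts in the zeta
  function is recovered by summing over rotations.\<close>

definition path_weight :: "('v edge stream \<times> 'v edge stream \<Rightarrow> complex) \<Rightarrow> complex \<Rightarrow> 'v edge list \<Rightarrow> complex" where
  "path_weight f z c = z ^ length c * f (periodic_path c)"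

text \<open>There are at most a constant times \<open>q ^ m\<close> closed paths of length
  \<open>m\<close> and \<open>f\<close> is bounded, so a geometric series of ratio
  \<open>norm z * q\<close> dominates. This is the origin of the abscissa
  \<open>3/2\<close>.\<close>

lemma path_weight_abs_summable:
  assumes f: "f \<in> loc_const G" and z: "norm z * q < 1"
  shows "(\<lambda>c. norm (path_weight f z c)) summable_on {c. closed_path G c}"
proof -
  obtain B where B: "\<And>p. p \<in> paths G \<Longrightarrow> norm (f p) \<le> B" using loc_const_bounded[OF f] by blast
  obtain K where K: "\<And>m. real (card (closed_paths m)) \<le> K * real q ^ m" using card_closed_paths by blast
  define D where "D = \<bar>K\<bar> * \<bar>B\<bar>"
  have D: "D \<ge> 0" by (simp add: D_def)
  have sm: "summable (\<lambda>m. D * (norm z * q) ^ m)" using z by (intro summable_mult summable_geometric) simp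
  have closed_paths_bound: "(\<Sum>c\<in>closed_paths m. norm (path_weight f z c)) \<le> D * (norm z * q) ^ m" for m
  proof -
    have "(\<Sum>c\<in>closed_paths m. norm (path_weight f z c)) \<le> (\<Sum>c\<in>closed_paths m. norm z ^ m * \<bar>B\<bar>)"
    proof (rule sum_mono)
      fix c assume "c \<in> closed_paths m"
      then have "closed_path G c" "length c = m" by (auto simp: closed_paths_def)
      then show "norm (path_weight f z c) \<le> norm z ^ m * \<bar>B\<bar>"
        using B[OF periodic_in_paths] unfolding path_weight_def norm_mult norm_power
        by (auto intro!: mult_left_mono order_trans[OF _ abs_ge_self])
    qed
    also have "\<dots> = real (card (closed_paths m)) * (norm z ^ m * \<bar>B\<bar>)" by simp
    also have "\<dots> \<le> (\<bar>K\<bar> * real q ^ m) * (norm z ^ m * \<bar>B\<bar>)"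
      by (intro mult_right_mono order_trans[OF K]) auto
    also have "\<dots> = D * (norm z * q) ^ m" by (simp add: D_def power_mult_distrib)
    finally show ?thesis .
  qed
  show ?thesis
  proof (rule nonneg_bdd_above_summable_on)
    show "bdd_above (sum (\<lambda>c. norm (path_weight f z c)) ` {F. F \<subseteq> {c. closed_path G c} \<and> finite F})"
    proof (rule bdd_aboveI2)
      fix F assume F: "F \<in> {F. F \<subseteq> {c. closed_path G c} \<and> finite F}"
      define k where "k = Suc (Max (insert 0 (length ` F)))"
      have "length c < k" if "c \<in> F" for c
        using that F unfolding k_def by (intro le_imp_less_Suc Max_ge) auto
      then have "F \<subseteq> (\<Union>m<k. closed_paths m)" using F by (auto simp: closed_paths_def)
      then have "(\<Sum>c\<in>F. norm (path_weight f z c)) \<le> (\<Sum>c\<in>(\<Union>m<k. closed_paths m). norm (path_weight f z c))"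
        using finite_closed_paths by (intro sum_mono2) auto
      also have "\<dots> = (\<Sum>m<k. \<Sum>c\<in>closed_paths m. norm (path_weight f z c))"
        using finite_closed_paths by (intro sum.UNION_disjoint) (auto simp: closed_paths_def)
      also have "\<dots> \<le> (\<Sum>m<k. D * (norm z * q) ^ m)" by (intro sum_mono closed_paths_bound)
      also have "\<dots> \<le> (\<Sum>m. D * (norm z * q) ^ m)" using D by (intro sum_le_suminf sm) auto
      finally show "(\<Sum>c\<in>F. norm (path_weight f z c)) \<le> (\<Sum>m. D * (norm z * q) ^ m)" .
    qed
  qed simp
qed

lemma path_weight_sums:
  assumes f: "f \<in> loc_const G" and z: "norm z * q < 1"
  shows "(\<lambda>m. z ^ m * (\<Sum>c\<in>closed_paths m. f (periodic_path c))) sums infsum (path_weight f z) {c. closed_path G c}"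
proof -
  have bij: "bij_betw snd (Sigma UNIV closed_paths) {c. closed_path G c}"
    by (rule bij_betwI[where g = "\<lambda>c. (length c, c)"]) (auto simp: closed_paths_def)
  have "path_weight f z summable_on {c. closed_path G c}" by (rule abs_summable_summable[OF path_weight_abs_summable[OF f z]])
  then have "(\<lambda>x. path_weight f z (snd x)) summable_on Sigma UNIV closed_paths" using summable_on_reindex_bij_betw[OF bij] by blast
  then have S: "(\<lambda>(m, c). path_weight f z c) summable_on Sigma UNIV closed_paths" by (simp add: case_prod_unfold)
  have "infsum (path_weight f z) {c. closed_path G c} = infsum (\<lambda>(m, c). path_weight f z c) (Sigma UNIV closed_paths)"
    using infsum_reindex_bij_betw[OF bij, of "path_weight f z"] by (simp add: case_prod_unfold)
  also have "\<dots> = infsum (\<lambda>m. infsum (path_weight f z) (closed_paths m)) UNIV"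
    by (rule infsum_Sigma'_banach[OF S, symmetric])
  finally have eq: "infsum (path_weight f z) {c. closed_path G c} = infsum (\<lambda>m. infsum (path_weight f z) (closed_paths m)) UNIV" .
  have "(\<lambda>m. infsum (path_weight f z) (closed_paths m)) summable_on UNIV"
    by (rule summable_on_Sigma_banach[OF S])
  then have "(\<lambda>m. infsum (path_weight f z) (closed_paths m)) sums infsum (path_weight f z) {c. closed_path G c}"
    unfolding eq by (intro has_sum_imp_sums has_sum_infsum)
  moreover have "infsum (path_weight f z) (closed_paths m) = z ^ m * (\<Sum>c\<in>closed_paths m. f (periodic_path c))" for m
    using finite_closed_paths by (auto simp: path_weight_def closed_paths_def sum_distrib_left intro!: sum.cong)
  ultimately show ?thesis by simp
qed

definition primitive_weight :: "('v edge stream \<times> 'v edge stream \<Rightarrow> complex) \<Rightarrow> complex \<Rightarrow> 'v edge list \<Rightarrow> complex" where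
  "primitive_weight f z c = z ^ length c / (1 - z ^ length c) * f (periodic_path c)"

text \<open>Repeating \<open>c\<close> leaves its periodic chain unchanged and multiplies its
  length: a geometric series in \<open>z ^ length c\<close>, starting with exponent 1.\<close>

lemma primitive_weight_has_sum:
  assumes z: "norm z < 1" and c: "primitive_path G c"
  shows "((\<lambda>m. path_weight f z (power_path (c, m))) has_sum primitive_weight f z c) {1..}"
proof -
  have ne: "c \<noteq> []" using c primitive_closed closed_path_ne by blast
  let ?w = "z ^ length c"
  have w: "norm ?w < 1" using z ne by (simp add: norm_power power_less_one_iff)
  have "((\<lambda>m. ?w ^ Suc m * f (periodic_path c)) has_sum (?w * (1 / (1 - ?w)) * f (periodic_path c))) UNIV"
  proof (rule norm_summable_imp_has_sum)
    show "summable (\<lambda>m. norm (?w ^ Suc m * f (periodic_path c)))"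
      unfolding norm_mult norm_power[of ?w] power_Suc using w by (intro summable_mult2 summable_mult summable_geometric) simp
    have "(\<lambda>m. ?w * ?w ^ m * f (periodic_path c)) sums (?w * (1 / (1 - ?w)) * f (periodic_path c))"
      by (intro sums_mult2 sums_mult geometric_sums w)
    then show "(\<lambda>m. ?w ^ Suc m * f (periodic_path c)) sums (?w * (1 / (1 - ?w)) * f (periodic_path c))" by simp
  qed
  then have "((\<lambda>m. path_weight f z (power_path (c, m))) \<circ> Suc has_sum primitive_weight f z c) UNIV"
    using ne by (simp add: o_def path_weight_def primitive_weight_def length_power_path periodic_power_path power_mult[symmetric] mult.commute power_add)
  then have "((\<lambda>m. path_weight f z (power_path (c, m))) has_sum primitive_weight f z c) (range Suc)"
    by (subst has_sum_reindex) auto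
  moreover have "range Suc = {1..}" by (auto simp: image_iff Suc_le_eq gr0_conv_Suc)
  ultimately show ?thesis by simp
qed

lemma norm_lt_1: "norm (z :: complex) * q < 1 \<Longrightarrow> norm z < 1"
proof -
  assume "norm z * q < 1"
  moreover have "norm z * 1 \<le> norm z * q" using q by (intro mult_left_mono) auto
  ultimately show ?thesis by linarith
qed

lemma primitive_weight_summable:
  assumes f: "f \<in> loc_const G" and z: "norm z * q < 1"
  shows "(\<lambda>c. norm (primitive_weight f z c)) summable_on {c. primitive_path G c}"
    "infsum (primitive_weight f z) {c. primitive_path G c} = infsum (path_weight f z) {c. closed_path G c}"
proof -
  let ?p = "{c. primitive_path G c}"
  note z1 = norm_lt_1[OF z]
  have abs: "(\<lambda>(c, m). norm (path_weight f z (power_path (c, m)))) summable_on (?p \<times> {1..})"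
    using summable_on_reindex_bij_betw[OF bij_power_path, of "\<lambda>c. norm (path_weight f z c)"] path_weight_abs_summable[OF f z]
    by (simp add: case_prod_unfold)
  then have S: "(\<lambda>(c, m). path_weight f z (power_path (c, m))) summable_on (?p \<times> {1..})"
    using abs_summable_summable[of "\<lambda>(c, m). path_weight f z (power_path (c, m))" "?p \<times> {1..}"] by (simp add: case_prod_unfold)
  have inner: "infsum (\<lambda>m. path_weight f z (power_path (c, m))) {1..} = primitive_weight f z c" if "c \<in> ?p" for c
    using primitive_weight_has_sum[OF z1, of c f] that by (simp add: infsumI)
  have "infsum (path_weight f z) {c. closed_path G c} = infsum (\<lambda>(c, m). path_weight f z (power_path (c, m))) (?p \<times> {1..})"
    using infsum_reindex_bij_betw[OF bij_power_path, of "path_weight f z"] by (simp add: case_prod_unfold)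
  also have "\<dots> = infsum (\<lambda>c. infsum (\<lambda>m. path_weight f z (power_path (c, m))) {1..}) ?p"
    by (rule infsum_Sigma'_banach[OF S, symmetric])
  also have "\<dots> = infsum (primitive_weight f z) ?p" using inner by (intro infsum_cong) auto
  finally show "infsum (primitive_weight f z) ?p = infsum (path_weight f z) {c. closed_path G c}" ..
  have nS: "(\<lambda>c. infsum (\<lambda>m. norm (path_weight f z (power_path (c, m)))) {1..}) summable_on ?p"
    by (rule summable_on_Sigma_banach[OF abs])
  have sl: "(\<lambda>m. norm (path_weight f z (power_path (c, m)))) summable_on {1..}" if "c \<in> ?p" for c
  proof -
    have "(\<lambda>(c, m). norm (path_weight f z (power_path (c, m)))) summable_on (Pair c ` {1..})"
      by (rule summable_on_subset_banach[OF abs]) (use that in auto)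
    then show ?thesis by (subst (asm) summable_on_reindex) (auto simp: o_def inj_on_def)
  qed
  show "(\<lambda>c. norm (primitive_weight f z c)) summable_on ?p"
  proof (rule summable_on_comparison_test[OF nS])
    fix c assume c: "c \<in> ?p"
    show "norm (primitive_weight f z c) \<le> infsum (\<lambda>m. norm (path_weight f z (power_path (c, m)))) {1..}"
      using norm_infsum_bound[OF sl[OF c]] inner[OF c] by simp
  qed simp
qed

text \<open>Whatever representative \<open>SOME\<close> picks, its rotations run through
  \<open>C\<close> exactly once, so the sum over shifts becomes a sum over \<open>C\<close>.\<close>

lemma zeta_term_eq:
  assumes "C \<in> primitive_cycles G"
  shows "finite C" "zeta_term q f s C = (\<Sum>c\<in>C. primitive_weight f (of_nat q powr (1/2 + \<i> * s)) c)"
proof -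
  let ?z = "of_nat q powr (1/2 + \<i> * s)"
  obtain c0 where c0: "primitive_path G c0" "C = rotations c0" using assms unfolding primitive_cycles_eq by blast
  have "c0 \<in> C" unfolding c0(2) by (auto intro: exI[of _ 0])
  define c where "c = (SOME c. c \<in> C)"
  have "c \<in> C" unfolding c_def using \<open>c0 \<in> C\<close> by (rule someI)
  then have C: "C = rotations c" "primitive_path G c"
    using rotations_rotate[of c c0] primitive_rotate[OF c0(1)] unfolding c0(2) by auto
  have ne: "c \<noteq> []" using C(2) primitive_closed closed_path_ne by blast
  have img: "C = (\<lambda>k. rotate k c) ` {..<length c}" unfolding C(1) by (rule rotations_eq[OF ne])
  show "finite C" unfolding img by simp
  have w: "of_nat q powr ((1/2 + \<i> * s) * of_nat (length c)) = ?z ^ length c"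
    using q by (intro powr_of_nat_mult) simp
  have "(\<Sum>c\<in>C. primitive_weight f ?z c) = (\<Sum>k<length c. primitive_weight f ?z (rotate k c))"
    unfolding img by (simp add: sum.reindex[OF inj_rotations[OF C(2)]])
  also have "\<dots> = ?z ^ length c / (1 - ?z ^ length c) * (\<Sum>k<length c. f (periodic_path (rotate k c)))"
    by (simp add: primitive_weight_def sum_distrib_left)
  finally show "zeta_term q f s C = (\<Sum>c\<in>C. primitive_weight f ?z c)"
    unfolding zeta_term_def Let_def c_def[symmetric] w shift_Plus_periodic[OF ne] by simp
qed

lemma norm_z_lt:
  assumes "Im s > 3/2"
  shows "norm (of_nat q powr (1/2 + \<i> * s)) * q < 1"
proof -
  have "norm (eigval q s) > q" using norm_eigval_gt[OF q, of 1 s] assms by simp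
  moreover from this have "norm (eigval q s) > 0" by (rule le_less_trans[rotated]) simp
  ultimately show ?thesis unfolding powr_eq_inverse_eigval by (simp add: norm_divide)
qed

theorem zeta_absolutely_convergent:
  assumes f: "f \<in> loc_const G" and s: "Im s > 3/2"
  shows "(\<lambda>C. norm (zeta_term q f s C)) summable_on primitive_cycles G"
    "weighted_zeta G q f s = infsum (path_weight f (of_nat q powr (1/2 + \<i> * s))) {c. closed_path G c}"
proof -
  let ?z = "of_nat q powr (1/2 + \<i> * s)" and ?p = "{c. primitive_path G c}"
  note pw = primitive_weight_summable[OF f norm_z_lt[OF s]]
  have abs: "(\<lambda>(C, c). norm (primitive_weight f ?z c)) summable_on Sigma (primitive_cycles G) (\<lambda>C. C)"
    using summable_on_reindex_bij_betw[OF bij_snd_cycles, of "\<lambda>c. norm (primitive_weight f ?z c)"] pw(1)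
    by (simp add: case_prod_unfold)
  have S: "(\<lambda>(C, c). primitive_weight f ?z c) summable_on Sigma (primitive_cycles G) (\<lambda>C. C)"
    using summable_on_reindex_bij_betw[OF bij_snd_cycles, of "primitive_weight f ?z"] abs_summable_summable[OF pw(1)]
    by (simp add: case_prod_unfold)
  have nS: "(\<lambda>C. infsum (\<lambda>c. norm (primitive_weight f ?z c)) C) summable_on primitive_cycles G"
    by (rule summable_on_Sigma_banach[OF abs])
  show "(\<lambda>C. norm (zeta_term q f s C)) summable_on primitive_cycles G"
  proof (rule summable_on_comparison_test[OF nS])
    fix C assume C: "C \<in> primitive_cycles G"
    show "norm (zeta_term q f s C) \<le> infsum (\<lambda>c. norm (primitive_weight f ?z c)) C"
      using zeta_term_eq[OF C] by (simp add: norm_sum)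
  qed simp
  have "infsum (path_weight f ?z) {c. closed_path G c} = infsum (\<lambda>(C, c). primitive_weight f ?z c) (Sigma (primitive_cycles G) (\<lambda>C. C))"
    unfolding pw(2)[symmetric] using infsum_reindex_bij_betw[OF bij_snd_cycles, of "primitive_weight f ?z"] by (simp add: case_prod_unfold)
  also have "\<dots> = infsum (\<lambda>C. infsum (primitive_weight f ?z) C) (primitive_cycles G)"
    by (rule infsum_Sigma'_banach[OF S, symmetric])
  also have "\<dots> = weighted_zeta G q f s"
    unfolding weighted_zeta_def using zeta_term_eq by (intro infsum_cong) simp
  finally show "weighted_zeta G q f s = infsum (path_weight f ?z) {c. closed_path G c}" ..
qed

subsection \<open>Reductions to half-infinite paths\<close>

text \<open>Puts the half of side \<open>\<epsilon>\<close> first, so that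
  \<open>shift \<epsilon>\<close> moves a letter from \<open>u\<close> to \<open>b\<close> for
  either sign.\<close>

definition join :: "side \<Rightarrow> 'v edge stream \<Rightarrow> 'v edge stream \<Rightarrow> 'v edge stream \<times> 'v edge stream" where
  "join \<epsilon> u b = (case \<epsilon> of Plus \<Rightarrow> (u, b) | Minus \<Rightarrow> (b, u))"

lemma join_half:
  obtains b where "p = join \<epsilon> (half \<epsilon> p) b"
  by (cases \<epsilon>; cases p) (auto simp: join_def)

definition op_side :: "side \<Rightarrow> side" where
  "op_side \<epsilon> = (case \<epsilon> of Plus \<Rightarrow> Minus | Minus \<Rightarrow> Plus)"

lemma join_in_paths:
  "join \<epsilon> u b \<in> paths G \<longleftrightarrow> u \<in> half_paths G \<epsilon> \<and> b \<in> half_paths G (op_side \<epsilon>) \<and> side_rel \<epsilon> (shd b) (shd u)"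
  by (cases \<epsilon>) (auto simp: join_def paths_def op_side_def side_rel_def)

lemma shift_join: "shift \<epsilon> (join \<epsilon> u b) = join \<epsilon> (stl u) (shd u ## b)"
  by (cases \<epsilon>) (simp_all add: join_def)

lemma shift_join_in_paths:
  assumes "join \<epsilon> u b \<in> paths G"
  shows "join \<epsilon> (stl u) (shd u ## b) \<in> paths G"
proof -
  have u: "u \<in> sft_paths E (side_rel \<epsilon>)" and b: "b \<in> sft_paths E (side_rel (op_side \<epsilon>))"
    and j: "side_rel \<epsilon> (shd b) (shd u)"
    using assms unfolding join_in_paths half_paths_sft by auto
  have u0: "shd u \<in> E" "side_rel \<epsilon> (shd u) (shd (stl u))"
    using u sft_paths_Stream[of "shd u" "stl u"] by auto
  have "side_rel (op_side \<epsilon>) (shd u) (shd b)" using j by (cases \<epsilon>) (auto simp: side_rel_def op_side_def)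
  then show ?thesis using u0 b sft_paths_stl[OF u] unfolding join_in_paths half_paths_sft
    by (simp add: sft_paths_Stream)
qed

lemma shift_join_iterate:
  "(shift \<epsilon> ^^ m) (join \<epsilon> u b) = join \<epsilon> (sdrop m u) (rev (stake m u) @- b)"
proof (induction m arbitrary: u b)
  case (Suc m)
  have "(shift \<epsilon> ^^ Suc m) (join \<epsilon> u b) = (shift \<epsilon> ^^ m) (join \<epsilon> (stl u) (shd u ## b))"
    by (simp only: funpow_Suc_right o_apply shift_join)
  then show ?case using Suc by simp
qed simp

lemma shift_join_iterate_in_paths:
  "join \<epsilon> u b \<in> paths G \<Longrightarrow> (shift \<epsilon> ^^ m) (join \<epsilon> u b) \<in> paths G"
proof (induction m arbitrary: u b)
  case (Suc m)
  have "(shift \<epsilon> ^^ Suc m) (join \<epsilon> u b) = (shift \<epsilon> ^^ m) (join \<epsilon> (stl u) (shd u ## b))"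
    by (simp only: funpow_Suc_right o_apply shift_join)
  then show ?case using Suc.IH[OF shift_join_in_paths[OF Suc.prems]] by simp
qed simp

lemma half_extends:
  assumes "u \<in> half_paths G \<epsilon>"
  obtains b where "join \<epsilon> u b \<in> paths G"
proof -
  interpret o: sft E "side_rel (op_side \<epsilon>)" q by (rule sft)
  have "shd u \<in> E" using assms sft.shd_E[OF sft] unfolding half_paths_sft by blast
  then obtain e where e: "e \<in> E" "side_rel (op_side \<epsilon>) (shd u) e" using o.succ by blast
  obtain b where b: "b \<in> sft_paths E (side_rel (op_side \<epsilon>))" "shd b = e" by (rule o.path_from[OF e(1)])
  have "side_rel \<epsilon> (shd b) (shd u)" using e(2) b(2) by (cases \<epsilon>) (auto simp: side_rel_def op_side_def)
  then have "join \<epsilon> u b \<in> paths G" using assms b(1) unfolding join_in_paths half_paths_sft by simp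
  then show thesis by (rule that)
qed

text \<open>After \<open>m\<close> steps the first \<open>m\<close> letters on either side of the base point come from one half.\<close>

lemma reduction_exists:
  assumes "f \<in> loc_const G"
  shows "\<exists>m g. is_reduction G \<epsilon> f m g"
proof -
  obtain k where k: "\<And>p p'. p \<in> paths G \<Longrightarrow> p' \<in> paths G \<Longrightarrow>
     stake k (fst p) = stake k (fst p') \<Longrightarrow> stake k (snd p) = stake k (snd p') \<Longrightarrow> f p = f p'"
    using assms unfolding loc_const_def by blast
  \<comment> \<open>At least \<open>k\<close>, so that the letters moved across fill the whole
    window on the other side, and at least 1, as a reduction demands.\<close>
  define m where "m = Suc k"
  have same: "f ((shift \<epsilon> ^^ m) (join \<epsilon> u b)) = f ((shift \<epsilon> ^^ m) (join \<epsilon> u' b'))"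
    if p: "join \<epsilon> u b \<in> paths G" "join \<epsilon> u' b' \<in> paths G" and eq: "stake (m + k) u = stake (m + k) u'" for u b u' b'
  proof (rule k[OF shift_join_iterate_in_paths[OF p(1)] shift_join_iterate_in_paths[OF p(2)]])
    have 1: "stake k (sdrop m u) = stake k (sdrop m u')"
      using eq unfolding stake_eq_iff by (simp add: sdrop_snth)
    have "stake m u = stake m u'" using eq unfolding stake_eq_iff by simp
    then have 2: "stake k (rev (stake m u) @- b) = stake k (rev (stake m u') @- b')"
      by (simp add: stake_shift m_def)
    show "stake k (fst ((shift \<epsilon> ^^ m) (join \<epsilon> u b))) = stake k (fst ((shift \<epsilon> ^^ m) (join \<epsilon> u' b')))"
      "stake k (snd ((shift \<epsilon> ^^ m) (join \<epsilon> u b))) = stake k (snd ((shift \<epsilon> ^^ m) (join \<epsilon> u' b')))"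
      unfolding shift_join_iterate using 1 2 by (cases \<epsilon>; simp add: join_def)+
  qed
  \<comment> \<open>An arbitrary completion to a bi-infinite path; by \<open>same\<close> the value
    of \<open>g\<close> does not depend on it.\<close>
  define ex where "ex u = (SOME b. join \<epsilon> u b \<in> paths G)" for u
  have ex: "join \<epsilon> u (ex u) \<in> paths G" if u: "u \<in> half_paths G \<epsilon>" for u
  proof -
    obtain b where "join \<epsilon> u b \<in> paths G" by (rule half_extends[OF u])
    then show ?thesis unfolding ex_def by (rule someI)
  qed
  define g where "g u = f ((shift \<epsilon> ^^ m) (join \<epsilon> u (ex u)))" for u
  have "g \<in> loc_const_half G \<epsilon>"
    unfolding loc_const_half_def g_def using same[OF ex ex] by blast
  moreover have "f ((shift \<epsilon> ^^ m) p) = g (half \<epsilon> p)" if p: "p \<in> paths G" for p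
  proof -
    obtain b where b: "p = join \<epsilon> (half \<epsilon> p) b" by (rule join_half)
    then have jp: "join \<epsilon> (half \<epsilon> p) b \<in> paths G" using p by simp
    then have "half \<epsilon> p \<in> half_paths G \<epsilon>" unfolding join_in_paths by blast
    from same[OF jp ex[OF this] refl] show ?thesis unfolding g_def using b by simp
  qed
  ultimately have "is_reduction G \<epsilon> f m g" unfolding is_reduction_def m_def by simp
  then show ?thesis by blast
qed

text \<open>Both sides are power series in \<open>1 / eigval q s\<close>, with coefficient
  \<open>m\<close> the sum over closed paths of length \<open>m\<close> and the trace
  \<open>tr g m\<close> respectively; each equals the sum of \<open>g\<close> over the points of
  period \<open>m\<close>.\<close>

lemma reduction_resolvent:
  assumes f: "f \<in> loc_const G" and red: "is_reduction G \<epsilon> f m g" and \<theta>: "0 < \<theta>" "\<theta> < 1"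
  obtains n adj d where "sft_resolvent E (side_rel \<epsilon>) q n \<theta> adj d"
    "sft_resolvent.depends E (side_rel \<epsilon>) n g"
    "\<And>s. Im s > 3/2 \<Longrightarrow> weighted_zeta G q f s = sft_resolvent.zeta_cont E (side_rel \<epsilon>) q n adj d g s"
proof -
  obtain k where k: "\<forall>p\<in>half_paths G \<epsilon>. \<forall>p'\<in>half_paths G \<epsilon>. stake k p = stake k p' \<longrightarrow> g p = g p'"
    using red unfolding is_reduction_def loc_const_half_def by blast
  \<comment> \<open>The successor secures \<open>n \<ge> 1\<close> even when \<open>g\<close> is
    constant.\<close>
  define n where "n = Suc k"
  obtain adj d where R: "sft_resolvent E (side_rel \<epsilon>) q n \<theta> adj d"
    by (rule sft_resolvent_exists[of n \<theta> \<epsilon>]) (auto simp: n_def \<theta>)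
  interpret sft_resolvent E "side_rel \<epsilon>" q n \<theta> adj d by (rule R)
  have dep: "depends g" unfolding depends_def
  proof (intro ballI impI)
    fix p p' assume p: "p \<in> P" "p' \<in> P" and "stake n p = stake n p'"
    then have "stake k p = stake k p'" unfolding stake_eq_iff by (simp add: n_def)
    then show "g p = g p'" using k p unfolding half_paths_sft by blast
  qed
  have "weighted_zeta G q f s = zeta_cont g s" if s: "Im s > 3/2" for s
  proof -
    define z where "z = of_nat q powr (1/2 + \<i> * s)"
    have z: "norm z * q < 1" unfolding z_def by (rule norm_z_lt[OF s])
    have z_eq: "z = 1 / eigval q s" unfolding z_def by (rule powr_eq_inverse_eigval)
    define h where "h m = z ^ m * (\<Sum>c\<in>closed_paths m. f (periodic_path c))" for m
    have "closed_paths 0 = {}" using closed_path_ne by (auto simp: closed_paths_def)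
    then have h0: "h 0 = 0" by (simp add: h_def)
    have "h sums weighted_zeta G q f s"
      unfolding h_def zeta_absolutely_convergent(2)[OF f s] z_def[symmetric] by (rule path_weight_sums[OF f z])
    then have "(\<lambda>m. h (Suc m)) sums weighted_zeta G q f s" using sums_Suc_iff[of h] h0 by simp
    moreover have "h (Suc m) = tr g (Suc m) / eigval q s ^ Suc m" for m
      unfolding h_def sum_closed_paths_reduction[OF red le_add1[of 1 m, simplified plus_1_eq_Suc]] half_paths_sft
        trace_periodic[OF dep le_add1[of 1 m, simplified plus_1_eq_Suc]]
      by (simp add: z_eq power_divide)
    moreover have "(\<lambda>m. tr g (Suc m) / eigval q s ^ Suc m) sums zeta_cont g s"
      by (rule zeta_cont_sums[OF q dep s])
    ultimately show ?thesis using sums_unique2 by fastforce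
  qed
  then show thesis by (rule that[OF R dep])
qed

end

theorem theorem1:
  fixes G :: "'v pair_pre_digraph"
    and q :: nat
    and f :: "'v edge stream \<times> 'v edge stream \<Rightarrow> complex"
  assumes "q > 1"
    and "pair_graph G"
    and "Digraph_Component.connected (with_proj G)"
    and "\<forall>v\<in>pverts G. out_degree (with_proj G) v = q + 1"
    and "f \<in> loc_const G"
  shows
    "(\<forall>s. Im s > 3/2 \<longrightarrow> (\<lambda>C. norm (zeta_term q f s C)) summable_on primitive_cycles G) \<and>
     (\<forall>\<theta>. 0 < \<theta> \<and> \<theta> < 1 \<longrightarrow>
        (\<exists>Z. is_zeta_continuation G q f \<theta> Z) \<and>
        (\<forall>Z \<epsilon> s\<^sub>0. is_zeta_continuation G q f \<theta> Z \<and> s\<^sub>0 \<in> half_plane q \<theta> \<and> is_pole Z s\<^sub>0 \<longrightarrow>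
           (let P = half_paths G \<epsilon> in
            eigval q s\<^sub>0 \<in> spectrum (lip_space \<theta> P) (lip_norm \<theta> P) (transfer P)))) \<and>
     (\<forall>\<theta> \<epsilon>. 0 < \<theta> \<and> \<theta> < 1 \<longrightarrow>
        (let P = half_paths G \<epsilon>; V = lip_space \<theta> P; N = lip_norm \<theta> P; L = transfer P in
         (\<exists>R. is_resolvent_continuation P q \<theta> R) \<and>
         (\<exists>m g. is_reduction G \<epsilon> f m g) \<and>
         (\<forall>Z R s\<^sub>0 J m g k.
            is_zeta_continuation G q f \<theta> Z \<and> is_resolvent_continuation P q \<theta> R \<and>
            s\<^sub>0 \<in> half_plane q \<theta> \<and> has_pole_of_order V N R s\<^sub>0 J \<and>
            is_reduction G \<epsilon> f m g \<and> k \<le> J \<longrightarrow>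
            (let A = (\<lambda>\<phi>. ((\<lambda>\<psi> p. L \<psi> p - eigval q s\<^sub>0 * \<psi> p) ^^ k)
                          (riesz_projector V N L (eigval q s\<^sub>0) (\<lambda>p. g p * \<phi> p)))
             in finite_rank V A \<and>
                residue (\<lambda>s. Z s * (eigval q s - eigval q s\<^sub>0) ^ k) s\<^sub>0 =
                  \<i> / ln (real q) * finite_rank_trace V A))))"
proof -
  \<comment> \<open>Connectedness in the graph library includes that the vertex set is
    nonempty.\<close>
  have "pverts G \<noteq> {}" using assms(3)
    by (auto simp: Digraph_Component.connected_def strongly_connected_def)
  then interpret regular_graph G q by (intro regular_graph.intro) (use assms in auto)
  note f = assms(5)
  have cont: "(\<exists>Z. is_zeta_continuation G q f \<theta> Z) \<and>
     (\<forall>Z s0. is_zeta_continuation G q f \<theta> Z \<and> s0 \<in> half_plane q \<theta> \<and> is_pole Z s0 \<longrightarrow>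
       eigval q s0 \<in> spectrum (lip_space \<theta> (half_paths G \<epsilon>)) (lip_norm \<theta> (half_paths G \<epsilon>)) (transfer (half_paths G \<epsilon>)))"
    if \<theta>: "0 < \<theta>" "\<theta> < 1" for \<theta> \<epsilon>
  proof -
    obtain m g where red: "is_reduction G \<epsilon> f m g" using reduction_exists[OF f] by blast
    obtain n adj d where R: "sft_resolvent E (side_rel \<epsilon>) q n \<theta> adj d"
      and dep: "sft_resolvent.depends E (side_rel \<epsilon>) n g"
      and zeta: "\<And>s. Im s > 3/2 \<Longrightarrow> weighted_zeta G q f s = sft_resolvent.zeta_cont E (side_rel \<epsilon>) q n adj d g s"
      by (rule reduction_resolvent[OF f red \<theta>], rule that)
    interpret sft_resolvent E "side_rel \<epsilon>" q n \<theta> adj d by (rule R)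
    have zeta_cont: "is_zeta_continuation G q f \<theta> (zeta_cont g)"
      unfolding is_zeta_continuation_def using zeta_cont_meromorphic[OF q] zeta by simp
    have "eigval q s0 \<in> spectrum V N L"
      if Z: "is_zeta_continuation G q f \<theta> Z" and s0: "s0 \<in> half_plane q \<theta>" and pole: "is_pole Z s0" for Z s0
    proof (rule ccontr)
      assume "eigval q s0 \<notin> spectrum V N L"
      \<comment> \<open>Roots of \<open>d\<close> are eigenvalues on \<open>V\<close>, so off the
        spectrum the explicit continuation is analytic.\<close>
      then have "poly d (eigval q s0) \<noteq> 0" using d_root_spectrum by blast
      then have "\<not> is_pole (zeta_cont g) s0" by (rule analytic_at_imp_no_pole[OF zeta_cont_analytic[OF q]])
      moreover have "\<forall>\<^sub>F s in at s0. Z s = zeta_cont g s"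
        by (rule zeta_continuation_unique[OF q \<theta> s0]) (use Z zeta_cont in \<open>auto simp: is_zeta_continuation_def\<close>)
      ultimately show False using pole is_pole_cong by blast
    qed
    then show ?thesis using zeta_cont unfolding half_paths_sft by blast
  qed
  have trace: "finite_rank V A \<and> residue (\<lambda>s. Z s * (eigval q s - eigval q s0) ^ k) s0 = \<i> / ln (real q) * finite_rank_trace V A"
    if \<theta>: "0 < \<theta>" "\<theta> < 1" and Z: "is_zeta_continuation G q f \<theta> Z" and s0: "s0 \<in> half_plane q \<theta>"
      and red: "is_reduction G \<epsilon> f m g" and V: "V = lip_space \<theta> (half_paths G \<epsilon>)"
      and N: "N = lip_norm \<theta> (half_paths G \<epsilon>)" and L: "L = transfer (half_paths G \<epsilon>)"
      and A: "A = (\<lambda>\<phi>. ((\<lambda>\<psi> p. L \<psi> p - eigval q s0 * \<psi> p) ^^ k)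
                          (riesz_projector V N L (eigval q s0) (\<lambda>p. g p * \<phi> p)))"
    for \<theta> \<epsilon> Z s0 m g k V N L A
  proof -
    obtain n adj d where R: "sft_resolvent E (side_rel \<epsilon>) q n \<theta> adj d"
      and dep: "sft_resolvent.depends E (side_rel \<epsilon>) n g"
      and zeta: "\<And>s. Im s > 3/2 \<Longrightarrow> weighted_zeta G q f s = sft_resolvent.zeta_cont E (side_rel \<epsilon>) q n adj d g s"
      by (rule reduction_resolvent[OF f red \<theta>], rule that)
    interpret R: sft_resolvent E "side_rel \<epsilon>" q n \<theta> adj d by (rule R)
    have l0: "norm (eigval q s0) > real q * \<theta>" using s0 half_plane_iff[OF q \<theta>(1)] by simp
    have "\<forall>\<^sub>F s in at s0. Z s = R.zeta_cont g s"
      by (rule zeta_continuation_unique[OF q \<theta> s0])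
        (use Z zeta R.zeta_cont_meromorphic[OF q] in \<open>auto simp: is_zeta_continuation_def\<close>)
    then have "residue (\<lambda>s. Z s * (eigval q s - eigval q s0) ^ k) s0 =
        residue (\<lambda>s. R.zeta_cont g s * (eigval q s - eigval q s0) ^ k) s0"
      by (intro residue_cong refl) (auto elim: eventually_mono)
    also have "\<dots> = \<i> / ln (real q) * residue (\<lambda>l. (l - eigval q s0) ^ k * R.F g l) (eigval q s0)"
      by (rule R.residue_zeta_cont[OF q])
    finally show ?thesis
      using R.trace_formula[OF dep l0, of k] unfolding A V N L half_paths_sft by simp
  qed
  have res: "\<exists>R. is_resolvent_continuation (half_paths G \<epsilon>) q \<theta> R" if \<theta>: "0 < \<theta>" "\<theta> < 1" for \<theta> \<epsilon>
  proof -
    \<comment> \<open>The resolvent does not involve \<open>f\<close>, so the shortest admissible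
      cylinders suffice.\<close>
    obtain adj d where R: "sft_resolvent E (side_rel \<epsilon>) q 1 \<theta> adj d"
      by (rule sft_resolvent_exists[of 1 \<theta> \<epsilon>]) (auto simp: \<theta>)
    interpret R: sft_resolvent E "side_rel \<epsilon>" q 1 \<theta> adj d by (rule R)
    show ?thesis unfolding half_paths_sft using R.resolvent_continuation[OF q] by blast
  qed
  show ?thesis
    unfolding Let_def
    using zeta_absolutely_convergent(1)[OF f] cont trace[OF _ _ _ _ _ refl refl refl refl] res reduction_exists[OF f]
    by blast
qed

end
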